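(* If the Lie algebra $\mathcal N^2_{r,s}$ is isomorphic to the Lie algebra $\mathcal N_{s,r}$, then 1. the Lie algebras $\mathcal N^2_{r,s+8k}$ and $\mathcal N_{s+8k,r}$ are isomorphic; 2. the Lie algebras $\mathcal N^2_{r+8k,s}$ and $\mathcal N_{s,r+8k}$ are isomorphic; 3. the Lie algebras $\mathcal N^2_{r+4k,s+4k}$ and $\mathcal N_{s+4k,r+4k}$ are isomorphic, for any $k=1,2,\dots$.
   Context: $\mathbb R^{r,s}$ denotes $\mathbb R^{r+s}$ with the symmetric bilinear form $\langle x,y\rangle_{r,s}=\sum_{i=1}^r x_iy_i-\sum_{j=1}^s x_{r+j}y_{r+j}$, and $\mathrm{Cl}_{r,s}$ is the Clifford algebra it generates with the convention $x\otimes x=-\langle x,x\rangle_{r,s}$. A $\mathrm{Cl}_{r,s}$-module is a finite-dimensional real vector space $U$ with a linear map $J\colon\mathbb R^{r,s}\to\mathrm{End}(U)$ such that $J_z^2=-\langle z,z\rangle_{r,s}\mathrm{Id}_U$. It is admissible if equipped with a non-degenerate symmetric bilinear form $\langle\cdot,\cdot\rangle_U$ with $\langle J_zx,y\rangle_U+\langle x,J_zy\rangle_U=0$ for all $z,x,y$; minimal admissible (denoted $V^{r,s}$) means (nonzero) admissible of the smallest possible dimension. $\mathcal N_{r,s}(U)=U\oplus\mathbb R^{r,s}$ is the 2-step nilpotent Lie algebra with centre $\mathbb R^{r,s}$ and bracket $[U,U]\subset\mathbb R^{r,s}$ given by $\langle J_zx,y\rangle_U=\langle z,[x,y]\rangle_{r,s}$.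 One writes $\mathcal N_{r,s}=\mathcal N_{r,s}(V^{r,s})$; up to isomorphism this does not depend on the choice of the minimal admissible module. $\mathcal N_{r,s}^2$ denotes the Lie algebra constructed by using the direct sum of two minimal admissible modules: $\mathcal N_{r,s}^2=\mathcal N_{r,s}(V^{r,s}\oplus V^{r,s})$ for $r-s\not\equiv3\pmod 4$; in the cases $r-s\equiv3\pmod4$, where $\mathrm{Cl}_{r,s}$ has two minimal admissible modules $V^{r,s}_{+}$ and $V^{r,s}_{-}$, $\mathcal N_{r,s}^2=\mathcal N_{r,s}(V^{r,s}_+\oplus V^{r,s}_-)$. Here $V^{r,s}_{\pm}$ are the minimal admissible modules on which the volume form $\Omega^{r,s}=\prod_{j=1}^{r+s}J_{z_j}$ ($\{z_j\}$ an orthonormal basis of $\mathbb R^{r,s}$, positive vectors first) acts as $\pm\mathrm{Id}$.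
   Formalization: For r−s≡3 mod 4 the form on V_- is fixed as that of V_+ carried over by J→−J, since N² otherwise depends on the relative sign of the two forms; where V_± do not exist (s odd), N² means N(V⊕V). *)

theory Defs
  imports "HOL-Analysis.Analysis" "HOL-Analysis.Finite_Function_Topology"
begin

definition linear_on :: "'a::real_vector set \<Rightarrow> 'b::real_vector set \<Rightarrow> ('a \<Rightarrow> 'b) \<Rightarrow> bool" where
  "linear_on S T f \<longleftrightarrow>
     (\<forall>x\<in>S. f x \<in> T) \<and>
     (\<forall>x\<in>S. \<forall>y\<in>S. f (x + y) = f x + f y) \<and>
     (\<forall>c. \<forall>x\<in>S. f (c *\<^sub>R x) = c *\<^sub>R f x)"

definition finite_dim_subspace :: "'a::real_vector set \<Rightarrow> bool" where
  "finite_dim_subspace S \<longleftrightarrow> subspace S \<and> (\<exists>B. finite B \<and> span B = S)"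

text \<open>
  Vectors are finitely supported sequences indexed from 0, so that the dimension \<open>r + s\<close> can be an
  ordinary natural number, possibly 0. The first \<open>r\<close> coordinates are the positive ones.
\<close>

definition pseudo_space :: "nat \<Rightarrow> nat \<Rightarrow> (nat \<Rightarrow>\<^sub>0 real) set" where
  "pseudo_space r s = {z. Poly_Mapping.keys z \<subseteq> {..<r + s}}"

definition pseudo_form :: "nat \<Rightarrow> nat \<Rightarrow> (nat \<Rightarrow>\<^sub>0 real) \<Rightarrow> (nat \<Rightarrow>\<^sub>0 real) \<Rightarrow> real" where
  "pseudo_form r s x y =
     (\<Sum>i<r. Poly_Mapping.lookup x i * Poly_Mapping.lookup y i)
     - (\<Sum>j<s. Poly_Mapping.lookup x (r + j) * Poly_Mapping.lookup y (r + j))"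

text \<open>
  The underlying vector space of a module is a finite-dimensional subspace of an arbitrary real
  vector space type. The maps \<open>act\<close> and \<open>form\<close> are only relevant on the respective carriers.
\<close>

record 'a form_module =
  mspace :: "'a set"
  act :: "(nat \<Rightarrow>\<^sub>0 real) \<Rightarrow> 'a \<Rightarrow> 'a"
  form :: "'a \<Rightarrow> 'a \<Rightarrow> real"

definition clifford_module :: "nat \<Rightarrow> nat \<Rightarrow> 'a::real_vector form_module \<Rightarrow> bool" where
  "clifford_module r s U \<longleftrightarrow>
     finite_dim_subspace (mspace U) \<and>
     (\<forall>z\<in>pseudo_space r s. linear_on (mspace U) (mspace U) (act U z)) \<and>
     (\<forall>x\<in>mspace U. linear_on (pseudo_space r s) (mspace U) (\<lambda>z. act U z x)) \<and>
     (\<forall>z\<in>pseudo_space r s. \<forall>x\<in>mspace U. act U z (act U z x) = - pseudo_form r s z z *\<^sub>R x)"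

definition nondegenerate_symmetric :: "'a::real_vector set \<Rightarrow> ('a \<Rightarrow> 'a \<Rightarrow> real) \<Rightarrow> bool" where
  "nondegenerate_symmetric S b \<longleftrightarrow>
     (\<forall>x\<in>S. linear_on S UNIV (b x)) \<and>
     (\<forall>x\<in>S. \<forall>y\<in>S. b x y = b y x) \<and>
     (\<forall>x\<in>S. (\<forall>y\<in>S. b x y = 0) \<longrightarrow> x = 0)"

definition admissible :: "nat \<Rightarrow> nat \<Rightarrow> 'a::real_vector form_module \<Rightarrow> bool" where
  "admissible r s U \<longleftrightarrow>
     clifford_module r s U \<and>
     nondegenerate_symmetric (mspace U) (form U) \<and>
     (\<forall>z\<in>pseudo_space r s. \<forall>x\<in>mspace U. \<forall>y\<in>mspace U.
        form U (act U z x) y + form U x (act U z y) = 0)"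

text \<open>
  Every finite-dimensional real vector space is isomorphic to a subspace of \<open>nat \<Rightarrow>\<^sub>0 real\<close>, so it
  suffices to compare dimensions with admissible modules carried by that type.
\<close>

definition minimal_admissible :: "nat \<Rightarrow> nat \<Rightarrow> 'a::real_vector form_module \<Rightarrow> bool" where
  "minimal_admissible r s U \<longleftrightarrow>
     admissible r s U \<and> mspace U \<noteq> {0} \<and>
     (\<forall>U' :: (nat \<Rightarrow>\<^sub>0 real) form_module.
        admissible r s U' \<and> mspace U' \<noteq> {0} \<longrightarrow> dim (mspace U) \<le> dim (mspace U'))"

definition module_sum ::
    "'a::real_vector form_module \<Rightarrow> 'b::real_vector form_module \<Rightarrow> ('a \<times> 'b) form_module" where
  "module_sum U V =
     \<lparr> mspace = mspace U \<times> mspace V,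
       act = (\<lambda>z (x, y). (act U z x, act V z y)),
       form = (\<lambda>(x, y) (x', y'). form U x x' + form V y y') \<rparr>"

text \<open>The product of the \<open>J\<^sub>z\<close> over the standard basis, positive vectors first.\<close>

definition volume_form :: "nat \<Rightarrow> nat \<Rightarrow> 'a::real_vector form_module \<Rightarrow> 'a \<Rightarrow> 'a" where
  "volume_form r s U x = foldr (\<lambda>j. act U (Poly_Mapping.single j 1)) [0..<r + s] x"

definition minimal_plus :: "nat \<Rightarrow> nat \<Rightarrow> 'a::real_vector form_module \<Rightarrow> bool" where
  "minimal_plus r s U \<longleftrightarrow>
     minimal_admissible r s U \<and> (\<forall>x\<in>mspace U. volume_form r s U x = x)"

definition minimal_minus :: "nat \<Rightarrow> nat \<Rightarrow> 'a::real_vector form_module \<Rightarrow> bool" where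
  "minimal_minus r s U \<longleftrightarrow>
     minimal_admissible r s U \<and> (\<forall>x\<in>mspace U. volume_form r s U x = - x)"

text \<open>
  When \<open>r - s \<equiv> 3 (mod 4)\<close>, the modules \<open>V\<^sub>+\<close> and \<open>V\<^sub>-\<close> exist if and only if \<open>s\<close> is even: for odd
  \<open>s\<close> the volume form is skew for every admissible form, so it cannot act as a scalar.
\<close>

definition two_minimal_modules :: "nat \<Rightarrow> nat \<Rightarrow> bool" where
  "two_minimal_modules r s \<longleftrightarrow>
     (int r - int s) mod 4 = 3 \<and>
     (\<exists>V :: (nat \<Rightarrow>\<^sub>0 real) form_module. minimal_plus r s V) \<and>
     (\<exists>V :: (nat \<Rightarrow>\<^sub>0 real) form_module. minimal_minus r s V)"

text \<open>
  Replacing \<open>J\<close> by \<open>-J\<close> and keeping the form turns \<open>V\<^sub>+\<close> into \<open>V\<^sub>-\<close>. The form on \<open>V\<^sub>-\<close> is normalised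
  to be the one obtained in this way from the form on \<open>V\<^sub>+\<close>. Without this normalisation the sum of
  the two modules is not well defined: for \<open>(r, s) = (3, 0)\<close>, changing the sign of the form on
  \<open>V\<^sub>-\<close> alone gives a Lie algebra isomorphic to the one built from two copies of \<open>V\<^sub>+\<close>, which is
  not isomorphic to the one built from \<open>V\<^sub>+\<close> and \<open>V\<^sub>-\<close> with both forms positive definite.
\<close>

definition opposite_modules ::
    "nat \<Rightarrow> nat \<Rightarrow> 'a::real_vector form_module \<Rightarrow> 'b::real_vector form_module \<Rightarrow> bool" where
  "opposite_modules r s U V \<longleftrightarrow>
     (\<exists>T. linear_on (mspace U) (mspace V) T \<and> bij_betw T (mspace U) (mspace V) \<and>
        (\<forall>z\<in>pseudo_space r s. \<forall>x\<in>mspace U. T (act U z x) = - act V z (T x)) \<and>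
        (\<forall>x\<in>mspace U. \<forall>y\<in>mspace U. form V (T x) (T y) = form U x y))"

definition double_summands ::
    "nat \<Rightarrow> nat \<Rightarrow> 'a::real_vector form_module \<Rightarrow> 'a form_module \<Rightarrow> bool" where
  "double_summands r s V1 V2 \<longleftrightarrow>
     (if two_minimal_modules r s
      then minimal_plus r s V1 \<and> minimal_minus r s V2 \<and> opposite_modules r s V1 V2
      else minimal_admissible r s V1 \<and> V2 = V1)"

record 'a lie_algebra =
  lie_carrier :: "'a set"
  lie_bracket :: "'a \<Rightarrow> 'a \<Rightarrow> 'a"

definition lie_isomorphic ::
    "'a::real_vector lie_algebra \<Rightarrow> 'b::real_vector lie_algebra \<Rightarrow> bool" where
  "lie_isomorphic L M \<longleftrightarrow>
     (\<exists>f. linear_on (lie_carrier L) (lie_carrier M) f \<and>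
        bij_betw f (lie_carrier L) (lie_carrier M) \<and>
        (\<forall>x\<in>lie_carrier L. \<forall>y\<in>lie_carrier L.
           f (lie_bracket L x y) = lie_bracket M (f x) (f y)))"

definition module_bracket ::
    "nat \<Rightarrow> nat \<Rightarrow> 'a::real_vector form_module \<Rightarrow> 'a \<Rightarrow> 'a \<Rightarrow> (nat \<Rightarrow>\<^sub>0 real)" where
  "module_bracket r s U x y =
     (THE w. w \<in> pseudo_space r s \<and>
        (\<forall>z\<in>pseudo_space r s. form U (act U z x) y = pseudo_form r s z w))"

definition pseudo_H_algebra ::
    "nat \<Rightarrow> nat \<Rightarrow> 'a::real_vector form_module \<Rightarrow> ('a \<times> (nat \<Rightarrow>\<^sub>0 real)) lie_algebra" where
  "pseudo_H_algebra r s U =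
     \<lparr> lie_carrier = mspace U \<times> pseudo_space r s,
       lie_bracket = (\<lambda>(x, z) (y, w). (0, module_bracket r s U x y)) \<rparr>"

text \<open>
  \<open>is_N r s L\<close> and \<open>is_N2 r s L\<close> say that \<open>L\<close> is \<open>\<N>\<^bsub>r,s\<^esub>\<close>, respectively \<open>\<N>\<^sup>2\<^bsub>r,s\<^esub>\<close>, built from
  some permitted choice of the minimal modules.
\<close>

definition is_N ::
    "nat \<Rightarrow> nat \<Rightarrow> ('a::real_vector \<times> (nat \<Rightarrow>\<^sub>0 real)) lie_algebra \<Rightarrow> bool" where
  "is_N r s L \<longleftrightarrow> (\<exists>V. minimal_admissible r s V \<and> L = pseudo_H_algebra r s V)"

definition is_N2 ::
    "nat \<Rightarrow> nat \<Rightarrow> (('a::real_vector \<times> 'a) \<times> (nat \<Rightarrow>\<^sub>0 real)) lie_algebra \<Rightarrow> bool" where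
  "is_N2 r s L \<longleftrightarrow>
     (\<exists>V1 V2. double_summands r s V1 V2 \<and> L = pseudo_H_algebra r s (module_sum V1 V2))"

end

theory Submission
  imports Defs
begin

text \<open>
  An isomorphism of the two Lie algebras restricts to linear maps \<open>A\<close> of the modules and \<open>C\<close> of the
  centres. Comparing quadratic equations satisfied by quotients of Clifford operators shows that
  \<open>C\<close> reverses the two scalar products up to a factor, and the isomorphism amounts to a self-adjoint
  invertible \<open>G\<close> on \<open>U = V \<oplus> V\<^sub>2\<close> with \<open>G J\<^sub>z G = - J\<^sub>z\<close>: then \<open>G\<^sup>-\<^sup>1 J\<close> and the form \<open>b (G x) y\<close>
  turn \<open>U\<close> into an admissible module of the opposite signature.

  For the periodicity, four commuting involutions, each a product of four out of the eight new
  generators, cut an admissible module down to their common fixed space, a module over the old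
  generators whose sixteen translates span the large module. Passing to the fixed space preserves
  minimality, and \<open>G\<close> extends from the fixed space by \<open>G J\<^sub>k = - J\<^sub>k G\<^sup>-\<^sup>1\<close>. Working downwards in this
  way needs no explicit module of dimension sixteen. The choices do not matter because an admissible
  module without proper non-degenerate submodules is unique up to the signs of \<open>J\<close> and of the form.
\<close>

section \<open>Finite-dimensional subspaces\<close>

text \<open>The hypothesis concerns one choice of modules and the conclusion every choice, possibly
  over other types, while the dimensions of minimal modules are never computed. Two substitutes
  carry the argument. Minimality is weakened to the absence of proper nondegenerate submodules,
  which can be tested inside a single module. Of the dimensions only one fact is kept, that
  \<open>V \<times> V\<close> and the module of opposite signature are linearly isomorphic; it
  survives the passage to larger signatures, since both sides grow by the same doublings. In the end
  it makes the flipped module minimal again. It also excludes \<open>r = s\<close>, the case in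
  which the law of inertia cannot decide the sign of the factor between the two scalar products.

  The involutions come from words of length four that pairwise meet in two letters: the length makes
  them self-adjoint with square 1, provided the signs along each word multiply to 1, and the even
  intersections make them commute. Four of the eight new generators are recovered from the
  involutions and an odd number of the other four, which is why the relation satisfied by
  \<open>G\<close> reaches them as well.\<close>

lemma finite_dim_subspace_basis:
  assumes "finite_dim_subspace V"
  obtains B where "finite B" "independent B" "span B = V" "card B = dim V"
proof -
  from assms obtain B0 where B0: "finite B0" "span B0 = V"
    by (auto simp: finite_dim_subspace_def)
  obtain B where B: "B \<subseteq> B0" "independent B" "B0 \<subseteq> span B"
    using maximal_independent_subset[of B0] by metis
  have "span B = V"
    using B B0 by (metis span_mono span_span subset_antisym)
  moreover have "finite B" using B B0 finite_subset by blast
  ultimately show ?thesis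
    using that B by (metis dim_span_eq_card_independent)
qed

text \<open>Module structures and isomorphisms are given on their carriers only. Composing with this
  projection turns them into total linear maps that agree with the originals on the carrier.\<close>

lemma subspace_projection:
  fixes V :: "'a::real_vector set"
  assumes "subspace V"
  obtains p :: "'a \<Rightarrow> 'a" where "linear p" "\<And>x. p x \<in> V" "\<And>x. x \<in> V \<Longrightarrow> p x = x"
proof -
  obtain B where B: "B \<subseteq> V" "independent B" "V \<subseteq> span B"
    using maximal_independent_subset[of V] by metis
  obtain p :: "'a \<Rightarrow> 'a" where p: "linear p" "\<forall>x\<in>B. p x = x" "range p = span ((\<lambda>x. x) ` B)"
    using linear_independent_extend_subspace[OF B(2), of "\<lambda>x. x"] by metis
  have sp: "span B = V"
    using B assms by (metis span_minimal subset_antisym)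
  have "p x = x" if "x \<in> span B" for x
    using linear_eq_on[OF p(1) linear_id _ , of x B] that p(2) by auto
  then show ?thesis using that p sp by (metis image_ident rangeI)
qed

lemma finite_dim_subspace_subset:
  assumes "finite_dim_subspace V" "subspace W" "W \<subseteq> V"
  shows "finite_dim_subspace W"
proof -
  obtain B where B: "finite B" "span B = V"
    using assms by (auto simp: finite_dim_subspace_def)
  obtain C where C: "C \<subseteq> W" "independent C" "W \<subseteq> span C"
    using maximal_independent_subset[of W] by metis
  have "finite C" using independent_span_bound[OF B(1) C(2)] C assms B by auto
  moreover have "span C = W" using C assms by (metis span_minimal subset_antisym)
  ultimately show ?thesis using assms(2) by (auto simp: finite_dim_subspace_def)
qed

lemma finite_dim_subspace_dim_mono:
  assumes "finite_dim_subspace V" "subspace W" "W \<subseteq> V"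
  shows "dim W \<le> dim V"
proof -
  obtain B where B: "finite B" "span B = V" "card B = dim V"
    using finite_dim_subspace_basis[OF assms(1)] by metis
  then show ?thesis using dim_le_card[of W B] assms by simp
qed

lemma finite_dim_subspace_dim_eq:
  assumes "finite_dim_subspace V" "subspace W" "W \<subseteq> V" "dim V \<le> dim W"
  shows "W = V"
proof (rule ccontr)
  assume "W \<noteq> V"
  then obtain a where a: "a \<in> V" "a \<notin> W" using assms by auto
  obtain C where C: "finite C" "independent C" "span C = W" "card C = dim W"
    using finite_dim_subspace_basis[OF finite_dim_subspace_subset[OF assms(1-3)]] by metis
  obtain B where B: "finite B" "span B = V" "card B = dim V"
    using finite_dim_subspace_basis[OF assms(1)] by metis
  have "independent (insert a C)" using a C by (simp add: independent_insertI)
  moreover have "insert a C \<subseteq> span B" using a B C assms span_superset by blast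
  ultimately have "card (insert a C) \<le> card B" using independent_span_bound B(1) by blast
  moreover have "a \<notin> C" using a C span_superset by blast
  ultimately show False using C B assms by simp
qed

lemma dim_linear_image:
  assumes "finite_dim_subspace V" "linear f" "inj_on f V"
  shows "dim (f ` V) = dim V" "finite_dim_subspace (f ` V)"
proof -
  obtain B where B: "finite B" "independent B" "span B = V" "card B = dim V"
    using finite_dim_subspace_basis[OF assms(1)] by metis
  have sp: "f ` V = span (f ` B)" using B(3) linear_span_image[OF assms(2)] by metis
  moreover have "independent (f ` B)"
    using linear_independent_injective_image[OF assms(2) B(2)] B(3) assms(3) by simp
  moreover have "card (f ` B) = card B"
    using card_image assms(3) B(3) by (metis inj_on_subset span_superset)
  ultimately show "dim (f ` V) = dim V"
    using B(4) dim_span_eq_card_independent by metis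
  show "finite_dim_subspace (f ` V)"
    unfolding finite_dim_subspace_def using sp B(1) by (metis finite_imageI subspace_span)
qed

lemma lookup_scaleR [simp]:
  "Poly_Mapping.lookup (c *\<^sub>R x :: 'a \<Rightarrow>\<^sub>0 'b::real_vector) i = c *\<^sub>R Poly_Mapping.lookup x i"
  by (simp add: scaleR_poly_mapping_def)

lemma linear_inj_on_iff:
  assumes "linear f" "subspace V"
  shows "inj_on f V \<longleftrightarrow> (\<forall>x\<in>V. f x = 0 \<longrightarrow> x = 0)"
proof
  assume "inj_on f V"
  then show "\<forall>x\<in>V. f x = 0 \<longrightarrow> x = 0"
    using assms by (metis inj_on_contraD linear_0 subspace_0)
next
  assume *: "\<forall>x\<in>V. f x = 0 \<longrightarrow> x = 0"
  show "inj_on f V"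
  proof (rule inj_onI)
    fix x y assume "x \<in> V" "y \<in> V" "f x = f y"
    then have "f (x - y) = 0" "x - y \<in> V"
      using assms by (auto simp: linear_diff subspace_diff)
    then show "x = y" using * by auto
  qed
qed

lemma linear_inj_endo_inverse:
  fixes f :: "'a::real_vector \<Rightarrow> 'a"
  assumes "finite_dim_subspace V" "linear f" "f ` V \<subseteq> V" "\<And>x. x \<in> V \<Longrightarrow> f x = 0 \<Longrightarrow> x = 0"
  obtains g where "linear g" "g ` V \<subseteq> V" "\<And>x. x \<in> V \<Longrightarrow> g (f x) = x" "\<And>x. x \<in> V \<Longrightarrow> f (g x) = x"
proof -
  have sub: "subspace V" using assms(1) by (simp add: finite_dim_subspace_def)
  have inj: "inj_on f V" using linear_inj_on_iff[OF assms(2) sub] assms(4) by blast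
  obtain g where g: "g ` UNIV \<subseteq> V" "linear g" "\<forall>v\<in>V. g (f v) = v"
    using linear_exists_left_inverse_on[OF assms(2) sub inj] by auto
  have "f ` V = V"
    using finite_dim_subspace_dim_eq[OF assms(1) _ assms(3)] dim_linear_image[OF assms(1,2) inj]
    by (simp add: finite_dim_subspace_def)
  then have "f (g x) = x" if "x \<in> V" for x using g that by (metis imageE)
  then show ?thesis using that[of g] g by blast
qed

lemma linear_bij_betw_inverse:
  assumes "subspace V" "linear f" "bij_betw f V W"
  obtains g where "linear g" "bij_betw g W V" "\<And>x. x \<in> V \<Longrightarrow> g (f x) = x" "\<And>y. y \<in> W \<Longrightarrow> f (g y) = y"
proof -
  obtain g where g: "g ` UNIV \<subseteq> V" "linear g" "\<forall>v\<in>V. g (f v) = v"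
    using linear_exists_left_inverse_on[OF assms(2,1)] assms(3) by (auto simp: bij_betw_def)
  have "f (g y) = y" if "y \<in> W" for y using g that assms(3) by (auto simp: bij_betw_def)
  moreover have "bij_betw g W V"
    by (rule bij_betw_byWitness[where f' = f]) (use g assms(3) calculation in \<open>auto simp: bij_betw_def\<close>)
  ultimately show ?thesis using that g by blast
qed

lemma finite_dim_subspace_coordinates:
  fixes V :: "'a::real_vector set"
  assumes "finite_dim_subspace V"
  obtains f :: "'a \<Rightarrow> (nat \<Rightarrow>\<^sub>0 real)" where "linear f" "inj_on f V"
proof -
  obtain B where B: "finite B" "independent B" "span B = V"
    using finite_dim_subspace_basis[OF assms] by metis
  obtain h :: "'a \<Rightarrow> nat" where h: "inj_on h B"
    using finite_imp_inj_to_nat_seg[OF B(1)] by auto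
  obtain f :: "'a \<Rightarrow> (nat \<Rightarrow>\<^sub>0 real)" where f: "linear f" "\<forall>b\<in>B. f b = Poly_Mapping.single (h b) 1"
    using linear_independent_extend[OF B(2), of "\<lambda>b. Poly_Mapping.single (h b) 1"] by auto
  have "x = 0" if x: "x \<in> V" "f x = 0" for x
  proof -
    from x(1) B obtain u where u: "x = (\<Sum>b\<in>B. u b *\<^sub>R b)"
      using span_finite[OF B(1)] by auto
    have "f x = (\<Sum>b\<in>B. u b *\<^sub>R Poly_Mapping.single (h b) 1)"
      using f by (simp add: u linear_sum linear_scale)
    then have z: "(\<Sum>b\<in>B. u b * Poly_Mapping.lookup (Poly_Mapping.single (h b) (1::real)) k) = 0" for k
      using x(2) by (metis (mono_tags, lifting) lookup_scaleR lookup_sum lookup_zero real_scaleR_def sum.cong)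
    have "u b = 0" if "b \<in> B" for b
    proof -
      have "(\<Sum>c\<in>B. u c * Poly_Mapping.lookup (Poly_Mapping.single (h c) (1::real)) (h b))
          = (\<Sum>c\<in>B. if c = b then u c else 0)"
        using h that by (intro sum.cong) (auto simp: lookup_single inj_on_def when_def)
      then show ?thesis using z[of "h b"] that B(1) by simp
    qed
    then show ?thesis by (simp add: u)
  qed
  then have "inj_on f V"
    using linear_inj_on_iff[OF f(1)] assms by (auto simp: finite_dim_subspace_def)
  then show ?thesis using that f(1) by blast
qed

section \<open>Bilinear forms and the operators representing them\<close>

lemma bilinear_linear_left: "bilinear b \<Longrightarrow> linear (\<lambda>x. b x y)"
  by (simp add: bilinear_def)

lemma bilinear_linear_right: "bilinear b \<Longrightarrow> linear (b x)"
  by (simp add: bilinear_def)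

lemma bilinear_compose:
  assumes "bilinear b" "linear f" "linear g"
  shows "bilinear (\<lambda>x y. b (f x) (g y))"
  using linear_compose[OF assms(2) bilinear_linear_left[OF assms(1)]]
    linear_compose[OF assms(3) bilinear_linear_right[OF assms(1)]]
  by (simp add: bilinear_def o_def)

text \<open>The functional \<open>b x\<close> is stored as the vector \<open>F b x\<close> of
  \<open>V\<close> whose coefficients in a basis are the values of \<open>b x\<close> there.
  Nondegeneracy makes \<open>F b\<close> injective, hence invertible on \<open>V\<close>, and
  \<open>S\<close> is \<open>F R\<close> followed by that inverse.\<close>

lemma bilinear_representation:
  fixes b R :: "'a::real_vector \<Rightarrow> 'a \<Rightarrow> real"
  assumes V: "finite_dim_subspace V" and b: "bilinear b" and R: "bilinear R"
    and nd: "\<And>x. x \<in> V \<Longrightarrow> (\<And>y. y \<in> V \<Longrightarrow> b x y = 0) \<Longrightarrow> x = 0"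
  obtains S where "linear S" "S ` V \<subseteq> V" "\<And>x y. x \<in> V \<Longrightarrow> y \<in> V \<Longrightarrow> b (S x) y = R x y"
proof -
  obtain B where B: "finite B" "independent B" "span B = V"
    using finite_dim_subspace_basis[OF V] by metis
  have sub: "subspace V" using V by (simp add: finite_dim_subspace_def)
  have BV: "B \<subseteq> V" using B span_superset by blast
  define F where "F Q x = (\<Sum>c\<in>B. Q x c *\<^sub>R c)" for Q :: "'a \<Rightarrow> 'a \<Rightarrow> real" and x
  have linF: "linear (F Q)" if "bilinear Q" for Q
    unfolding F_def using that
    by (intro linearI) (simp_all add: bilinear_ladd bilinear_lmul scaleR_add_left sum.distrib scaleR_sum_right)
  have FV: "F Q x \<in> V" for Q x
    unfolding F_def using BV by (intro subspace_sum[OF sub] subspace_scale[OF sub]) auto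
  have coeff: "\<forall>c\<in>B. P x c = Q z c" if "F P x = F Q z" for P Q x z
  proof -
    have "(\<Sum>c\<in>B. (P x c - Q z c) *\<^sub>R c) = 0"
      using that by (simp add: F_def scaleR_diff_left sum_subtractf)
    then have "\<forall>c\<in>B. P x c - Q z c = 0"
      using independentD[OF B(2) B(1) subset_refl, of "\<lambda>c. P x c - Q z c"] by blast
    then show ?thesis by simp
  qed
  have ext: "f y = g y" if "linear f" "linear g" "\<forall>c\<in>B. f c = g c" "y \<in> V" for f g :: "'a \<Rightarrow> real" and y
    using linear_eq_on[OF that(1,2), of y B] that B by blast
  have "x = 0" if x: "x \<in> V" "F b x = 0" for x
  proof (rule nd[OF x(1)])
    fix y assume "y \<in> V"
    have "F b x = F (\<lambda>_ _. 0) x" using x by (simp add: F_def)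
    from coeff[OF this] have "\<forall>c\<in>B. b x c = 0" by simp
    then show "b x y = 0"
      using ext[OF bilinear_linear_right[OF b] linear_zero] \<open>y \<in> V\<close> by auto
  qed
  then obtain H where H: "linear H" "H ` V \<subseteq> V" "\<And>x. x \<in> V \<Longrightarrow> F b (H x) = x"
    using linear_inj_endo_inverse[OF V linF[OF b]] FV by (metis image_subsetI)
  show ?thesis
  proof (rule that[of "H \<circ> F R"])
    show "linear (H \<circ> F R)" using H(1) linF[OF R] linear_compose by blast
    show "(H \<circ> F R) ` V \<subseteq> V" using H(2) FV by auto
    fix x y assume "x \<in> V" "y \<in> V"
    have "F b (H (F R x)) = F R x" using H(3) FV by simp
    from ext[OF bilinear_linear_right[OF b] bilinear_linear_right[OF R] coeff[OF this] \<open>y \<in> V\<close>]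
    show "b ((H \<circ> F R) x) y = R x y" by simp
  qed
qed

section \<open>Inner products\<close>

text \<open>
  The last conjunct holds for every inner product on a finite-dimensional space. Carrying it along
  replaces a compactness argument.
\<close>

definition dominating_form :: "'a::real_vector set \<Rightarrow> ('a \<Rightarrow> 'a \<Rightarrow> real) \<Rightarrow> bool" where
  "dominating_form V P \<longleftrightarrow> bilinear P \<and> (\<forall>x\<in>V. \<forall>y\<in>V. P x y = P y x) \<and>
     (\<forall>x\<in>V. x \<noteq> 0 \<longrightarrow> 0 < P x x) \<and>
     (\<forall>R. bilinear R \<longrightarrow> (\<exists>M. \<forall>x\<in>V. \<bar>R x x\<bar> \<le> M * P x x))"

text \<open>The standard inner product of a basis works: a product of two coordinates of
  \<open>x\<close> is at most \<open>P x x\<close> in absolute value, so the sum of the absolute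
  values of the coefficients of \<open>R\<close> serves as the bound.\<close>

lemma dominating_form_exists:
  fixes V :: "'a::real_vector set"
  assumes "finite_dim_subspace V"
  obtains P where "dominating_form V P"
proof -
  obtain B where B: "finite B" "independent B" "span B = V"
    using finite_dim_subspace_basis[OF assms] by metis
  have "\<exists>f :: 'a \<Rightarrow> real. linear f \<and> (\<forall>c\<in>B. f c = (if c = d then 1 else 0))" for d
    using linear_independent_extend[OF B(2), of "\<lambda>c. if c = d then 1 else (0::real)"] by auto
  then obtain u :: "'a \<Rightarrow> 'a \<Rightarrow> real" where u: "\<And>d. linear (u d)"
      "\<And>c d. c \<in> B \<Longrightarrow> u d c = (if c = d then 1 else 0)" by metis
  have rep: "x = (\<Sum>d\<in>B. u d x *\<^sub>R d)" if "x \<in> V" for x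
  proof -
    have "(\<lambda>x. x) x = (\<lambda>x. \<Sum>d\<in>B. u d x *\<^sub>R d) x"
    proof (rule linear_eq_on[where B = B and f = "\<lambda>x. x" and g = "\<lambda>x. \<Sum>d\<in>B. u d x *\<^sub>R d"])
      show "linear (\<lambda>x. \<Sum>d\<in>B. u d x *\<^sub>R d)"
        using u(1) by (intro linearI)
          (simp_all add: linear_add linear_scale scaleR_add_left sum.distrib scaleR_sum_right)
      show "x \<in> span B" using that B by simp
      show "c = (\<Sum>d\<in>B. u d c *\<^sub>R d)" if "c \<in> B" for c
        using that B(1) by (simp add: u(2) if_distrib[of "\<lambda>t. t *\<^sub>R _"] cong: if_cong)
    qed (rule linear_ident)
    then show ?thesis by simp
  qed
  define P where "P x y = (\<Sum>d\<in>B. u d x * u d y)" for x y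
  have "bilinear P"
    unfolding bilinear_def P_def using u(1)
    by (auto intro!: linearI simp: linear_add linear_scale algebra_simps sum.distrib sum_distrib_left)
  moreover have "\<forall>x\<in>V. \<forall>y\<in>V. P x y = P y x" by (simp add: P_def mult.commute)
  moreover have "0 < P x x" if x: "x \<in> V" "x \<noteq> 0" for x
  proof -
    have "(\<Sum>d\<in>B. u d x *\<^sub>R d) \<noteq> 0" using rep[OF x(1)] x(2) by simp
    then obtain d where d: "d \<in> B" "u d x \<noteq> 0"
      by (metis (no_types, lifting) scaleR_eq_0_iff sum.not_neutral_contains_not_neutral)
    then have "0 < u d x * u d x" by (metis not_real_square_gt_zero)
    then show ?thesis unfolding P_def using d(1) B(1)
      by (meson sum_pos2 zero_le_square)
  qed
  moreover have "\<exists>M. \<forall>x\<in>V. \<bar>R x x\<bar> \<le> M * P x x" if R: "bilinear R" for R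
  proof (intro exI ballI)
    fix x assume x: "x \<in> V"
    have sq: "\<bar>u d x\<bar> * \<bar>u c x\<bar> \<le> P x x" if "c \<in> B" "d \<in> B" for c d
    proof -
      have le: "u e x * u e x \<le> P x x" if "e \<in> B" for e
        unfolding P_def using that B(1) by (intro member_le_sum[of e B "\<lambda>e. u e x * u e x"]) auto
      have "2 * (\<bar>u d x\<bar> * \<bar>u c x\<bar>) \<le> u d x * u d x + u c x * u c x"
        using zero_le_square[of "\<bar>u d x\<bar> - \<bar>u c x\<bar>"] by (simp add: algebra_simps)
      then show ?thesis using le[OF that(1)] le[OF that(2)] by linarith
    qed
    have "R x x = R (\<Sum>d\<in>B. u d x *\<^sub>R d) (\<Sum>c\<in>B. u c x *\<^sub>R c)" using rep[OF x] by simp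
    also have "\<dots> = (\<Sum>d\<in>B. \<Sum>c\<in>B. u d x * (u c x * R d c))"
      unfolding linear_sum[OF bilinear_linear_left[OF R], of _ B] linear_sum[OF bilinear_linear_right[OF R], of _ _ B]
      by (subst sum.swap) (simp add: bilinear_lmul[OF R] bilinear_rmul[OF R] algebra_simps)
    finally have "\<bar>R x x\<bar> \<le> (\<Sum>d\<in>B. \<bar>\<Sum>c\<in>B. u d x * (u c x * R d c)\<bar>)" by simp
    also have "\<dots> \<le> (\<Sum>d\<in>B. \<Sum>c\<in>B. \<bar>u d x * (u c x * R d c)\<bar>)" by (intro sum_mono sum_abs)
    also have "\<dots> \<le> (\<Sum>d\<in>B. \<Sum>c\<in>B. \<bar>R d c\<bar> * P x x)"
    proof (intro sum_mono)
      fix d c assume "d \<in> B" "c \<in> B"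
      then have "\<bar>R d c\<bar> * (\<bar>u d x\<bar> * \<bar>u c x\<bar>) \<le> \<bar>R d c\<bar> * P x x"
        using sq by (intro mult_left_mono) auto
      then show "\<bar>u d x * (u c x * R d c)\<bar> \<le> \<bar>R d c\<bar> * P x x"
        by (simp add: abs_mult mult_ac)
    qed
    finally show "\<bar>R x x\<bar> \<le> (\<Sum>d\<in>B. \<Sum>c\<in>B. \<bar>R d c\<bar>) * P x x"
      by (simp add: sum_distrib_right)
  qed
  ultimately have "dominating_form V P" by (simp add: dominating_form_def)
  then show ?thesis using that by blast
qed

text \<open>One averaging step. The quadratic form only grows, so an old bound, made nonnegative,
  remains valid.\<close>

lemma dominating_form_add_pullback:
  assumes "dominating_form V P" "linear f" "f ` V \<subseteq> V"
  shows "dominating_form V (\<lambda>x y. P x y + P (f x) (f y))"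
proof -
  have P: "bilinear P" and sym: "\<And>x y. x \<in> V \<Longrightarrow> y \<in> V \<Longrightarrow> P x y = P y x"
    and pos: "\<And>x. x \<in> V \<Longrightarrow> x \<noteq> 0 \<Longrightarrow> 0 < P x x"
    and dom: "\<And>R. bilinear R \<Longrightarrow> \<exists>M. \<forall>x\<in>V. \<bar>R x x\<bar> \<le> M * P x x"
    using assms(1) by (auto simp: dominating_form_def)
  have nn: "0 \<le> P (f x) (f x)" if "x \<in> V" for x
    using that assms(3) pos[of "f x"] bilinear_lzero[OF P] by (cases "f x = 0") fastforce+
  have "bilinear (\<lambda>x y. P x y + P (f x) (f y))"
    using P bilinear_compose[OF P assms(2,2)] unfolding bilinear_def
    by (auto intro: linear_compose_add)
  moreover have "\<exists>M. \<forall>x\<in>V. \<bar>R x x\<bar> \<le> M * (P x x + P (f x) (f x))" if R: "bilinear R" for R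
  proof -
    obtain M where M: "\<forall>x\<in>V. \<bar>R x x\<bar> \<le> M * P x x" using dom[OF R] by auto
    have "\<bar>R x x\<bar> \<le> \<bar>M\<bar> * (P x x + P (f x) (f x))" if "x \<in> V" for x
    proof -
      have "0 \<le> P x x" using pos[of x] that bilinear_lzero[OF P] by (cases "x = 0") fastforce+
      then have "M * P x x \<le> \<bar>M\<bar> * P x x" by (simp add: mult_right_mono)
      moreover have "0 \<le> \<bar>M\<bar> * P (f x) (f x)" using nn[OF that] by simp
      ultimately show ?thesis using M that by (fastforce simp: distrib_left)
    qed
    then show ?thesis by blast
  qed
  ultimately show ?thesis
    unfolding dominating_form_def using sym pos nn assms(3)
    by (auto simp: image_subset_iff add_pos_nonneg)
qed

lemma dominating_form_scale:
  assumes "dominating_form V P" "0 < c"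
  shows "dominating_form V (\<lambda>x y. c * P x y)"
proof -
  have P: "bilinear P" and dom: "\<And>R. bilinear R \<Longrightarrow> \<exists>M. \<forall>x\<in>V. \<bar>R x x\<bar> \<le> M * P x x"
    using assms(1) by (auto simp: dominating_form_def)
  have "\<exists>M. \<forall>x\<in>V. \<bar>R x x\<bar> \<le> M * (c * P x x)" if R: "bilinear R" for R
  proof -
    obtain M where "\<forall>x\<in>V. \<bar>R x x\<bar> \<le> M * P x x" using dom[OF R] by auto
    then have "\<forall>x\<in>V. \<bar>R x x\<bar> \<le> (M / c) * (c * P x x)" using assms(2) by simp
    then show ?thesis by blast
  qed
  moreover have "bilinear (\<lambda>x y. c * P x y)"
    unfolding bilinear_def
    by (auto intro!: linearI simp: bilinear_ladd[OF P] bilinear_radd[OF P] bilinear_lmul[OF P]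
        bilinear_rmul[OF P] algebra_simps)
  ultimately show ?thesis using assms by (simp add: dominating_form_def)
qed

text \<open>The eigenvalue is the largest \<open>t\<close> with \<open>P (S x) x \<ge> t * P x x\<close> on \<open>V\<close>.\<close>

lemma dominating_form_eigenvector:
  fixes V :: "'a::real_vector set"
  assumes V: "finite_dim_subspace V" "V \<noteq> {0}" and dom: "dominating_form V P"
    and S: "linear S" "S ` V \<subseteq> V" and sa: "\<And>x y. x \<in> V \<Longrightarrow> y \<in> V \<Longrightarrow> P (S x) y = P x (S y)"
  obtains m x where "x \<in> V" "x \<noteq> 0" "S x = m *\<^sub>R x"
proof -
  have P: "bilinear P" and sym: "\<And>x y. x \<in> V \<Longrightarrow> y \<in> V \<Longrightarrow> P x y = P y x"
    and pos: "\<And>x. x \<in> V \<Longrightarrow> x \<noteq> 0 \<Longrightarrow> 0 < P x x"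
    and bd: "\<And>R. bilinear R \<Longrightarrow> \<exists>M. \<forall>x\<in>V. \<bar>R x x\<bar> \<le> M * P x x"
    using dom by (auto simp: dominating_form_def)
  have sub: "subspace V" using V(1) by (simp add: finite_dim_subspace_def)
  have nn: "0 \<le> P x x" if "x \<in> V" for x
    using pos[of x] that bilinear_lzero[OF P] by (cases "x = 0") fastforce+
  obtain M where M: "\<forall>x\<in>V. \<bar>P (S x) x\<bar> \<le> M * P x x"
    using bd[OF bilinear_compose[OF P S(1) linear_ident]] by blast
  obtain x0 where x0: "x0 \<in> V" "x0 \<noteq> 0" using V(2) subspace_0[OF sub] by auto
  define X where "X = {t. \<forall>x\<in>V. t * P x x \<le> P (S x) x}"
  have "- M \<in> X" using M unfolding X_def by (auto simp: abs_le_iff)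
  moreover have ub: "t \<le> P (S x) x / P x x" if "t \<in> X" "x \<in> V" "x \<noteq> 0" for t x
    using that pos unfolding X_def by (simp add: pos_le_divide_eq)
  then have bdd: "bdd_above X" using x0 by (meson bdd_aboveI)
  define m where "m = Sup X"
  have mX: "m \<in> X"
  proof -
    have "m * P x x \<le> P (S x) x" if "x \<in> V" for x
    proof (cases "x = 0")
      case False
      have "m \<le> P (S x) x / P x x" unfolding m_def
        using \<open>- M \<in> X\<close> ub that False by (intro cSup_least) auto
      then show ?thesis using pos[OF that False] by (simp add: pos_le_divide_eq)
    qed (simp add: bilinear_lzero[OF P] bilinear_rzero[OF P])
    then show ?thesis by (simp add: X_def)
  qed
  define D where "D x = S x - m *\<^sub>R x" for x
  have D: "linear D" unfolding D_def using S(1)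
    by (intro linear_compose_sub) (auto simp: linear_scale_self)
  have DV: "D ` V \<subseteq> V" unfolding D_def using S(2) sub
    by (auto intro!: subspace_diff subspace_scale)
  have Dsa: "P (D x) y = P x (D y)" if "x \<in> V" "y \<in> V" for x y
    using sa[OF that] by (simp add: D_def bilinear_lsub[OF P] bilinear_rsub[OF P] bilinear_lmul[OF P] bilinear_rmul[OF P])
  have Dpsd: "0 \<le> P (D x) x" if "x \<in> V" for x
    using mX that unfolding X_def D_def by (simp add: bilinear_lsub[OF P] bilinear_lmul[OF P])
  \<comment> \<open>Otherwise \<open>D\<close> has an inverse \<open>H\<close> on \<open>V\<close>.
    Positivity of \<open>D\<close> at \<open>x - t *\<^sub>R H x\<close> with
    \<open>t = 1 / K\<close> yields \<open>P x x / K \<le> P (D x) x\<close>, so that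
    \<open>m + 1 / K\<close> would still belong to \<open>X\<close>, although \<open>m\<close> is
    its supremum.\<close>
  have "\<exists>x\<in>V. x \<noteq> 0 \<and> D x = 0"
  proof (rule ccontr)
    assume "\<not> (\<exists>x\<in>V. x \<noteq> 0 \<and> D x = 0)"
    then obtain H where H: "linear H" "H ` V \<subseteq> V" "\<And>x. x \<in> V \<Longrightarrow> D (H x) = x"
      using linear_inj_endo_inverse[OF V(1) D DV] by metis
    obtain N where N: "\<forall>x\<in>V. \<bar>P x (H x)\<bar> \<le> N * P x x"
      using bd[OF bilinear_compose[OF P linear_ident H(1)]] by blast
    define K where "K = \<bar>N\<bar> + 1"
    have K: "0 < K" "P x (H x) \<le> K * P x x" if "x \<in> V" for x
    proof -
      show "0 < K" by (simp add: K_def)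
      have "N * P x x \<le> K * P x x" unfolding K_def using nn[OF that] by (intro mult_right_mono) auto
      then show "P x (H x) \<le> K * P x x" using N that by fastforce
    qed
    have "P x x / K \<le> P (D x) x" if x: "x \<in> V" for x
    proof -
      define t where "t = 1 / K"
      have HV: "H x \<in> V" using H(2) x by auto
      then have v: "x - t *\<^sub>R H x \<in> V" using sub x by (auto intro!: subspace_diff subspace_scale)
      have "P (D (x - t *\<^sub>R H x)) (x - t *\<^sub>R H x)
          = P (D x) x - t * P (D x) (H x) - t * P (D (H x)) x + t * t * P (D (H x)) (H x)"
        by (simp add: linear_diff[OF D] linear_scale[OF D] bilinear_lsub[OF P] bilinear_rsub[OF P]
            bilinear_lmul[OF P] bilinear_rmul[OF P] algebra_simps)
      also have "\<dots> = P (D x) x - 2 * t * P x x + t * t * P x (H x)"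
        using Dsa[OF x HV] H(3)[OF x] by simp
      finally have "2 * t * P x x \<le> P (D x) x + t * t * P x (H x)" using Dpsd[OF v] by simp
      moreover have "t * t * P x (H x) \<le> t * t * (K * P x x)"
        using K[OF x] by (intro mult_left_mono) auto
      moreover have "t * t * (K * P x x) = t * P x x" using K(1)[OF x] by (simp add: t_def)
      ultimately show ?thesis by (simp add: t_def)
    qed
    then have "(m + 1 / K) * P x x \<le> P (S x) x" if "x \<in> V" for x
      using that unfolding D_def
      by (fastforce simp: bilinear_lsub[OF P] bilinear_lmul[OF P] distrib_right)
    then have "m + 1 / K \<in> X" by (simp add: X_def)
    then have "m + 1 / K \<le> m" unfolding m_def using bdd cSup_upper by blast
    then show False using K(1)[OF x0(1)] by simp
  qed
  then show ?thesis using that unfolding D_def by (metis eq_iff_diff_eq_0)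
qed

section \<open>Clifford modules with an admissible form\<close>

text \<open>Operators and form are linear everywhere, while the Clifford relations are demanded on
  \<open>V\<close> only. Passing to an invariant nondegenerate subspace, or dropping generators,
  keeps \<open>J\<close> and \<open>b\<close> and changes just \<open>V\<close> and
  \<open>I\<close>.\<close>

locale clifford_form =
  fixes I :: "'i set" and e :: "'i \<Rightarrow> real" and V :: "'a::real_vector set"
    and J :: "'i \<Rightarrow> 'a \<Rightarrow> 'a" and b :: "'a \<Rightarrow> 'a \<Rightarrow> real"
  assumes finI: "finite I"
    and fdV: "finite_dim_subspace V"
    and sign: "i \<in> I \<Longrightarrow> e i = 1 \<or> e i = - 1"
    and linJ: "i \<in> I \<Longrightarrow> linear (J i)"
    and JV: "i \<in> I \<Longrightarrow> x \<in> V \<Longrightarrow> J i x \<in> V"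
    and sqJ: "i \<in> I \<Longrightarrow> x \<in> V \<Longrightarrow> J i (J i x) = - e i *\<^sub>R x"
    and antiJ: "i \<in> I \<Longrightarrow> j \<in> I \<Longrightarrow> i \<noteq> j \<Longrightarrow> x \<in> V \<Longrightarrow> J i (J j x) = - J j (J i x)"
    and bil: "bilinear b"
    and sym: "x \<in> V \<Longrightarrow> y \<in> V \<Longrightarrow> b x y = b y x"
    and nondeg: "x \<in> V \<Longrightarrow> (\<And>y. y \<in> V \<Longrightarrow> b x y = 0) \<Longrightarrow> x = 0"
    and skewJ: "i \<in> I \<Longrightarrow> x \<in> V \<Longrightarrow> y \<in> V \<Longrightarrow> b (J i x) y = - b x (J i y)"
begin

lemma subV: "subspace V" using fdV by (simp add: finite_dim_subspace_def)

lemma sign_sq [simp]: "i \<in> I \<Longrightarrow> e i * e i = 1" using sign by fastforce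

lemma J_eq_0: "i \<in> I \<Longrightarrow> x \<in> V \<Longrightarrow> J i x = 0 \<Longrightarrow> x = 0"
  using sqJ[of i x] sign[of i] linear_0[OF linJ[of i]] by auto

lemma isoJ: "i \<in> I \<Longrightarrow> x \<in> V \<Longrightarrow> y \<in> V \<Longrightarrow> b (J i x) (J i y) = e i * b x y"
  by (simp add: skewJ JV sqJ bilinear_rmul[OF bil] bilinear_rneg[OF bil])

text \<open>This averages over the group generated by the \<open>J i\<close>, one generator at a
  time. As \<open>J a\<close> squares to a sign, the sum of \<open>P\<close> and its pullback along
  \<open>J a\<close> is invariant under \<open>J a\<close>. Invariance under the earlier
  \<open>J i\<close> survives, because exchanging \<open>J i\<close> with \<open>J a\<close> costs a
  sign in both arguments.\<close>

lemma invariant_dominating_form: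
  obtains P where "dominating_form V P"
    "\<And>i x y. i \<in> I \<Longrightarrow> x \<in> V \<Longrightarrow> y \<in> V \<Longrightarrow> P (J i x) (J i y) = P x y"
proof -
  have *: "\<exists>P. dominating_form V P \<and> (\<forall>i\<in>A. \<forall>x\<in>V. \<forall>y\<in>V. P (J i x) (J i y) = P x y)"
    if "finite A" "A \<subseteq> I" for A
    using that
  proof (induction A rule: finite_induct)
    case empty
    then show ?case using dominating_form_exists[OF fdV] by auto
  next
    case (insert a A)
    then obtain P where P: "dominating_form V P"
        "\<And>i x y. i \<in> A \<Longrightarrow> x \<in> V \<Longrightarrow> y \<in> V \<Longrightarrow> P (J i x) (J i y) = P x y" by auto
    have a: "a \<in> I" and A: "A \<subseteq> I" using insert.prems by blast+
    have bP: "bilinear P" using P(1) by (simp add: dominating_form_def)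
    define Q where "Q x y = P x y + P (J a x) (J a y)" for x y
    have "dominating_form V Q"
      unfolding Q_def using linJ[OF a] JV[OF a] by (intro dominating_form_add_pullback[OF P(1)]) auto
    moreover have "Q (J a x) (J a y) = Q x y" if "x \<in> V" "y \<in> V" for x y
      using that a by (simp add: Q_def sqJ bilinear_lneg[OF bP] bilinear_rneg[OF bP]
          bilinear_lmul[OF bP] bilinear_rmul[OF bP] mult.assoc[symmetric])
    moreover have "Q (J i x) (J i y) = Q x y" if "i \<in> A" "x \<in> V" "y \<in> V" for x y i
    proof -
      have i: "i \<in> I" "i \<noteq> a" using that A insert.hyps by auto
      have "P (J a (J i x)) (J a (J i y)) = P (J i (J a x)) (J i (J a y))"
        using i that a by (simp add: antiJ[of a i] bilinear_lneg[OF bP] bilinear_rneg[OF bP])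
      then show ?thesis using that P(2) JV[OF a] by (simp add: Q_def)
    qed
    ultimately show ?case by (intro exI[of _ Q]) simp
  qed
  from *[OF finI subset_refl] obtain P where "dominating_form V P"
      "\<forall>i\<in>I. \<forall>x\<in>V. \<forall>y\<in>V. P (J i x) (J i y) = P x y" by (elim exE conjE)
  then show ?thesis by (intro that[of P]) simp_all
qed

end

text \<open>Irreducibility relative to \<open>b\<close>: a minimal admissible module may well have
  proper submodules on which \<open>b\<close> degenerates, so only nondegenerate ones are excluded.
  The operators are an argument because the periodicity step enlarges their set by
  involutions.\<close>

definition simple_form ::
    "'a::real_vector set \<Rightarrow> ('a \<Rightarrow> 'a) set \<Rightarrow> ('a \<Rightarrow> 'a \<Rightarrow> real) \<Rightarrow> bool" where
  "simple_form V \<S> b \<longleftrightarrow> V \<noteq> {0} \<and>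
     (\<forall>W. subspace W \<and> W \<subseteq> V \<and> W \<noteq> {0} \<and> (\<forall>f\<in>\<S>. f ` W \<subseteq> W) \<and>
        (\<forall>x\<in>W. (\<forall>y\<in>W. b x y = 0) \<longrightarrow> x = 0) \<longrightarrow> W = V)"

lemma simple_formD:
  assumes "simple_form V \<S> b" "subspace W" "W \<subseteq> V" "x \<in> W" "x \<noteq> 0"
    "\<And>f x. f \<in> \<S> \<Longrightarrow> x \<in> W \<Longrightarrow> f x \<in> W"
    "\<And>x. x \<in> W \<Longrightarrow> (\<And>y. y \<in> W \<Longrightarrow> b x y = 0) \<Longrightarrow> x = 0"
  shows "W = V"
proof -
  have "W \<noteq> {0}" using assms(4,5) by auto
  then show ?thesis using assms(1,2,3,6,7) unfolding simple_form_def by (metis image_subsetI)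
qed

context clifford_form begin

text \<open>An eigenspace \<open>W\<close> of \<open>S\<close> is stable under the
  \<open>J i\<close> and under \<open>B\<close>. The latter makes \<open>b\<close> nondegenerate on
  \<open>W\<close>: with \<open>x\<close> also \<open>B x\<close> lies in \<open>W\<close>, and
  \<open>b x (B x) = P (B x) (B x)\<close> is positive unless \<open>x = 0\<close>. Simplicity
  forces \<open>W = V\<close>.\<close>

lemma schur:
  assumes simple: "simple_form V (J ` I) b" and dom: "dominating_form V P"
    and B: "linear B" "B ` V \<subseteq> V" "\<And>x y. x \<in> V \<Longrightarrow> y \<in> V \<Longrightarrow> P (B x) y = b x y"
    and S: "linear S" "S ` V \<subseteq> V" "\<And>x y. x \<in> V \<Longrightarrow> y \<in> V \<Longrightarrow> P (S x) y = P x (S y)"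
    and SJ: "\<And>i x. i \<in> I \<Longrightarrow> x \<in> V \<Longrightarrow> S (J i x) = J i (S x)"
    and SB: "\<And>x. x \<in> V \<Longrightarrow> S (B x) = B (S x)"
  obtains m where "\<And>x. x \<in> V \<Longrightarrow> S x = m *\<^sub>R x"
proof -
  have "V \<noteq> {0}" using simple by (simp add: simple_form_def)
  then obtain m v where v: "v \<in> V" "v \<noteq> 0" "S v = m *\<^sub>R v"
    using dominating_form_eigenvector[OF fdV _ dom S] by metis
  define W where "W = {x\<in>V. S x = m *\<^sub>R x}"
  have "W = V"
  proof (rule simple_formD[OF simple _ _ _ v(2)])
    show "subspace W"
      unfolding W_def subspace_def using subV linear_0[OF S(1)]
      by (auto simp: subspace_0 subspace_add subspace_scale linear_add[OF S(1)] linear_scale[OF S(1)]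
          scaleR_add_right)
    show "W \<subseteq> V" by (auto simp: W_def)
    show "v \<in> W" using v by (simp add: W_def)
    show "f x \<in> W" if "f \<in> J ` I" "x \<in> W" for f x
      using that SJ JV by (auto simp: W_def linear_scale[OF linJ])
    show "x = 0" if x: "x \<in> W" "\<And>y. y \<in> W \<Longrightarrow> b x y = 0" for x
    proof (rule ccontr)
      assume "x \<noteq> 0"
      have xV: "x \<in> V" and Sx: "S x = m *\<^sub>R x" using x(1) by (auto simp: W_def)
      have BxV: "B x \<in> V" using B(2) xV by auto
      have "B x \<noteq> 0"
      proof
        assume "B x = 0"
        then have "b x y = 0" if "y \<in> V" for y
          using B(3)[OF xV that] dom by (simp add: dominating_form_def bilinear_lzero)
        then show False using nondeg[OF xV] \<open>x \<noteq> 0\<close> by auto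
      qed
      have "B x \<in> W" using SB[OF xV] Sx BxV by (simp add: W_def linear_scale[OF B(1)])
      then have "P (B x) (B x) = 0" using x(2) B(3)[OF xV BxV] by simp
      moreover have "\<forall>z\<in>V. z \<noteq> 0 \<longrightarrow> 0 < P z z" using dom by (simp add: dominating_form_def)
      ultimately show False using BxV \<open>B x \<noteq> 0\<close> by fastforce
    qed
  qed
  then show ?thesis using that by (auto simp: W_def)
qed

text \<open>
  If \<open>P\<close> is Clifford invariant and \<open>b x y = P (B x) y\<close>, then \<open>B\<close> commutes or anticommutes with each
  \<open>J i\<close>, so \<open>B \<circ> B\<close> is scalar.
\<close>

lemma polar_form:
  assumes simple: "simple_form V (J ` I) b"
  obtains P B where "dominating_form V P"
    "\<And>i x y. i \<in> I \<Longrightarrow> x \<in> V \<Longrightarrow> y \<in> V \<Longrightarrow> P (J i x) y = - e i * P x (J i y)"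
    "linear B" "B ` V \<subseteq> V" "\<And>x y. x \<in> V \<Longrightarrow> y \<in> V \<Longrightarrow> P (B x) y = b x y"
    "\<And>x. x \<in> V \<Longrightarrow> B (B x) = x"
    "\<And>i x. i \<in> I \<Longrightarrow> x \<in> V \<Longrightarrow> B (J i x) = e i *\<^sub>R J i (B x)"
proof -
  obtain P where dom: "dominating_form V P"
    and invP: "\<And>i x y. i \<in> I \<Longrightarrow> x \<in> V \<Longrightarrow> y \<in> V \<Longrightarrow> P (J i x) (J i y) = P x y"
    using invariant_dominating_form by metis
  have bP: "bilinear P" and symP: "\<And>x y. x \<in> V \<Longrightarrow> y \<in> V \<Longrightarrow> P x y = P y x"
    and pos: "\<And>x. x \<in> V \<Longrightarrow> x \<noteq> 0 \<Longrightarrow> 0 < P x x"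
    using dom by (auto simp: dominating_form_def)
  have ndP: "x = 0" if "x \<in> V" "\<And>y. y \<in> V \<Longrightarrow> P x y = 0" for x
    using that pos by force
  have PJ: "P (J i x) y = - e i * P x (J i y)" if "i \<in> I" "x \<in> V" "y \<in> V" for i x y
  proof -
    have "P x (J i y) = P (J i x) (J i (J i y))" using invP that JV by simp
    also have "\<dots> = - e i * P (J i x) y" using that by (simp add: sqJ bilinear_rmul[OF bP] bilinear_rneg[OF bP])
    finally show ?thesis using sign_sq[OF that(1)] by simp
  qed
  have eq: "u = v" if "u \<in> V" "v \<in> V" "\<And>y. y \<in> V \<Longrightarrow> P u y = P v y" for u v
    using ndP[of "u - v"] that subV by (auto simp: subspace_diff bilinear_lsub[OF bP])
  obtain B where B: "linear B" "B ` V \<subseteq> V" "\<And>x y. x \<in> V \<Longrightarrow> y \<in> V \<Longrightarrow> P (B x) y = b x y"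
    using bilinear_representation[OF fdV bP bil ndP] by metis
  have BV: "B x \<in> V" if "x \<in> V" for x using B(2) that by auto
  have Bsa: "P (B x) y = P x (B y)" if "x \<in> V" "y \<in> V" for x y
    using that B(3) sym symP BV by metis
  have BJ: "B (J i x) = e i *\<^sub>R J i (B x)" if "i \<in> I" "x \<in> V" for i x
  proof (rule eq)
    show "B (J i x) \<in> V" "e i *\<^sub>R J i (B x) \<in> V" using that BV JV subV by (auto simp: subspace_scale)
    fix y assume y: "y \<in> V"
    have "P (B (J i x)) y = - P (B x) (J i y)" using that y B(3) JV skewJ by simp
    also have "\<dots> = e i * P (J i (B x)) y" using PJ[OF that(1) BV[OF that(2)] y] sign_sq[OF that(1)]
      by (simp add: mult.assoc[symmetric])
    finally show "P (B (J i x)) y = P (e i *\<^sub>R J i (B x)) y" by (simp add: bilinear_lmul[OF bP])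
  qed
  obtain m where m: "\<And>x. x \<in> V \<Longrightarrow> (B \<circ> B) x = m *\<^sub>R x"
  proof (rule schur[OF simple dom B, of "B \<circ> B"])
    show "linear (B \<circ> B)" using B(1) linear_compose by blast
    show "(B \<circ> B) ` V \<subseteq> V" using BV by auto
    show "P ((B \<circ> B) x) y = P x ((B \<circ> B) y)" if "x \<in> V" "y \<in> V" for x y
      using that Bsa BV by simp
    show "(B \<circ> B) (J i x) = J i ((B \<circ> B) x)" if "i \<in> I" "x \<in> V" for i x
      using that BV by (simp add: BJ linear_scale[OF B(1)])
  qed auto
  obtain v where v: "v \<in> V" "v \<noteq> 0" using simple subspace_0[OF subV] by (auto simp: simple_form_def)
  have "B v \<noteq> 0"
  proof
    assume "B v = 0"
    then have "b v y = 0" if "y \<in> V" for y using B(3)[OF v(1) that] by (simp add: bilinear_lzero[OF bP])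
    then show False using nondeg[OF v(1)] v(2) by auto
  qed
  then have "0 < P (B v) (B v)" using pos BV v by auto
  also have "\<dots> = m * P v v"
    using Bsa[OF BV[OF v(1)] v(1)] m[OF v(1)] by (simp add: symP BV v bilinear_lmul[OF bP] bilinear_rmul[OF bP])
  finally have "0 < m" using pos[OF v] by (simp add: zero_less_mult_iff)
  \<comment> \<open>Multiplying \<open>P\<close> by \<open>c\<close> and dividing \<open>B\<close>
    by \<open>c\<close> leaves \<open>b\<close> unchanged, and \<open>c * c = m\<close> turns the
    new operator into an involution.\<close>
  define c where "c = sqrt m"
  have c: "0 < c" "c * c = m" using \<open>0 < m\<close> by (auto simp: c_def)
  show ?thesis
  proof (rule that[of "\<lambda>x y. c * P x y" "\<lambda>x. (1 / c) *\<^sub>R B x"])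
    show "dominating_form V (\<lambda>x y. c * P x y)" using dominating_form_scale[OF dom c(1)] .
    show "c * P (J i x) y = - e i * (c * P x (J i y))" if "i \<in> I" "x \<in> V" "y \<in> V" for i x y
      using PJ[OF that] by simp
    show "linear (\<lambda>x. (1 / c) *\<^sub>R B x)" using B(1) by (rule linear_compose_scale_right)
    show "(\<lambda>x. (1 / c) *\<^sub>R B x) ` V \<subseteq> V" using BV subV by (auto simp: subspace_scale)
    show "c * P ((1 / c) *\<^sub>R B x) y = b x y" if "x \<in> V" "y \<in> V" for x y
      using c B(3)[OF that] by (simp add: bilinear_lmul[OF bP])
    show "(1 / c) *\<^sub>R B ((1 / c) *\<^sub>R B x) = x" if "x \<in> V" for x
      using m[OF that] c by (auto simp: linear_scale[OF B(1)])
    show "(1 / c) *\<^sub>R B (J i x) = e i *\<^sub>R J i ((1 / c) *\<^sub>R B x)" if "i \<in> I" "x \<in> V" for i x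
      using BJ[OF that] that by (simp add: linear_scale[OF linJ])
  qed
qed

end

section \<open>Uniqueness of simple modules\<close>

locale clifford_form_pair =
  c1: clifford_form I e V J b + c2: clifford_form I e V' J' b'
  for I :: "'i set" and e :: "'i \<Rightarrow> real"
    and V :: "'a::real_vector set" and J :: "'i \<Rightarrow> 'a \<Rightarrow> 'a" and b :: "'a \<Rightarrow> 'a \<Rightarrow> real"
    and V' :: "'b::real_vector set" and J' :: "'i \<Rightarrow> 'b \<Rightarrow> 'b" and b' :: "'b \<Rightarrow> 'b \<Rightarrow> real"
begin

definition semi_intertwiner :: "real \<Rightarrow> 'i set \<Rightarrow> ('a \<Rightarrow> 'b) \<Rightarrow> bool" where
  "semi_intertwiner d A T \<longleftrightarrow> linear T \<and> T ` V \<subseteq> V' \<and> (\<exists>x\<in>V. T x \<noteq> 0) \<and>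
     (\<forall>i\<in>A. \<forall>x\<in>V. J' i (T x) = d *\<^sub>R T (J i x))"

text \<open>
  Averaging \<open>T\<close> with its conjugate under a new generator gives a nonzero map commuting or
  anticommuting with that generator. If the new sign differs from the old ones, composing with
  the new generator flips all old signs and keeps the new one.
\<close>

lemma semi_intertwiner_insert:
  assumes T: "semi_intertwiner d A T" and d: "d = 1 \<or> d = - 1" and A: "A \<subseteq> I" "a \<in> I" "a \<notin> A"
  shows "\<exists>d T. (d = 1 \<or> d = - 1) \<and> semi_intertwiner d (insert a A) T"
proof -
  have lT: "linear T" and TV: "\<And>x. x \<in> V \<Longrightarrow> T x \<in> V'"
    and TA: "\<And>i x. i \<in> A \<Longrightarrow> x \<in> V \<Longrightarrow> J' i (T x) = d *\<^sub>R T (J i x)"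
    using T by (auto simp: semi_intertwiner_def)
  obtain x0 where x0: "x0 \<in> V" "T x0 \<noteq> 0" using T by (auto simp: semi_intertwiner_def)
  have la: "linear (J a)" "linear (J' a)" using A c1.linJ c2.linJ by auto
  define S where "S x = J' a (T (J a x))" for x
  have S: "linear S" unfolding S_def
    using linear_compose[OF linear_compose[OF la(1) lT] la(2)] by (simp add: o_def)
  have SV: "S x \<in> V'" if "x \<in> V" for x using that A c1.JV c2.JV TV by (simp add: S_def)
  have SA: "J' i (S x) = d *\<^sub>R S (J i x)" if "i \<in> A" "x \<in> V" for i x
  proof -
    have i: "i \<in> I" "i \<noteq> a" using that A by auto
    have JaV: "J a x \<in> V" using that A c1.JV by auto
    have "J' i (S x) = - J' a (J' i (T (J a x)))"
      unfolding S_def using i A TV[OF JaV] by (simp add: c2.antiJ[of i a])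
    also have "\<dots> = - d *\<^sub>R J' a (T (J i (J a x)))"
      using TA[OF that(1) JaV] by (simp add: linear_scale[OF la(2)])
    also have "\<dots> = d *\<^sub>R S (J i x)"
      unfolding S_def using i A that
      by (simp add: c1.antiJ[of i a] linear_neg[OF lT] linear_neg[OF la(2)])
    finally show ?thesis .
  qed
  have JS: "J' a (S x) = - e a *\<^sub>R T (J a x)" if "x \<in> V" for x
    unfolding S_def using that A TV c1.JV by (simp add: c2.sqJ)
  have SJ: "S (J a x) = - e a *\<^sub>R J' a (T x)" if "x \<in> V" for x
    unfolding S_def using that A by (simp add: c1.sqJ linear_scale[OF lT] linear_scale[OF la(2)]
        linear_neg[OF lT] linear_neg[OF la(2)])
  have "\<exists>U f. semi_intertwiner d A U \<and> (f = 1 \<or> f = - 1) \<and> (\<forall>x\<in>V. J' a (U x) = f *\<^sub>R U (J a x))"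
  proof -
    \<comment> \<open>\<open>U f\<close> is \<open>T\<close> plus \<open>f\<close> times the
      conjugate of \<open>T\<close> under the new generator, whose inverse is \<open>- e a\<close>
      times itself. Since \<open>U 1\<close> and \<open>U (- 1)\<close> add up to twice
      \<open>T\<close>, one of them is nonzero.\<close>
    define U where "U f x = T x - (f * e a) *\<^sub>R S x" for f x
    have lU: "linear (U f)" for f unfolding U_def
      by (intro linear_compose_sub lT linear_compose_scale_right S)
    have UV: "U f ` V \<subseteq> V'" for f
      unfolding U_def using TV SV c2.subV by (auto intro!: subspace_diff subspace_scale)
    have UA: "J' i (U f x) = d *\<^sub>R U f (J i x)" if "i \<in> A" "x \<in> V" for i x f
    proof -
      have li: "linear (J' i)" using that A c2.linJ by auto
      show ?thesis unfolding U_def using TA[OF that] SA[OF that]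
        by (simp add: linear_diff[OF li] linear_scale[OF li] scaleR_diff_right mult.commute)
    qed
    have Ua: "J' a (U f x) = f *\<^sub>R U f (J a x)" if "f = 1 \<or> f = - 1" "x \<in> V" for f x
    proof -
      have ff: "f * f = 1" using that by auto
      have "J' a (U f x) = J' a (T x) + (f * (e a * e a)) *\<^sub>R T (J a x)"
        using JS[OF that(2)] by (simp add: U_def linear_diff[OF la(2)] linear_scale[OF la(2)] mult.assoc)
      moreover have "f *\<^sub>R U f (J a x) = f *\<^sub>R T (J a x) + (f * f * (e a * e a)) *\<^sub>R J' a (T x)"
        using SJ[OF that(2)] by (simp add: U_def scaleR_diff_right scaleR_add_right mult_ac)
      ultimately show ?thesis using ff c1.sign_sq[OF A(2)] by simp
    qed
    have "(\<exists>x\<in>V. U 1 x \<noteq> 0) \<or> (\<exists>x\<in>V. U (- 1) x \<noteq> 0)"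
    proof (rule ccontr)
      assume "\<not> ?thesis"
      then have "U 1 x0 + U (- 1) x0 = 0" using x0(1) by auto
      then have "T x0 + T x0 = 0" by (simp add: U_def)
      then have "2 *\<^sub>R T x0 = 0" by (simp add: scaleR_2)
      then show False using x0(2) by simp
    qed
    then obtain f where f: "f = 1 \<or> f = - 1" "\<exists>x\<in>V. U f x \<noteq> 0" by metis
    then have "semi_intertwiner d A (U f)" using lU UV UA by (simp add: semi_intertwiner_def)
    moreover have "\<forall>x\<in>V. J' a (U f x) = f *\<^sub>R U f (J a x)" using Ua f(1) by simp
    ultimately show ?thesis using f(1) by (intro exI conjI)
  qed
  then obtain U f where U: "semi_intertwiner d A U" and f: "f = 1 \<or> f = - 1"
    and Ua: "\<And>x. x \<in> V \<Longrightarrow> J' a (U x) = f *\<^sub>R U (J a x)" by blast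
  show ?thesis
  proof (cases "f = d")
    case True
    then have "semi_intertwiner d (insert a A) U" using U Ua by (simp add: semi_intertwiner_def)
    then show ?thesis using d by blast
  next
    case False
    then have fd: "f = - d" using f d by auto
    have lU: "linear U" using U by (simp add: semi_intertwiner_def)
    obtain y where y: "y \<in> V" "U y \<noteq> 0" using U by (auto simp: semi_intertwiner_def)
    have "U (J a (J a y)) \<noteq> 0"
      using y A c1.sign[OF A(2)] by (auto simp: c1.sqJ linear_scale[OF lU] linear_neg[OF lU])
    moreover have "J' i (U (J a x)) = f *\<^sub>R U (J a (J i x))" if "i \<in> insert a A" "x \<in> V" for i x
    proof (cases "i = a")
      case True
      then show ?thesis using Ua that A c1.JV by simp
    next
      case False
      then have i: "i \<in> A" "i \<in> I" using that A by auto
      have "J' i (U (J a x)) = d *\<^sub>R U (J i (J a x))"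
        using U i that A c1.JV by (simp add: semi_intertwiner_def)
      then show ?thesis using i that A False fd
        by (simp add: c1.antiJ[of i a] linear_neg[OF lU])
    qed
    ultimately have "semi_intertwiner f (insert a A) (U \<circ> J a)"
      using U linear_compose[OF la(1) lU] y(1) A c1.JV
      by (auto simp: semi_intertwiner_def image_subset_iff)
    then show ?thesis using f by blast
  qed
qed

lemma semi_intertwiner_exists:
  assumes "V \<noteq> {0}" "V' \<noteq> {0}"
  shows "\<exists>d T. (d = 1 \<or> d = - 1) \<and> semi_intertwiner d I T"
proof -
  have "\<exists>d T. (d = 1 \<or> d = - 1) \<and> semi_intertwiner d A T" if "finite A" "A \<subseteq> I" for A
    using that
  proof (induction A rule: finite_induct)
    case empty
    obtain x y where x: "x \<in> V" "x \<noteq> 0" and y: "y \<in> V'" "y \<noteq> 0"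
      using assms subspace_0[OF c1.subV] subspace_0[OF c2.subV] by auto
    obtain z where z: "z \<in> V" "b x z \<noteq> 0" using c1.nondeg[OF x(1)] x(2) by blast
    \<comment> \<open>Without generators any nonzero linear map qualifies; this one has rank one and
      is nonzero at \<open>z\<close>.\<close>
    have "semi_intertwiner 1 {} (\<lambda>v. b x v *\<^sub>R y)"
      unfolding semi_intertwiner_def
    proof (intro conjI)
      show "linear (\<lambda>v. b x v *\<^sub>R y)"
        by (intro linearI) (simp_all add: bilinear_radd[OF c1.bil] bilinear_rmul[OF c1.bil] scaleR_add_left)
      show "(\<lambda>v. b x v *\<^sub>R y) ` V \<subseteq> V'" using y c2.subV by (auto simp: subspace_scale)
      show "\<exists>v\<in>V. b x v *\<^sub>R y \<noteq> 0" using z y by auto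
    qed simp
    then show ?case by blast
  next
    case (insert a A)
    from insert.IH insert.prems obtain d T where "d = 1 \<or> d = - 1" "semi_intertwiner d A T" by auto
    then show ?case using semi_intertwiner_insert[of d A T a] insert.prems insert.hyps by auto
  qed
  from this[OF c1.finI subset_refl] show ?thesis .
qed

text \<open>Some semi-intertwiner exists; averaging it with the involutions \<open>B\<close> and
  \<open>B'\<close> of the two polar forms makes it compatible with the forms as well, up to a sign
  \<open>f\<close>. Its adjoint times itself, the operator \<open>S\<close>, then commutes with all
  \<open>J i\<close> and with \<open>B\<close>, so it is a scalar by Schur's lemma. After rescaling,
  the map multiplies the forms by \<open>f\<close>; hence it is injective with nondegenerate
  invariant image, which simplicity makes all of \<open>V'\<close>.\<close>

lemma simple_forms_similar:
  assumes s1: "simple_form V (J ` I) b" and s2: "simple_form V' (J' ` I) b'"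
  obtains d f T where "d = 1 \<or> d = - 1" "f = 1 \<or> f = - 1" "linear T" "bij_betw T V V'"
    "\<And>i x. i \<in> I \<Longrightarrow> x \<in> V \<Longrightarrow> J' i (T x) = d *\<^sub>R T (J i x)"
    "\<And>x y. x \<in> V \<Longrightarrow> y \<in> V \<Longrightarrow> b' (T x) (T y) = f * b x y"
proof -
  from c1.polar_form[OF s1] obtain P B where dom: "dominating_form V P"
    and PJ: "\<And>i x y. i \<in> I \<Longrightarrow> x \<in> V \<Longrightarrow> y \<in> V \<Longrightarrow> P (J i x) y = - e i * P x (J i y)"
    and B: "linear B" "B ` V \<subseteq> V" "\<And>x y. x \<in> V \<Longrightarrow> y \<in> V \<Longrightarrow> P (B x) y = b x y"
      "\<And>x. x \<in> V \<Longrightarrow> B (B x) = x"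
      "\<And>i x. i \<in> I \<Longrightarrow> x \<in> V \<Longrightarrow> B (J i x) = e i *\<^sub>R J i (B x)" by blast
  from c2.polar_form[OF s2] obtain P' B' where dom': "dominating_form V' P'"
    and PJ': "\<And>i x y. i \<in> I \<Longrightarrow> x \<in> V' \<Longrightarrow> y \<in> V' \<Longrightarrow> P' (J' i x) y = - e i * P' x (J' i y)"
    and B': "linear B'" "B' ` V' \<subseteq> V'" "\<And>x y. x \<in> V' \<Longrightarrow> y \<in> V' \<Longrightarrow> P' (B' x) y = b' x y"
      "\<And>x. x \<in> V' \<Longrightarrow> B' (B' x) = x"
      "\<And>i x. i \<in> I \<Longrightarrow> x \<in> V' \<Longrightarrow> B' (J' i x) = e i *\<^sub>R J' i (B' x)" by blast
  have BV: "B x \<in> V" if "x \<in> V" for x using B(2) that by auto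
  have BV': "B' x \<in> V'" if "x \<in> V'" for x using B'(2) that by auto
  have bP: "bilinear P" and symP: "\<And>x y. x \<in> V \<Longrightarrow> y \<in> V \<Longrightarrow> P x y = P y x"
    and pos: "\<And>x. x \<in> V \<Longrightarrow> x \<noteq> 0 \<Longrightarrow> 0 < P x x"
    using dom by (auto simp: dominating_form_def)
  have bP': "bilinear P'" and symP': "\<And>x y. x \<in> V' \<Longrightarrow> y \<in> V' \<Longrightarrow> P' x y = P' y x"
    and pos': "\<And>x. x \<in> V' \<Longrightarrow> x \<noteq> 0 \<Longrightarrow> 0 < P' x x"
    using dom' by (auto simp: dominating_form_def)
  have ndP: "x = 0" if "x \<in> V" "\<And>y. y \<in> V \<Longrightarrow> P x y = 0" for x
    using that pos by force
  have eq: "u = v" if "u \<in> V" "v \<in> V" "\<And>y. y \<in> V \<Longrightarrow> P u y = P v y" for u v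
    using ndP[of "u - v"] that c1.subV by (auto simp: subspace_diff bilinear_lsub[OF bP])
  have Bsa: "P (B x) y = P x (B y)" if "x \<in> V" "y \<in> V" for x y
    using that B(3) c1.sym symP BV by metis
  have Bsa': "P' (B' x) y = P' x (B' y)" if "x \<in> V'" "y \<in> V'" for x y
    using that B'(3) c2.sym symP' BV' by metis
  have ne: "V \<noteq> {0}" "V' \<noteq> {0}" using s1 s2 by (auto simp: simple_form_def)
  obtain d T0 where d: "d = 1 \<or> d = - 1" and T0: "semi_intertwiner d I T0"
    using semi_intertwiner_exists[OF ne] by blast
  have lT0: "linear T0" and T0V: "\<And>x. x \<in> V \<Longrightarrow> T0 x \<in> V'"
    and T0J: "\<And>i x. i \<in> I \<Longrightarrow> x \<in> V \<Longrightarrow> J' i (T0 x) = d *\<^sub>R T0 (J i x)"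
    using T0 by (auto simp: semi_intertwiner_def)
  obtain x0 where x0: "x0 \<in> V" "T0 x0 \<noteq> 0" using T0 by (auto simp: semi_intertwiner_def)
  \<comment> \<open>Because \<open>B\<close> and \<open>B'\<close> are involutions,
    \<open>B' (U f x) = f *\<^sub>R U f (B x)\<close> for both signs, and again one of
    \<open>U 1\<close>, \<open>U (- 1)\<close> does not vanish.\<close>
  define U where "U f x = T0 x + f *\<^sub>R B' (T0 (B x))" for f x
  have lU: "linear (U f)" for f
    unfolding U_def using linear_compose[OF linear_compose[OF B(1) lT0] B'(1)]
    by (intro linear_compose_add lT0 linear_compose_scale_right) (simp add: o_def)
  have UV: "U f x \<in> V'" if "x \<in> V" for f x
    unfolding U_def using that T0V BV BV' c2.subV by (auto intro!: subspace_add subspace_scale)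
  have UJ: "J' i (U f x) = d *\<^sub>R U f (J i x)" if "i \<in> I" "x \<in> V" for i x f
  proof -
    have li: "linear (J' i)" using that c2.linJ by auto
    have "B' (T0 (B (J i x))) = e i *\<^sub>R B' (T0 (J i (B x)))"
      using that B(5) by (simp add: linear_scale[OF lT0] linear_scale[OF B'(1)])
    moreover have "J' i (B' (T0 (B x))) = e i *\<^sub>R B' (J' i (T0 (B x)))"
      using that B'(5)[OF that(1) T0V[OF BV[OF that(2)]]] c1.sign_sq[OF that(1)] by simp
    ultimately show ?thesis unfolding U_def using that T0J BV
      by (simp add: linear_add[OF li] linear_scale[OF li] linear_scale[OF B'(1)] scaleR_add_right mult_ac)
  qed
  have UB: "B' (U f x) = f *\<^sub>R U f (B x)" if "f = 1 \<or> f = - 1" "x \<in> V" for f x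
    using that B(4) B'(4) T0V BV
    by (auto simp: U_def linear_add[OF B'(1)] linear_diff[OF B'(1)] linear_neg[OF B'(1)] linear_scale[OF B'(1)])
  have "(\<exists>x\<in>V. U 1 x \<noteq> 0) \<or> (\<exists>x\<in>V. U (- 1) x \<noteq> 0)"
  proof (rule ccontr)
    assume "\<not> ?thesis"
    then have "U 1 x0 + U (- 1) x0 = 0" using x0(1) by auto
    then have "T0 x0 + T0 x0 = 0" by (simp add: U_def)
    then have "2 *\<^sub>R T0 x0 = 0" by (simp add: scaleR_2)
    then show False using x0(2) by simp
  qed
  then obtain f v where f: "f = 1 \<or> f = - 1" and v: "v \<in> V" "U f v \<noteq> 0" by metis
  define T where "T = U f"
  have T: "linear T" "\<And>x. x \<in> V \<Longrightarrow> T x \<in> V'" "\<And>i x. i \<in> I \<Longrightarrow> x \<in> V \<Longrightarrow> J' i (T x) = d *\<^sub>R T (J i x)"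
    "\<And>x. x \<in> V \<Longrightarrow> B' (T x) = f *\<^sub>R T (B x)"
    using lU UV UJ UB f by (auto simp: T_def)
  obtain S where S: "linear S" "S ` V \<subseteq> V" "\<And>x y. x \<in> V \<Longrightarrow> y \<in> V \<Longrightarrow> P (S x) y = P' (T x) (T y)"
    using bilinear_representation[OF c1.fdV bP bilinear_compose[OF bP' T(1,1)] ndP] by metis
  have SV: "S x \<in> V" if "x \<in> V" for x using S(2) that by auto
  have "\<exists>m. \<forall>x\<in>V. S x = m *\<^sub>R x"
  proof (rule c1.schur[OF s1 dom B(1-3) S(1,2)])
    show "P (S x) y = P x (S y)" if "x \<in> V" "y \<in> V" for x y
      using that S(3) symP symP' SV T(2) by metis
    show "S (J i x) = J i (S x)" if "i \<in> I" "x \<in> V" for i x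
    proof (rule eq)
      show "S (J i x) \<in> V" "J i (S x) \<in> V" using that SV c1.JV by auto
      fix y assume y: "y \<in> V"
      have dd: "d * d = 1" using d by auto
      have inv: "T (J i z) = d *\<^sub>R J' i (T z)" if "z \<in> V" for z
        using T(3)[OF \<open>i \<in> I\<close> that] dd by simp
      have "P (S (J i x)) y = d * P' (J' i (T x)) (T y)"
        using that y S(3) c1.JV inv by (simp add: bilinear_lmul[OF bP'])
      also have "\<dots> = - e i * P' (T x) (d *\<^sub>R J' i (T y))"
        using PJ'[OF that(1) T(2)[OF that(2)] T(2)[OF y]] by (simp add: bilinear_rmul[OF bP'])
      also have "\<dots> = - e i * P (S x) (J i y)" using inv[OF y] S(3) that y c1.JV by simp
      also have "\<dots> = P (J i (S x)) y" using PJ that y SV by simp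
      finally show "P (S (J i x)) y = P (J i (S x)) y" .
    qed
    show "S (B x) = B (S x)" if "x \<in> V" for x
    proof (rule eq)
      show "S (B x) \<in> V" "B (S x) \<in> V" using that SV BV by auto
      fix y assume y: "y \<in> V"
      have ff: "f * f = 1" using f by auto
      have inv: "T (B z) = f *\<^sub>R B' (T z)" if "z \<in> V" for z using T(4)[OF that] ff by simp
      have "P (S (B x)) y = f * P' (B' (T x)) (T y)"
        using that y S(3) BV inv by (simp add: bilinear_lmul[OF bP'])
      also have "\<dots> = P' (T x) (f *\<^sub>R B' (T y))"
        using Bsa' T(2) that y by (simp add: bilinear_rmul[OF bP'])
      also have "\<dots> = P (S x) (B y)" using inv[OF y] S(3) that y BV by simp
      also have "\<dots> = P (B (S x)) y" using Bsa that y SV by simp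
      finally show "P (S (B x)) y = P (B (S x)) y" .
    qed
  qed auto
  then obtain m where m: "\<And>x. x \<in> V \<Longrightarrow> S x = m *\<^sub>R x" by blast
  have PT: "P' (T x) (T y) = m * P x y" if "x \<in> V" "y \<in> V" for x y
    using S(3)[OF that] m that by (simp add: bilinear_lmul[OF bP])
  have "v \<noteq> 0" using v(2) linear_0[OF lU] by auto
  then have "0 < m"
    using PT[OF v(1) v(1)] pos[OF v(1)] pos'[OF T(2)[OF v(1)]] v(2)
    by (simp add: T_def zero_less_mult_iff)
  define c where "c = 1 / sqrt m"
  have c: "c * c * m = 1" "c \<noteq> 0" using \<open>0 < m\<close> by (auto simp: c_def)
  define R where "R x = c *\<^sub>R T x" for x
  have R: "linear R" unfolding R_def using T(1) by (rule linear_compose_scale_right)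
  have RV: "R x \<in> V'" if "x \<in> V" for x using T(2)[OF that] c2.subV by (simp add: R_def subspace_scale)
  have RJ: "J' i (R x) = d *\<^sub>R R (J i x)" if "i \<in> I" "x \<in> V" for i x
    using T(3)[OF that] c2.linJ[OF that(1)] by (simp add: R_def linear_scale mult.commute)
  have Rb: "b' (R x) (R y) = f * b x y" if "x \<in> V" "y \<in> V" for x y
  proof -
    have "b' (R x) (R y) = c * c * P' (B' (T x)) (T y)"
      using B'(3) T(2) that by (simp add: R_def bilinear_lmul[OF c2.bil] bilinear_rmul[OF c2.bil])
    also have "\<dots> = f * (c * c * m) * P (B x) y"
      using T(4)[OF that(1)] PT[OF BV[OF that(1)] that(2)] by (simp add: bilinear_lmul[OF bP'])
    finally show ?thesis using c(1) B(3)[OF that] by simp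
  qed
  have f0: "f \<noteq> 0" using f by auto
  have "inj_on R V"
    unfolding linear_inj_on_iff[OF R c1.subV]
  proof (intro ballI impI)
    fix x assume x: "x \<in> V" "R x = 0"
    show "x = 0"
    proof (rule c1.nondeg[OF x(1)])
      fix y assume "y \<in> V"
      then show "b x y = 0" using Rb[OF x(1) \<open>y \<in> V\<close>] x(2) f0 by (simp add: bilinear_lzero[OF c2.bil])
    qed
  qed
  moreover have "R ` V = V'"
  proof (rule simple_formD[OF s2])
    show "subspace (R ` V)" using R c1.subV by (rule linear_subspace_image)
    show "R ` V \<subseteq> V'" using RV by auto
    show "R v \<in> R ` V" using v(1) by simp
    show "R v \<noteq> 0" using v(2) c(2) by (simp add: R_def T_def)
    show "g x \<in> R ` V" if g: "g \<in> J' ` I" and x: "x \<in> R ` V" for g x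
    proof -
      obtain i z where i: "i \<in> I" "g = J' i" and z: "z \<in> V" "x = R z" using g x by auto
      have "g x = R (d *\<^sub>R J i z)" using RJ i z by (simp add: linear_scale[OF R])
      then show ?thesis using c1.JV[OF i(1) z(1)] c1.subV by (simp add: subspace_scale)
    qed
    show "x = 0" if x: "x \<in> R ` V" "\<And>y. y \<in> R ` V \<Longrightarrow> b' x y = 0" for x
    proof -
      obtain z where z: "z \<in> V" "x = R z" using x(1) by auto
      have "z = 0"
      proof (rule c1.nondeg[OF z(1)])
        fix y assume y: "y \<in> V"
        have "b' (R z) (R y) = 0" using x(2)[of "R y"] y z(2) by simp
        then show "b z y = 0" using Rb[OF z(1) y] f0 by simp
      qed
      then show ?thesis using z(2) linear_0[OF R] by simp
    qed
  qed
  ultimately have "bij_betw R V V'" by (simp add: bij_betw_def)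
  then show ?thesis using that[OF d f R _ RJ Rb] by blast
qed

end

section \<open>The fixed space of an involution\<close>

text \<open>The map \<open>g\<close> is invertible and anticommutes with \<open>P\<close>, so it
  exchanges the eigenspaces of \<open>P\<close>, and \<open>V\<close> is the orthogonal sum of the
  fixed space and its translate by \<open>g\<close>. In the application \<open>P\<close> is a
  product of four generators and \<open>g\<close> is one of them; \<open>d\<close> is its sign and
  \<open>c\<close> minus its sign.\<close>

locale involution_flip =
  fixes V :: "'a::real_vector set" and b :: "'a \<Rightarrow> 'a \<Rightarrow> real" and P g :: "'a \<Rightarrow> 'a" and c d :: real
  assumes subspaceV: "subspace V" and bilb: "bilinear b"
    and linP: "linear P" and ling: "linear g"
    and PV: "x \<in> V \<Longrightarrow> P x \<in> V" and gV: "x \<in> V \<Longrightarrow> g x \<in> V"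
    and PP: "x \<in> V \<Longrightarrow> P (P x) = x"
    and Pg: "x \<in> V \<Longrightarrow> P (g x) = - g (P x)"
    and gg: "x \<in> V \<Longrightarrow> g (g x) = c *\<^sub>R x" and c0: "c \<noteq> 0"
    and gb: "x \<in> V \<Longrightarrow> y \<in> V \<Longrightarrow> b (g x) (g y) = d * b x y" and d0: "d \<noteq> 0"
    and Pb: "x \<in> V \<Longrightarrow> y \<in> V \<Longrightarrow> b (P x) y = b x (P y)"
begin

definition fixed :: "'a set" where "fixed = {x\<in>V. P x = x}"

definition even_part :: "'a \<Rightarrow> 'a" where "even_part x = (1 / 2) *\<^sub>R (x + P x)"

text \<open>The component of \<open>x\<close> for the eigenvalue -1, brought back into the fixed
  space by the inverse of \<open>g\<close>, which is \<open>g\<close> divided by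
  \<open>c\<close>.\<close>

definition odd_part :: "'a \<Rightarrow> 'a" where "odd_part x = (1 / (2 * c)) *\<^sub>R g (x - P x)"

lemma linear_even_part: "linear even_part"
  unfolding even_part_def by (intro linear_compose_scale_right linear_compose_add linear_ident linP)

lemma linear_odd_part: "linear odd_part"
  unfolding odd_part_def
  using linear_compose[OF linear_compose_sub[OF linear_ident linP] ling]
  by (intro linear_compose_scale_right) (simp add: o_def)

lemma even_part_fixed: "x \<in> V \<Longrightarrow> even_part x \<in> fixed"
  unfolding even_part_def fixed_def using subspaceV
  by (simp add: subspace_scale subspace_add PV linear_scale[OF linP] linear_add[OF linP] PP add.commute)

lemma odd_part_fixed: "x \<in> V \<Longrightarrow> odd_part x \<in> fixed"
  unfolding odd_part_def fixed_def using subspaceV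
  by (simp add: subspace_scale subspace_diff PV gV linear_scale[OF linP] Pg linear_diff[OF linP]
      linear_diff[OF ling] PP)

lemma decomposition: "x \<in> V \<Longrightarrow> x = even_part x + g (odd_part x)"
  unfolding even_part_def odd_part_def using subspaceV c0
  by (simp add: linear_scale[OF ling] gg subspace_diff PV scaleR_add_left[symmetric]
      scaleR_add_right scaleR_diff_right flip: scaleR_left_distrib)

lemma fixed_V: "x \<in> fixed \<Longrightarrow> x \<in> V" by (simp add: fixed_def)

lemma even_part_eq: "u \<in> fixed \<Longrightarrow> w \<in> fixed \<Longrightarrow> even_part (u + g w) = u"
  by (simp add: even_part_def fixed_def linear_add[OF linP] Pg flip: scaleR_2)

lemma odd_part_eq: "u \<in> fixed \<Longrightarrow> w \<in> fixed \<Longrightarrow> odd_part (u + g w) = w"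
  using c0
  by (simp add: odd_part_def fixed_def linear_add[OF linP] Pg linear_add[OF ling] linear_scale[OF ling] gg flip: scaleR_2)

lemma fixedE:
  assumes "x \<in> V"
  obtains u w where "u \<in> fixed" "w \<in> fixed" "x = u + g w"
  using decomposition[OF assms] even_part_fixed[OF assms] odd_part_fixed[OF assms] by blast

lemma subspace_fixed: "subspace fixed"
  using subspaceV by (auto simp: fixed_def subspace_def linear_0[OF linP] linear_add[OF linP] linear_scale[OF linP])

lemma orthogonal: "u \<in> fixed \<Longrightarrow> w \<in> fixed \<Longrightarrow> b (g u) w = 0 \<and> b u (g w) = 0"
  using Pb[of "g u" w] Pb[of u "g w"] gV
  by (auto simp: fixed_def Pg bilinear_lneg[OF bilb] bilinear_rneg[OF bilb])

lemma nondegenerate_fixed: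
  assumes "\<And>x. x \<in> V \<Longrightarrow> (\<And>y. y \<in> V \<Longrightarrow> b x y = 0) \<Longrightarrow> x = 0"
    and x: "x \<in> fixed" "\<And>y. y \<in> fixed \<Longrightarrow> b x y = 0"
  shows "x = 0"
proof (rule assms(1)[OF fixed_V[OF x(1)]])
  fix y assume "y \<in> V"
  then obtain u w where "u \<in> fixed" "w \<in> fixed" "y = u + g w" by (rule fixedE)
  then show "b x y = 0" using x orthogonal by (simp add: bilinear_radd[OF bilb])
qed

text \<open>For an invariant nondegenerate \<open>W\<close> in the fixed space,
  \<open>W + g W\<close> is invariant under all operators. It is nondegenerate because its summands
  are orthogonal and \<open>g\<close> multiplies \<open>b\<close> by \<open>d\<close>. So it is
  \<open>V\<close>, and taking even parts gives \<open>W = fixed\<close>.\<close>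

lemma simple_fixed:
  assumes simple: "simple_form V (insert g (insert P \<S>)) b"
    and \<S>: "\<And>s. s \<in> \<S> \<Longrightarrow> linear s" "\<And>s. s \<in> \<S> \<Longrightarrow> \<exists>t. \<forall>x\<in>V. s (g x) = t *\<^sub>R g (s x)"
  shows "simple_form fixed \<S> b"
  unfolding simple_form_def
proof (intro conjI allI impI)
  obtain x where x: "x \<in> V" "x \<noteq> 0"
    using simple subspace_0[OF subspaceV] by (auto simp: simple_form_def)
  show "fixed \<noteq> {0}"
  proof
    assume "fixed = {0}"
    then have "even_part x = 0" "odd_part x = 0" using even_part_fixed odd_part_fixed x(1) by auto
    then show False using decomposition[OF x(1)] x(2) linear_0[OF ling] by simp
  qed
next
  fix W
  assume "subspace W \<and> W \<subseteq> fixed \<and> W \<noteq> {0} \<and> (\<forall>f\<in>\<S>. f ` W \<subseteq> W) \<and>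
      (\<forall>x\<in>W. (\<forall>y\<in>W. b x y = 0) \<longrightarrow> x = 0)"
  then have W: "subspace W" "W \<subseteq> fixed" "W \<noteq> {0}" "\<And>f x. f \<in> \<S> \<Longrightarrow> x \<in> W \<Longrightarrow> f x \<in> W"
    "\<And>x. x \<in> W \<Longrightarrow> (\<And>y. y \<in> W \<Longrightarrow> b x y = 0) \<Longrightarrow> x = 0" by auto
  obtain w0 where w0: "w0 \<in> W" "w0 \<noteq> 0" using W(1,3) subspace_0 by blast
  define X where "X = {x + y |x y. x \<in> W \<and> y \<in> g ` W}"
  have XI: "u + g w \<in> X" if "u \<in> W" "w \<in> W" for u w using that by (auto simp: X_def)
  have XE: "\<exists>u w. u \<in> W \<and> w \<in> W \<and> x = u + g w" if "x \<in> X" for x using that by (auto simp: X_def)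
  have WV: "x \<in> V" if "x \<in> W" for x using W(2) that fixed_V by auto
  have "X = V"
  proof (rule simple_formD[OF simple _ _ _ w0(2)])
    show "subspace X" unfolding X_def
      by (intro subspace_sums W(1) linear_subspace_image ling)
    show "X \<subseteq> V" using WV gV subspaceV by (auto simp: X_def subspace_add)
    show "w0 \<in> X" using XI[OF w0(1) subspace_0[OF W(1)]] linear_0[OF ling] by simp
    show "f x \<in> X" if f: "f \<in> insert g (insert P \<S>)" and x: "x \<in> X" for f x
    proof -
      obtain u w where uw: "u \<in> W" "w \<in> W" "x = u + g w" using XE[OF x] by blast
      have fx: "P u = u" "P w = w" using uw(1,2) W(2) by (auto simp: fixed_def)
      consider "f = g" | "f = P" | "f \<in> \<S>" using f by auto
      then show ?thesis
      proof cases
        case 1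
        then show ?thesis using XI[of "c *\<^sub>R w" u] uw WV W(1)
          by (simp add: linear_add[OF ling] gg subspace_scale add.commute)
      next
        case 2
        then show ?thesis using XI[of u "- w"] uw WV W(1) fx
          by (simp add: linear_add[OF linP] Pg linear_neg[OF ling] subspace_neg)
      next
        case 3
        obtain t where "\<forall>x\<in>V. f (g x) = t *\<^sub>R g (f x)" using \<S>(2)[OF 3] by blast
        then show ?thesis using XI[of "f u" "t *\<^sub>R f w"] uw WV W(1,4) 3
          by (simp add: linear_add[OF \<S>(1)[OF 3]] linear_scale[OF ling] subspace_scale)
      qed
    qed
    show "x = 0" if x: "x \<in> X" "\<And>y. y \<in> X \<Longrightarrow> b x y = 0" for x
    proof -
      obtain u w where uw: "u \<in> W" "w \<in> W" "x = u + g w" using XE[OF x(1)] by blast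
      have "u = 0"
      proof (rule W(5)[OF uw(1)])
        fix y assume y: "y \<in> W"
        have "b x (y + g 0) = 0" using x(2) XI[OF y subspace_0[OF W(1)]] by blast
        then show "b u y = 0" using orthogonal[OF subsetD[OF W(2) uw(2)] subsetD[OF W(2) y]] uw(3)
          by (simp add: linear_0[OF ling] bilinear_ladd[OF bilb])
      qed
      moreover have "w = 0"
      proof (rule W(5)[OF uw(2)])
        fix y assume y: "y \<in> W"
        have "b x (0 + g y) = 0" using x(2) XI[OF subspace_0[OF W(1)] y] by blast
        then show "b w y = 0" using uw WV y \<open>u = 0\<close> gb[of w y] d0 by simp
      qed
      ultimately show ?thesis using uw(3) linear_0[OF ling] by simp
    qed
  qed
  have "x \<in> W" if x: "x \<in> fixed" for x
  proof -
    obtain u w where uw: "u \<in> W" "w \<in> W" "x = u + g w"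
      using XE[of x] fixed_V[OF x] \<open>X = V\<close> by auto
    then have "even_part x = u" using even_part_eq W(2) by auto
    moreover have "even_part x = x" using x by (simp add: even_part_def fixed_def flip: scaleR_2)
    ultimately show ?thesis using uw(1) by simp
  qed
  then show "W = fixed" using W(2) by auto
qed

end

text \<open>
  \<open>G\<close> compares the two Clifford actions on the space of a module for which the Lie algebra of
  signature \<open>(r, s)\<close> is isomorphic to one of signature \<open>(s, r)\<close>: the maps \<open>G\<^sup>-\<^sup>1 J\<close> satisfy the
  Clifford relations of opposite sign and are skew for the form \<open>b (G x) y\<close>. The set \<open>\<E>\<close> collects
  products of an even number of generators.
\<close>

definition flip_operator ::
    "'a::real_vector set \<Rightarrow> ('a \<Rightarrow> 'a) set \<Rightarrow> ('a \<Rightarrow> 'a) set \<Rightarrow> ('a \<Rightarrow> 'a \<Rightarrow> real) \<Rightarrow> ('a \<Rightarrow> 'a) \<Rightarrow> ('a \<Rightarrow> 'a) \<Rightarrow> bool" where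
  "flip_operator V \<O> \<E> b G H \<longleftrightarrow> linear G \<and> linear H \<and> G ` V \<subseteq> V \<and> H ` V \<subseteq> V \<and>
     (\<forall>x\<in>V. G (H x) = x \<and> H (G x) = x) \<and> (\<forall>x\<in>V. \<forall>y\<in>V. b (G x) y = b x (G y)) \<and>
     (\<forall>s\<in>\<O>. \<forall>x\<in>V. G (s (G x)) = - s x) \<and> (\<forall>p\<in>\<E>. \<forall>x\<in>V. G (p x) = p (G x))"

context involution_flip begin

text \<open>The extension is forced: \<open>G (g (G w)) = - g w\<close> amounts to
  \<open>G (g w) = - g (H w)\<close>. Thus the new operator acts through \<open>G\<close> on the
  fixed space and through its inverse \<open>H\<close> on the translate. An operator of
  \<open>\<E>\<close> commutes with \<open>G\<close>, hence with \<open>H\<close>, and with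
  \<open>g\<close>; therefore it commutes with the extension.\<close>

lemma flip_operator_extend:
  assumes fo: "flip_operator fixed \<O> \<E> b G H"
    and \<O>: "\<And>s. s \<in> \<O> \<Longrightarrow> linear s" "\<And>s x. s \<in> \<O> \<Longrightarrow> x \<in> V \<Longrightarrow> s x \<in> V"
      "\<And>s x. s \<in> \<O> \<Longrightarrow> x \<in> V \<Longrightarrow> s (P x) = P (s x)" "\<And>s x. s \<in> \<O> \<Longrightarrow> x \<in> V \<Longrightarrow> s (g x) = - g (s x)"
    and \<E>: "\<And>s. s \<in> \<E> \<Longrightarrow> linear s" "\<And>s x. s \<in> \<E> \<Longrightarrow> x \<in> V \<Longrightarrow> s x \<in> V"
      "\<And>s x. s \<in> \<E> \<Longrightarrow> x \<in> V \<Longrightarrow> s (P x) = P (s x)" "\<And>s x. s \<in> \<E> \<Longrightarrow> x \<in> V \<Longrightarrow> s (g x) = g (s x)"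
  shows "\<exists>G H. flip_operator V (insert g \<O>) (insert P \<E>) b G H"
proof -
  have G: "linear G" "linear H" "\<And>x. x \<in> fixed \<Longrightarrow> G x \<in> fixed" "\<And>x. x \<in> fixed \<Longrightarrow> H x \<in> fixed"
    "\<And>x. x \<in> fixed \<Longrightarrow> G (H x) = x" "\<And>x. x \<in> fixed \<Longrightarrow> H (G x) = x"
    "\<And>x y. x \<in> fixed \<Longrightarrow> y \<in> fixed \<Longrightarrow> b (G x) y = b x (G y)"
    "\<And>s x. s \<in> \<O> \<Longrightarrow> x \<in> fixed \<Longrightarrow> G (s (G x)) = - s x"
    "\<And>s x. s \<in> \<E> \<Longrightarrow> x \<in> fixed \<Longrightarrow> G (s x) = s (G x)"
    using fo by (auto simp: flip_operator_def)
  define G' where "G' x = G (even_part x) - g (H (odd_part x))" for x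
  define H' where "H' x = H (even_part x) - g (G (odd_part x))" for x
  have lin: "linear G'" "linear H'"
    using linear_compose_sub[OF linear_compose[OF linear_even_part G(1)]
        linear_compose[OF linear_compose[OF linear_odd_part G(2)] ling]]
      linear_compose_sub[OF linear_compose[OF linear_even_part G(2)]
        linear_compose[OF linear_compose[OF linear_odd_part G(1)] ling]]
    by (simp_all add: G'_def[abs_def] H'_def[abs_def] o_def)
  have G'eq: "G' (u + g w) = G u + g (- H w)" and H'eq: "H' (u + g w) = H u + g (- G w)"
    if "u \<in> fixed" "w \<in> fixed" for u w
    using even_part_eq[OF that] odd_part_eq[OF that]
    by (simp_all add: G'_def H'_def linear_neg[OF ling])
  have neg: "- x \<in> fixed" if "x \<in> fixed" for x using that subspace_fixed by (simp add: subspace_neg)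
  have scl: "r *\<^sub>R x \<in> fixed" if "x \<in> fixed" for x r using that subspace_fixed by (simp add: subspace_scale)
  have mem: "u + g w \<in> V" if "u \<in> fixed" "w \<in> fixed" for u w
    using that fixed_V gV subspaceV by (simp add: subspace_add)
  have sfix: "s x \<in> fixed" if "s \<in> \<O> \<or> s \<in> \<E>" "x \<in> fixed" for s x
    using that \<O>(2,3)[of s x] \<E>(2,3)[of s x] by (auto simp: fixed_def)
  have "flip_operator V (insert g \<O>) (insert P \<E>) b G' H'"
    unfolding flip_operator_def
  proof (intro conjI lin image_subsetI ballI)
    fix x assume "x \<in> V"
    then obtain u w where uw: "u \<in> fixed" "w \<in> fixed" "x = u + g w" by (rule fixedE)
    have m: "G u \<in> fixed" "G w \<in> fixed" "H u \<in> fixed" "H w \<in> fixed" using uw G by auto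
    show "G' x \<in> V" "H' x \<in> V" unfolding uw(3) G'eq[OF uw(1,2)] H'eq[OF uw(1,2)]
      using m by (auto intro!: mem neg)
    show "G' (H' x) = x" "H' (G' x) = x"
      unfolding uw(3) G'eq[OF uw(1,2)] H'eq[OF uw(1,2)]
      using m uw by (simp_all add: G'eq H'eq neg linear_neg[OF G(1)] linear_neg[OF G(2)] G(5,6))
    fix y assume "y \<in> V"
    then obtain u' w' where uw': "u' \<in> fixed" "w' \<in> fixed" "y = u' + g w'" by (rule fixedE)
    have m': "G u' \<in> fixed" "H w' \<in> fixed" using uw' G by auto
    have "b (H w) w' = b (H w) (G (H w'))" using G(5) uw' by simp
    also have "\<dots> = b w (H w')" using G(7)[OF m(4) m'(2)] G(5) uw(2) by simp
    finally have Hsa: "b (H w) w' = b w (H w')" .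
    show "b (G' x) y = b x (G' y)"
      unfolding uw(3) uw'(3) G'eq[OF uw(1,2)] G'eq[OF uw'(1,2)]
      using m m' uw uw' Hsa orthogonal gb fixed_V
      by (simp add: bilinear_ladd[OF bilb] bilinear_radd[OF bilb] linear_neg[OF ling]
          bilinear_lsub[OF bilb] bilinear_rsub[OF bilb] G(7))
  next
    fix s x assume s: "s \<in> insert g \<O>" and "x \<in> V"
    then obtain u w where uw: "u \<in> fixed" "w \<in> fixed" "x = u + g w" using fixedE by metis
    have m: "G u \<in> fixed" "G w \<in> fixed" "H u \<in> fixed" "H w \<in> fixed" using uw G by auto
    show "G' (s (G' x)) = - s x"
    proof (cases "s = g")
      case True
      have "g (G' x) = (- c) *\<^sub>R H w + g (G u)"
        unfolding uw(3) G'eq[OF uw(1,2)] using m fixed_V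
        by (simp add: linear_diff[OF ling] linear_neg[OF ling] gg gV)
      then have "G' (g (G' x)) = (- c) *\<^sub>R w + g (- u)"
        using G'eq[of "(- c) *\<^sub>R H w" "G u"] scl[OF m(4), of "- c"] m uw G(5,6)
        by (simp add: linear_scale[OF G(1)] linear_neg[OF G(1)])
      then show ?thesis using True uw fixed_V
        by (simp add: linear_add[OF ling] linear_neg[OF ling] gg)
    next
      case False
      then have s: "s \<in> \<O>" using s by auto
      \<comment> \<open>Multiplying \<open>G (s (G x)) = - s x\<close> by \<open>H\<close> on both
        sides. On the translate the extension acts through \<open>H\<close>, so there
        \<open>s\<close> appears between two copies of \<open>H\<close>.\<close>
      have HsH: "H (s (H w)) = - s w"
      proof -
        have "s w = s (G (H w))" using uw G(5) by simp
        also have "\<dots> = H (G (s (G (H w))))" using G(6) sfix s m G(3,4) uw by simp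
        also have "\<dots> = - H (s (H w))" using G(8)[OF s m(4)] by (simp add: linear_neg[OF G(2)])
        finally show ?thesis by simp
      qed
      have "s (G' x) = s (G u) + g (s (H w))"
        unfolding uw(3) G'eq[OF uw(1,2)] using m fixed_V \<O>(4)[OF s]
        by (simp add: linear_add[OF \<O>(1)[OF s]] linear_diff[OF \<O>(1)[OF s]] linear_neg[OF ling])
      then have "G' (s (G' x)) = - s u + g (s w)"
        using G'eq[of "s (G u)" "s (H w)"] sfix s m G(8)[OF s uw(1)] HsH by simp
      then show ?thesis using uw fixed_V s \<O>(4)[OF s, of w]
        by (simp add: linear_add[OF \<O>(1)[OF s]])
    qed
  next
    fix p x assume p: "p \<in> insert P \<E>" and "x \<in> V"
    then obtain u w where uw: "u \<in> fixed" "w \<in> fixed" "x = u + g w" using fixedE by metis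
    have m: "G u \<in> fixed" "G w \<in> fixed" "H u \<in> fixed" "H w \<in> fixed" using uw G by auto
    have Pf: "P z = z" "P (g z) = - g z" if "z \<in> fixed" for z using that Pg by (auto simp: fixed_def)
    show "G' (p x) = p (G' x)"
    proof (cases "p = P")
      case True
      have "P x = u + g (- w)" using uw Pf by (simp add: linear_add[OF linP] linear_neg[OF ling])
      then have "G' (P x) = G u + g (H w)"
        using G'eq[of u "- w"] uw neg by (simp add: linear_neg[OF G(2)])
      moreover have "P (G' x) = G u + g (H w)"
        unfolding uw(3) G'eq[OF uw(1,2)] using m Pf
        by (simp add: linear_diff[OF linP] linear_neg[OF ling])
      ultimately show ?thesis using True by simp
    next
      case False
      then have p: "p \<in> \<E>" using p by auto
      have Hp: "H (p w) = p (H w)"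
        using G(9)[OF p m(4)] G(5)[OF uw(2)] G(6)[of "p (H w)"] sfix[of p "H w"] p m by simp
      have "p x = p u + g (p w)" using uw p \<E>(4) fixed_V by (simp add: linear_add[OF \<E>(1)[OF p]])
      then have "G' (p x) = p (G u) - g (p (H w))"
        using G'eq[of "p u" "p w"] sfix p uw G(9) Hp by (simp add: linear_neg[OF ling])
      then show ?thesis unfolding uw(3) G'eq[OF uw(1,2)] using m p \<E>(4)[OF p] fixed_V
        by (simp add: linear_add[OF \<E>(1)[OF p]] linear_diff[OF \<E>(1)[OF p]] linear_neg[OF ling])
    qed
  qed
  then show ?thesis by blast
qed

end

section \<open>Comparing dimensions through linear isomorphisms\<close>

definition linearly_isomorphic :: "'a::real_vector set \<Rightarrow> 'b::real_vector set \<Rightarrow> bool" where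
  "linearly_isomorphic V W \<longleftrightarrow> (\<exists>f. linear f \<and> bij_betw f V W)"

lemma linearly_isomorphic_double:
  assumes "involution_flip V b P g c d" "involution_flip V' b' P' g' c' d'"
    and iso: "linearly_isomorphic {x\<in>V. P x = x} {x\<in>V'. P' x = x}"
  shows "linearly_isomorphic V V'"
proof -
  interpret A: involution_flip V b P g c d by fact
  interpret B: involution_flip V' b' P' g' c' d' by fact
  obtain f where f: "linear f" "bij_betw f A.fixed B.fixed"
    using iso by (auto simp: linearly_isomorphic_def A.fixed_def B.fixed_def)
  obtain h where h: "linear h" "bij_betw h B.fixed A.fixed"
    "\<And>x. x \<in> A.fixed \<Longrightarrow> h (f x) = x" "\<And>y. y \<in> B.fixed \<Longrightarrow> f (h y) = y"
    using linear_bij_betw_inverse[OF A.subspace_fixed f] by metis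
  have fF: "f x \<in> B.fixed" if "x \<in> A.fixed" for x using f(2) that by (auto simp: bij_betw_def)
  have hF: "h x \<in> A.fixed" if "x \<in> B.fixed" for x using h(2) that by (auto simp: bij_betw_def)
  define F where "F x = f (A.even_part x) + g' (f (A.odd_part x))" for x
  define F' where "F' x = h (B.even_part x) + g (h (B.odd_part x))" for x
  have "linear F"
    using linear_compose_add[OF linear_compose[OF A.linear_even_part f(1)]
        linear_compose[OF linear_compose[OF A.linear_odd_part f(1)] B.ling]]
    by (simp add: F_def[abs_def] o_def)
  moreover have "bij_betw F V V'"
  proof (rule bij_betw_byWitness[where f' = F'])
    show "\<forall>x\<in>V. F' (F x) = x"
      using A.even_part_fixed A.odd_part_fixed A.decomposition
      by (simp add: F_def F'_def B.even_part_eq B.odd_part_eq fF h(3))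
    show "\<forall>x\<in>V'. F (F' x) = x"
      using B.even_part_fixed B.odd_part_fixed B.decomposition
      by (simp add: F_def F'_def A.even_part_eq A.odd_part_eq hF h(4))
    show "F ` V \<subseteq> V'" using fF A.even_part_fixed A.odd_part_fixed B.fixed_V B.gV B.subspaceV
      by (auto simp: F_def subspace_add)
    show "F' ` V' \<subseteq> V" using hF B.even_part_fixed B.odd_part_fixed A.fixed_V A.gV A.subspaceV
      by (auto simp: F'_def subspace_add)
  qed
  ultimately show ?thesis by (auto simp: linearly_isomorphic_def)
qed

section \<open>Eight additional generators\<close>

text \<open>
  The involutions \<open>Q 0, \<dots>, Q 3\<close> below correspond to the generators of the extended Hamming code in
  systematic form. They commute, and for \<open>m, n < 4\<close> the operator \<open>A m\<close> anticommutes with \<open>Q n\<close> exactly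
  if \<open>m = n\<close>.
\<close>

locale clifford_octet = clifford_form I e V J b
  for I :: "'i set" and e :: "'i \<Rightarrow> real" and V :: "'a::real_vector set"
    and J :: "'i \<Rightarrow> 'a \<Rightarrow> 'a" and b :: "'a \<Rightarrow> 'a \<Rightarrow> real" +
  fixes k :: "nat \<Rightarrow> 'i"
  assumes injk: "inj_on k {..<8}" and kI: "n < 8 \<Longrightarrow> k n \<in> I"
    and codeword_signs: "e (k 0) * e (k 5) * e (k 6) * e (k 7) = 1" "e (k 1) * e (k 4) * e (k 6) * e (k 7) = 1"
      "e (k 2) * e (k 4) * e (k 5) * e (k 7) = 1" "e (k 3) * e (k 4) * e (k 5) * e (k 6) = 1"
begin

definition A :: "nat \<Rightarrow> 'a \<Rightarrow> 'a" where "A n = J (k n)"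

text \<open>The lists spell out the words 0567, 1467, 2457 and 3456; the index \<open>n\<close> is
  the only one below 4 in the word of \<open>Q n\<close>.\<close>

definition Q :: "nat \<Rightarrow> 'a \<Rightarrow> 'a" where
  "Q n x = A n (A ([5,4,4,4] ! n) (A ([6,6,5,5] ! n) (A ([7,7,7,6] ! n) x)))"

lemma A_V: "n < 8 \<Longrightarrow> x \<in> V \<Longrightarrow> A n x \<in> V"
  by (simp add: A_def JV kI)

lemma A_linear: "n < 8 \<Longrightarrow> linear (A n)"
  by (simp add: A_def linJ kI)

lemma A_sq: "n < 8 \<Longrightarrow> x \<in> V \<Longrightarrow> A n (A n x) = - e (k n) *\<^sub>R x"
  by (simp add: A_def sqJ kI)

lemma A_swap: "m < n \<Longrightarrow> n < 8 \<Longrightarrow> x \<in> V \<Longrightarrow> A n (A m x) = - A m (A n x)"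
  using injk unfolding A_def by (intro antiJ kI) (auto dest: inj_onD)

lemma A_neg: "n < 8 \<Longrightarrow> A n (- x) = - A n x"
  by (simp add: A_linear linear_neg)

lemma A_scale: "n < 8 \<Longrightarrow> A n (r *\<^sub>R x) = r *\<^sub>R A n x"
  by (simp add: A_linear linear_scale)

text \<open>Read from left to right these rules sort a word in the generators by increasing index
  and cancel equal neighbours, so an identity between two words becomes an identity between
  scalars.\<close>

lemmas A_normalize = A_V A_sq A_swap A_neg A_scale

lemma skewA: "n < 8 \<Longrightarrow> x \<in> V \<Longrightarrow> y \<in> V \<Longrightarrow> b (A n x) y = - b x (A n y)"
  by (simp add: A_def skewJ kI)

lemma signk: "n < 8 \<Longrightarrow> e (k n) = 1 \<or> e (k n) = - 1"
  using sign kI by blast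

lemma less_4_cases: "n < 4 \<Longrightarrow> n = 0 \<or> n = Suc 0 \<or> n = 2 \<or> n = (3::nat)" by auto

lemma Q_linear: "n < 4 \<Longrightarrow> linear (Q n)"
  unfolding Q_def[abs_def]
  by (auto dest!: less_4_cases intro!: linear_compose[OF _ A_linear, unfolded o_def] A_linear)

lemma Q_V: "n < 4 \<Longrightarrow> x \<in> V \<Longrightarrow> Q n x \<in> V"
  by (auto dest!: less_4_cases simp: Q_def A_V)

text \<open>Reversing four anticommuting factors takes six exchanges and costs no sign. Hence the
  square is the product of the four scalars \<open>- e (k j)\<close>, which equals 1 by
  \<open>codeword_signs\<close>. The same count, with four skew factors, gives
  self-adjointness.\<close>

lemma Q_sq: "n < 4 \<Longrightarrow> x \<in> V \<Longrightarrow> Q n (Q n x) = x"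
  using codeword_signs by (auto dest!: less_4_cases simp: Q_def A_normalize mult_ac)

lemma Q_self_adjoint: "n < 4 \<Longrightarrow> x \<in> V \<Longrightarrow> y \<in> V \<Longrightarrow> b (Q n x) y = b x (Q n y)"
  by (auto dest!: less_4_cases simp: Q_def skewA A_normalize bilinear_rneg[OF bil])

text \<open>Two different words share exactly two letters, so 14 of the 16 pairs of factors
  anticommute, an even number.\<close>

lemma Q_commute: "m < 4 \<Longrightarrow> n < 4 \<Longrightarrow> x \<in> V \<Longrightarrow> Q m (Q n x) = Q n (Q m x)"
  by (auto dest!: less_4_cases simp: Q_def A_normalize)

lemma Q_A_commute: "m < 4 \<Longrightarrow> n < 4 \<Longrightarrow> m \<noteq> n \<Longrightarrow> x \<in> V \<Longrightarrow> Q m (A n x) = A n (Q m x)"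
  by (auto dest!: less_4_cases simp: Q_def A_normalize)

lemma Q_A_anticommute: "n < 4 \<Longrightarrow> x \<in> V \<Longrightarrow> Q n (A n x) = - A n (Q n x)"
  by (auto dest!: less_4_cases simp: Q_def A_normalize)

definition rest :: "'i set" where "rest = I - k ` {..<8}"

lemma J_A_anti: "i \<in> rest \<Longrightarrow> n < 8 \<Longrightarrow> x \<in> V \<Longrightarrow> J i (A n x) = - A n (J i x)"
  unfolding A_def by (rule antiJ) (auto simp: rest_def kI)

lemma J_Q_commute: "i \<in> rest \<Longrightarrow> n < 4 \<Longrightarrow> x \<in> V \<Longrightarrow> J i (Q n x) = Q n (J i x)"
  by (auto dest!: less_4_cases simp: Q_def J_A_anti A_V A_neg)

text \<open>The three words containing \<open>n\<close> add up modulo 2 to the set of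
  \<open>f\<close>, \<open>g\<close>, \<open>h\<close> and \<open>n\<close>, so the product of the
  three involutions is a multiple of the product of these four generators. Multiplying by the
  generators \<open>f\<close>, \<open>g\<close>, \<open>h\<close> leaves \<open>A n\<close>.\<close>

lemma last_generators:
  assumes "4 \<le> n" "n < 8"
  shows "\<exists>f<4. \<exists>g<4. \<exists>h<4. \<exists>c. \<forall>x\<in>V. A n x = c *\<^sub>R Q f (Q g (Q h (A f (A g (A h x)))))"
proof -
  \<comment> \<open>The fifteen factors on the right of the claim reduce to \<open>A n\<close> by
    seven cancellations; \<open>d\<close> collects the signs of the cancelled generators.\<close>
  have *: "\<exists>c. \<forall>x\<in>V. A n x = c *\<^sub>R F x" if "\<forall>x\<in>V. F x = - (d *\<^sub>R A n x)" "d \<noteq> 0" for F :: "'a \<Rightarrow> 'a" and d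
    using that by (intro exI[of _ "- 1 / d"]) simp
  have e0: "m < 8 \<Longrightarrow> e (k m) \<noteq> 0" for m using signk by fastforce
  consider "n = 4" | "n = 5" | "n = 6" | "n = 7" using assms by linarith
  then show ?thesis
  proof cases
    case 1
    show ?thesis unfolding 1
      by (rule exI[of _ 1], simp, rule exI[of _ 2], simp, rule exI[of _ 3], simp,
          rule *[where d = "e (k 3) * e (k 5) * e (k 4) * e (k 2) * e (k 7) * e (k 6) * e (k (Suc 0))", unfolded 1])
        (simp_all add: Q_def A_normalize e0)
  next
    case 2
    show ?thesis unfolding 2
      by (rule exI[of _ 0], simp, rule exI[of _ 2], simp, rule exI[of _ 3], simp,
          rule *[where d = "e (k 3) * e (k 5) * e (k 4) * e (k 2) * e (k 7) * e (k 6) * e (k 0)", unfolded 2])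
        (simp_all add: Q_def A_normalize e0)
  next
    case 3
    show ?thesis unfolding 3
      by (rule exI[of _ 0], simp, rule exI[of _ 1], simp, rule exI[of _ 3], simp,
          rule *[where d = "e (k 3) * e (k 6) * e (k 4) * e (k (Suc 0)) * e (k 7) * e (k 5) * e (k 0)", unfolded 3])
        (simp_all add: Q_def A_normalize e0)
  next
    case 4
    show ?thesis unfolding 4
      by (rule exI[of _ 0], simp, rule exI[of _ 1], simp, rule exI[of _ 2], simp,
          rule *[where d = "e (k 2) * e (k 7) * e (k 4) * e (k (Suc 0)) * e (k 6) * e (k 5) * e (k 0)", unfolded 4])
        (simp_all add: Q_def A_normalize e0)
  qed
qed

section \<open>The chain of common fixed spaces of the involutions\<close>

definition stage :: "nat \<Rightarrow> 'a set" where "stage m = {x\<in>V. \<forall>j<m. Q j x = x}"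

lemma stage_0: "stage 0 = V" by (simp add: stage_def)

lemma stage_V: "x \<in> stage m \<Longrightarrow> x \<in> V" by (simp add: stage_def)

lemma stage_Suc: "stage (Suc m) = {x \<in> stage m. Q m x = x}"
  by (auto simp: stage_def less_Suc_eq)

lemma subspace_stage: "m \<le> 4 \<Longrightarrow> subspace (stage m)"
  using subV Q_linear unfolding subspace_def stage_def
  by (auto simp: linear_0 linear_add linear_scale)

lemma A_stage: "m \<le> n \<Longrightarrow> n < 4 \<Longrightarrow> x \<in> stage m \<Longrightarrow> A n x \<in> stage m"
  by (simp add: stage_def A_V Q_A_commute)

lemma Q_stage: "m \<le> 4 \<Longrightarrow> n < 4 \<Longrightarrow> x \<in> stage m \<Longrightarrow> Q n x \<in> stage m"
  by (simp add: stage_def Q_V Q_commute[of _ n])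

lemma J_stage: "m \<le> 4 \<Longrightarrow> i \<in> rest \<Longrightarrow> x \<in> stage m \<Longrightarrow> J i x \<in> stage m"
  using JV[of i] by (simp add: stage_def rest_def) (metis J_Q_commute order_less_le_trans rest_def DiffI)

text \<open>\<open>A m\<close> commutes with every \<open>Q j\<close> for \<open>j < m\<close> and
  anticommutes with \<open>Q m\<close>: it preserves the stage and exchanges the two eigenspaces of
  \<open>Q m\<close> in it.\<close>

lemma stage_involution_flip:
  assumes "m < 4"
  shows "involution_flip (stage m) b (Q m) (A m) (- e (k m)) (e (k m))"
proof (rule involution_flip.intro)
  show "e (k m) \<noteq> 0" "- e (k m) \<noteq> 0" using signk[of m] assms by auto
  show "subspace (stage m)" using assms by (simp add: subspace_stage)
  show "bilinear b" by (rule bil)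
  show "linear (Q m)" "linear (A m)" using assms by (simp_all add: Q_linear A_linear)
  fix x assume x: "x \<in> stage m"
  show "Q m x \<in> stage m" "A m x \<in> stage m" using x assms by (simp_all add: Q_stage A_stage)
  have V: "x \<in> V" using x by (rule stage_V)
  show "Q m (Q m x) = x" "Q m (A m x) = - A m (Q m x)" "A m (A m x) = - e (k m) *\<^sub>R x"
    using V assms by (simp_all add: Q_sq Q_A_anticommute A_sq)
  fix y assume "y \<in> stage m"
  then have "y \<in> V" by (rule stage_V)
  then show "b (A m x) (A m y) = e (k m) * b x y" "b (Q m x) y = b x (Q m y)"
    using V assms Q_self_adjoint isoJ[OF kI] by (simp_all add: A_def)
qed

lemma stage_fixed: "m < 4 \<Longrightarrow> involution_flip.fixed (stage m) (Q m) = stage (Suc m)"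
  by (simp add: involution_flip.fixed_def[OF stage_involution_flip] stage_Suc)

lemma nondegenerate_stage:
  assumes "m \<le> 4"
  shows "x \<in> stage m \<Longrightarrow> (\<And>y. y \<in> stage m \<Longrightarrow> b x y = 0) \<Longrightarrow> x = 0"
  using assms
proof (induction m arbitrary: x)
  case 0
  then show ?case using nondeg by (simp add: stage_0)
next
  case (Suc m)
  then have m: "m < 4" by simp
  show ?case
    using involution_flip.nondegenerate_fixed[OF stage_involution_flip[OF m], unfolded stage_fixed[OF m]]
      Suc m by (metis less_imp_le)
qed

lemma clifford_form_stage: "clifford_form rest e (stage 4) J b"
proof (rule clifford_form.intro)
  show "finite rest" using finI by (simp add: rest_def)
  show "finite_dim_subspace (stage 4)"
    using finite_dim_subspace_subset[OF fdV subspace_stage[of 4]] stage_V by auto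
  show "bilinear b" by (rule bil)
  fix x assume x: "x \<in> stage 4"
  then have V: "x \<in> V" by (rule stage_V)
  show "x = 0" if "\<And>y. y \<in> stage 4 \<Longrightarrow> b x y = 0" using nondegenerate_stage[of 4 x] x that by simp
  show "b x y = b y x" if "y \<in> stage 4" for y using sym V stage_V that by blast
  fix i assume i: "i \<in> rest"
  then have I: "i \<in> I" by (simp add: rest_def)
  show "J i x \<in> stage 4" using J_stage i x by simp
  show "J i (J i x) = - e i *\<^sub>R x" using sqJ I V by blast
  show "b (J i x) y = - b x (J i y)" if "y \<in> stage 4" for y using skewJ I V stage_V that by blast
  show "J i (J j x) = - J j (J i x)" if "j \<in> rest" "i \<noteq> j" for j
    using antiJ[OF I _ that(2) V] that(1) by (simp add: rest_def)
qed (auto simp: rest_def intro: linJ dest: sign)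

text \<open>The generators with index 4 to 7 are left out: each occurs in three of the words, hence
  anticommutes with three of the involutions and does not preserve the later stages. They are
  recovered at stage 0 by \<open>last_generators\<close>.\<close>

definition stage_generators :: "nat \<Rightarrow> ('a \<Rightarrow> 'a) set" where
  "stage_generators m = A ` {m..<4} \<union> J ` rest"

lemma interval_Suc: "m < 4 \<Longrightarrow> {m..<4} = insert m {Suc m..<(4::nat)}" by auto

lemma stage_generators_Suc: "m < 4 \<Longrightarrow> stage_generators m = insert (A m) (stage_generators (Suc m))"
  by (simp add: stage_generators_def interval_Suc)

lemma stage_involutions_Suc: "m < 4 \<Longrightarrow> Q ` {m..<4} = insert (Q m) (Q ` {Suc m..<4})"
  by (simp add: interval_Suc)

lemma generators_cases:
  assumes "i \<in> I"
  obtains "i \<in> rest" | n where "n < 4" "J i = A n" | n where "4 \<le> n" "n < 8" "J i = A n"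
proof (cases "i \<in> rest")
  case False
  then obtain n where n: "n < 8" "J i = A n" using assms by (auto simp: rest_def A_def)
  then show ?thesis using that(2)[of n] that(3)[of n] by (cases "n < 4") simp_all
qed (rule that(1))

text \<open>At stage 0, stability under the first four generators, the involutions and the old
  generators implies stability under all generators, so simplicity carries over. Each further step
  removes \<open>A m\<close> and \<open>Q m\<close> from the set of operators.\<close>

lemma simple_stage:
  assumes simple: "simple_form V (J ` I) b" and "m \<le> 4"
  shows "simple_form (stage m) (stage_generators m \<union> Q ` {m..<4}) b"
  using assms(2)
proof (induction m)
  case 0
  show ?case
    unfolding simple_form_def stage_0
  proof (intro conjI allI impI)
    show "V \<noteq> {0}" using simple by (simp add: simple_form_def)
    fix W
    assume "subspace W \<and> W \<subseteq> V \<and> W \<noteq> {0} \<and> (\<forall>f\<in>stage_generators 0 \<union> Q ` {0..<4}. f ` W \<subseteq> W) \<and>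
      (\<forall>x\<in>W. (\<forall>y\<in>W. b x y = 0) \<longrightarrow> x = 0)"
    then have W: "subspace W" "W \<subseteq> V" "W \<noteq> {0}" "\<And>n x. n < 4 \<Longrightarrow> x \<in> W \<Longrightarrow> A n x \<in> W"
      "\<And>n x. n < 4 \<Longrightarrow> x \<in> W \<Longrightarrow> Q n x \<in> W" "\<And>i x. i \<in> rest \<Longrightarrow> x \<in> W \<Longrightarrow> J i x \<in> W"
      "\<And>x. x \<in> W \<Longrightarrow> (\<And>y. y \<in> W \<Longrightarrow> b x y = 0) \<Longrightarrow> x = 0"
      by (auto simp: stage_generators_def image_subset_iff)
    obtain x where x: "x \<in> W" "x \<noteq> 0" using W(3) subspace_0[OF W(1)] by auto
    show "W = V"
    proof (rule simple_formD[OF simple W(1,2) x])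
      fix f y assume f: "f \<in> J ` I" and y: "y \<in> W"
      then obtain i where i: "i \<in> I" "f = J i" by auto
      have "J i y \<in> W"
        using i(1)
      proof (cases rule: generators_cases)
        case (3 n)
        then obtain p q r c where "p < 4" "q < 4" "r < 4"
            "\<forall>x\<in>V. A n x = c *\<^sub>R Q p (Q q (Q r (A p (A q (A r x)))))"
          using last_generators by metis
        then show ?thesis using 3 y W(1,2,4,5) by (auto simp: subspace_scale)
      qed (use W y in auto)
      then show "f y \<in> W" using i by simp
    qed (use W(7) in auto)
  qed
next
  case (Suc m)
  then have m: "m < 4" by simp
  have eq: "stage_generators m \<union> Q ` {m..<4} =
      insert (A m) (insert (Q m) (stage_generators (Suc m) \<union> Q ` {Suc m..<4}))"
    using stage_generators_Suc[OF m] stage_involutions_Suc[OF m] by auto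
  interpret F: involution_flip "stage m" b "Q m" "A m" "- e (k m)" "e (k m)"
    using stage_involution_flip[OF m] .
  show ?case
    unfolding stage_fixed[OF m, symmetric]
  proof (rule F.simple_fixed)
    show "simple_form (stage m) (insert (A m) (insert (Q m) (stage_generators (Suc m) \<union> Q ` {Suc m..<4}))) b"
      using Suc.IH m unfolding eq by simp
    fix s assume "s \<in> stage_generators (Suc m) \<union> Q ` {Suc m..<4}"
    then consider n where "Suc m \<le> n" "n < 4" "s = A n" | n where "Suc m \<le> n" "n < 4" "s = Q n"
      | i where "i \<in> rest" "s = J i"
      by (auto simp: stage_generators_def)
    then have "linear s \<and> (\<exists>t. \<forall>x\<in>stage m. s (A m x) = t *\<^sub>R A m (s x))"
    proof cases
      case 1
      then show ?thesis using A_swap[of m n] stage_V by (auto intro!: exI[of _ "- 1"] simp: A_linear)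
    next
      case 2
      then show ?thesis using Q_A_commute[of n m] stage_V by (auto intro!: exI[of _ 1] simp: Q_linear)
    next
      case 3
      then show ?thesis using J_A_anti[of _ m] stage_V m linJ
        by (auto intro!: exI[of _ "- 1"] simp: rest_def)
    qed
    then show "linear s" "\<exists>t. \<forall>x\<in>stage m. s (A m x) = t *\<^sub>R A m (s x)" by auto
  qed
qed

lemma simple_core:
  assumes "simple_form V (J ` I) b"
  shows "simple_form (stage 4) (J ` rest) b"
  using simple_stage[OF assms, of 4] by (simp add: stage_generators_def)

text \<open>The involutions already passed are recorded as commuting with the extended
  \<open>G\<close>, since the remaining four generators are accessible only through them.\<close>

lemma flip_operator_stage:
  assumes fo: "flip_operator (stage 4) (J ` rest) {} b G H" and "m \<le> 4"
  shows "\<exists>G H. flip_operator (stage m) (stage_generators m) (Q ` {m..<4}) b G H"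
  using assms(2)
proof (induction m rule: inc_induct)
  case base
  then show ?case using fo by (auto simp: stage_generators_def)
next
  case (step m)
  then have m: "m < 4" by simp
  interpret F: involution_flip "stage m" b "Q m" "A m" "- e (k m)" "e (k m)"
    using stage_involution_flip[OF m] .
  obtain G H where GH: "flip_operator (stage (Suc m)) (stage_generators (Suc m)) (Q ` {Suc m..<4}) b G H"
    using step.IH by blast
  show ?case
    unfolding stage_generators_Suc[OF m] stage_involutions_Suc[OF m]
  proof (rule F.flip_operator_extend[OF GH[folded stage_fixed[OF m]]])
    fix s assume "s \<in> stage_generators (Suc m)"
    then consider n where "Suc m \<le> n" "n < 4" "s = A n" | i where "i \<in> rest" "s = J i"
      by (auto simp: stage_generators_def)
    then have "linear s \<and> (\<forall>x\<in>stage m. s x \<in> stage m \<and> s (Q m x) = Q m (s x) \<and> s (A m x) = - A m (s x))"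
    proof cases
      case 1
      then show ?thesis using A_swap[of m n] stage_V m by (auto simp: A_linear A_stage Q_A_commute)
    next
      case 2
      then show ?thesis using J_A_anti[of _ m] J_Q_commute[of _ m] J_stage[of m] stage_V m linJ
        by (auto simp: rest_def)
    qed
    then show "linear s" "\<And>x. x \<in> stage m \<Longrightarrow> s x \<in> stage m"
      "\<And>x. x \<in> stage m \<Longrightarrow> s (Q m x) = Q m (s x)" "\<And>x. x \<in> stage m \<Longrightarrow> s (A m x) = - A m (s x)" by auto
  next
    fix s assume "s \<in> Q ` {Suc m..<4}"
    then obtain n where "Suc m \<le> n" "n < 4" "s = Q n" by auto
    then show "linear s" "\<And>x. x \<in> stage m \<Longrightarrow> s x \<in> stage m"
      "\<And>x. x \<in> stage m \<Longrightarrow> s (Q m x) = Q m (s x)" "\<And>x. x \<in> stage m \<Longrightarrow> s (A m x) = A m (s x)"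
      using m stage_V by (simp_all add: Q_linear Q_stage Q_commute[of n m] Q_A_commute)
  qed
qed

text \<open>For a generator of index at least 4 the three involutions commute with \<open>G\<close>,
  while moving \<open>G\<close> past each of the three generators in \<open>last_generators\<close>
  exchanges \<open>G\<close> with \<open>H\<close> and changes the sign. As three is odd, the second
  \<open>G\<close> is cancelled and one sign remains.\<close>

lemma flip_operator_core:
  assumes "flip_operator (stage 4) (J ` rest) {} b G H"
  shows "\<exists>G H. flip_operator V (J ` I) {} b G H"
proof -
  obtain G H where fo: "flip_operator V (stage_generators 0) (Q ` {0..<4}) b G H"
    using flip_operator_stage[OF assms, of 0] by (auto simp: stage_0)
  have G: "linear G" "\<And>x. x \<in> V \<Longrightarrow> G x \<in> V" "\<And>x. x \<in> V \<Longrightarrow> H x \<in> V"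
    "\<And>x. x \<in> V \<Longrightarrow> G (H x) = x" "\<And>x. x \<in> V \<Longrightarrow> H (G x) = x"
    "\<And>n x. n < 4 \<Longrightarrow> x \<in> V \<Longrightarrow> G (A n (G x)) = - A n x"
    "\<And>n x. n < 4 \<Longrightarrow> x \<in> V \<Longrightarrow> G (Q n x) = Q n (G x)"
    "\<And>i x. i \<in> rest \<Longrightarrow> x \<in> V \<Longrightarrow> G (J i (G x)) = - J i x"
    using fo by (auto simp: flip_operator_def stage_generators_def)
  have lH: "linear H" using fo by (simp add: flip_operator_def)
  have GA: "G (A n x) = - A n (H x)" and HA: "H (A n x) = - A n (G x)" if "n < 4" "x \<in> V" for n x
  proof -
    show "G (A n x) = - A n (H x)" using G(6)[of n "H x"] that G(3,4) by simp
    have "A n (G x) = H (G (A n (G x)))" using that G(2,5) A_V by simp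
    then show "H (A n x) = - A n (G x)" using G(6)[OF that] by (simp add: linear_neg[OF lH])
  qed
  have "G (J i (G x)) = - J i x" if i: "i \<in> I" and x: "x \<in> V" for i x
    using i
  proof (cases rule: generators_cases)
    case (3 n)
    then obtain p q r c where pqr: "p < 4" "q < 4" "r < 4"
        and An: "\<forall>x\<in>V. A n x = c *\<^sub>R Q p (Q q (Q r (A p (A q (A r x)))))"
      using last_generators by metis
    have "G (A p (A q (A r (G x)))) = - A p (A q (A r x))"
      using pqr x G A_V by (simp add: GA HA linear_neg[OF lH] A_neg G(6))
    then have "G (A n (G x)) = - A n x"
      using pqr x G(2,7) A_V Q_V An
      by (simp add: linear_scale[OF G(1)] linear_neg[OF Q_linear])
    then show ?thesis using 3 by simp
  qed (use G x in auto)
  then have "flip_operator V (J ` I) {} b G H" using fo by (auto simp: flip_operator_def)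
  then show ?thesis by blast
qed

end

lemma linearly_isomorphic_octet:
  assumes "clifford_octet I e V J b k" "clifford_octet I' e' V' J' b' k'"
    and "linearly_isomorphic (clifford_octet.stage V J k 4) (clifford_octet.stage V' J' k' 4)"
  shows "linearly_isomorphic V V'"
proof -
  interpret A: clifford_octet I e V J b k by fact
  interpret B: clifford_octet I' e' V' J' b' k' by fact
  have "linearly_isomorphic (A.stage m) (B.stage m)" if "m \<le> 4" for m
    using that
  proof (induction m rule: inc_induct)
    case base
    then show ?case using assms(3) .
  next
    case (step m)
    then show ?case
      using linearly_isomorphic_double[OF A.stage_involution_flip B.stage_involution_flip, of m]
      by (simp add: A.stage_Suc B.stage_Suc)
  qed
  from this[of 0] show ?thesis by (simp add: A.stage_0 B.stage_0)
qed

section \<open>Modules over the Clifford algebra of signature (r, s)\<close>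

text \<open>
  The standard basis is indexed by \<open>nat + nat\<close> with the positive vectors on the left, so that \<open>idx r s\<close>
  increases with both \<open>r\<close> and \<open>s\<close>.
\<close>

definition idx :: "nat \<Rightarrow> nat \<Rightarrow> (nat + nat) set" where "idx r s = {..<r} <+> {..<s}"

definition sgn_idx :: "nat + nat \<Rightarrow> real" where "sgn_idx = case_sum (\<lambda>_. 1) (\<lambda>_. - 1)"

definition pos_idx :: "nat \<Rightarrow> nat + nat \<Rightarrow> nat" where "pos_idx r = case_sum (\<lambda>i. i) (\<lambda>j. r + j)"

lemma finite_idx [simp]: "finite (idx r s)" by (simp add: idx_def)

lemma sgn_idx_cases: "sgn_idx i = 1 \<or> sgn_idx i = - 1"
  by (cases i) (simp_all add: sgn_idx_def)

lemma sgn_idx_sq [simp]: "sgn_idx i * sgn_idx i = 1" "sgn_idx i * (sgn_idx i * x) = x"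
  using sgn_idx_cases[of i] by auto

lemma pos_idx_less: "i \<in> idx r s \<Longrightarrow> pos_idx r i < r + s"
  by (auto simp: idx_def pos_idx_def)

lemma inj_on_pos_idx: "inj_on (pos_idx r) (idx r s)"
  by (auto simp: inj_on_def idx_def pos_idx_def)

lemma pos_idx_eq_iff: "i \<in> idx r s \<Longrightarrow> j \<in> idx r s \<Longrightarrow> pos_idx r i = pos_idx r j \<longleftrightarrow> i = j"
  using inj_on_pos_idx by (auto simp: inj_on_def)

lemma pos_idx_image: "pos_idx r ` idx r s = {..<r + s}"
proof (intro set_eqI iffI)
  fix n assume "n \<in> {..<r + s}"
  then have "n = pos_idx r (Inl n) \<and> Inl n \<in> idx r s \<or> n = pos_idx r (Inr (n - r)) \<and> Inr (n - r) \<in> idx r s"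
    by (auto simp: idx_def pos_idx_def)
  then show "n \<in> pos_idx r ` idx r s" by blast
qed (use pos_idx_less in auto)

definition unit_vec :: "nat \<Rightarrow> nat \<Rightarrow>\<^sub>0 real" where "unit_vec n = Poly_Mapping.single n 1"

definition coord :: "(nat \<Rightarrow>\<^sub>0 real) \<Rightarrow> nat \<Rightarrow> real" where "coord z n = Poly_Mapping.lookup z n"

lemma coord_simps [simp]:
  "coord (z + w) n = coord z n + coord w n" "coord (c *\<^sub>R z) n = c * coord z n"
  "coord (- z) n = - coord z n" "coord (z - w) n = coord z n - coord w n" "coord 0 n = 0"
  by (simp_all add: coord_def lookup_add lookup_minus)

lemma coord_unit_vec: "coord (unit_vec m) n = (if m = n then 1 else 0)"
  by (simp add: coord_def unit_vec_def lookup_single when_def)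

lemma coord_sum: "coord (sum f A) n = (\<Sum>a\<in>A. coord (f a) n)"
  by (simp add: coord_def lookup_sum)

lemma pseudo_space_iff: "z \<in> pseudo_space r s \<longleftrightarrow> (\<forall>n\<ge>r + s. coord z n = 0)"
  by (auto simp: pseudo_space_def coord_def in_keys_iff subset_iff) (metis linorder_not_less)

lemma subspace_pseudo_space: "subspace (pseudo_space r s)"
  by (simp add: subspace_def pseudo_space_iff)

lemma unit_vec_pseudo_space: "n < r + s \<Longrightarrow> unit_vec n \<in> pseudo_space r s"
  by (simp add: pseudo_space_iff coord_unit_vec)

lemma pseudo_space_eqI:
  assumes "z \<in> pseudo_space r s" "w \<in> pseudo_space r s"
    "\<And>i. i \<in> idx r s \<Longrightarrow> coord z (pos_idx r i) = coord w (pos_idx r i)"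
  shows "z = w"
proof (rule poly_mapping_eqI)
  fix n
  have "coord z n = coord w n"
  proof (cases "n < r + s")
    case True
    then have "n \<in> pos_idx r ` idx r s" by (simp add: pos_idx_image)
    then show ?thesis using assms(3) by blast
  qed (use assms(1,2) in \<open>simp add: pseudo_space_iff\<close>)
  then show "Poly_Mapping.lookup z n = Poly_Mapping.lookup w n" by (simp add: coord_def)
qed

lemma coord_expansion:
  assumes "i \<in> idx r s"
  shows "coord (\<Sum>j\<in>idx r s. u j *\<^sub>R unit_vec (pos_idx r j)) (pos_idx r i) = u i"
proof -
  have "coord (\<Sum>j\<in>idx r s. u j *\<^sub>R unit_vec (pos_idx r j)) (pos_idx r i)
      = (\<Sum>j\<in>idx r s. if j = i then u j else 0)"
    unfolding coord_sum using assms
    by (intro sum.cong) (auto simp: coord_unit_vec pos_idx_eq_iff)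
  then show ?thesis using assms by simp
qed

lemma expansion_pseudo_space: "(\<Sum>j\<in>idx r s. u j *\<^sub>R unit_vec (pos_idx r j)) \<in> pseudo_space r s"
  by (intro subspace_sum[OF subspace_pseudo_space] subspace_scale[OF subspace_pseudo_space]
      unit_vec_pseudo_space pos_idx_less)

lemma pseudo_space_expansion:
  "z \<in> pseudo_space r s \<Longrightarrow> z = (\<Sum>i\<in>idx r s. coord z (pos_idx r i) *\<^sub>R unit_vec (pos_idx r i))"
  by (rule pseudo_space_eqI[of _ r s]) (simp_all add: expansion_pseudo_space coord_expansion)

lemma span_unit_vec: "span (unit_vec ` {..<r + s}) = pseudo_space r s"
proof
  show "span (unit_vec ` {..<r + s}) \<subseteq> pseudo_space r s"
    by (rule span_minimal[OF _ subspace_pseudo_space]) (auto intro: unit_vec_pseudo_space)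
  show "pseudo_space r s \<subseteq> span (unit_vec ` {..<r + s})"
  proof
    fix z assume "z \<in> pseudo_space r s"
    from pseudo_space_expansion[OF this] show "z \<in> span (unit_vec ` {..<r + s})"
      by (metis (no_types, lifting) pos_idx_less image_eqI lessThan_iff span_base span_scale span_sum)
  qed
qed

lemma finite_dim_pseudo_space: "finite_dim_subspace (pseudo_space r s)"
  unfolding finite_dim_subspace_def
  by (metis finite_imageI finite_lessThan span_unit_vec subspace_pseudo_space)

lemma pseudo_form_idx:
  "pseudo_form r s z w = (\<Sum>i\<in>idx r s. sgn_idx i * (coord z (pos_idx r i) * coord w (pos_idx r i)))"
  by (simp add: pseudo_form_def idx_def sum.Plus sgn_idx_def pos_idx_def coord_def o_def sum_negf)

lemma bilinear_pseudo_form: "bilinear (pseudo_form r s)"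
  unfolding bilinear_def
  by (auto intro!: linearI simp: pseudo_form_idx algebra_simps sum.distrib sum_distrib_left)

lemma pseudo_form_sym: "pseudo_form r s z w = pseudo_form r s w z"
  by (simp add: pseudo_form_idx mult.commute)

lemma pseudo_form_unit_vec:
  assumes "i \<in> idx r s"
  shows "pseudo_form r s z (unit_vec (pos_idx r i)) = sgn_idx i * coord z (pos_idx r i)"
proof -
  have "pseudo_form r s z (unit_vec (pos_idx r i))
      = (\<Sum>j\<in>idx r s. if j = i then sgn_idx j * coord z (pos_idx r j) else 0)"
    unfolding pseudo_form_idx using assms
    by (intro sum.cong) (auto simp: coord_unit_vec pos_idx_eq_iff)
  then show ?thesis using assms by simp
qed

lemma pseudo_form_nondegenerate:
  assumes "z \<in> pseudo_space r s" "\<And>w. w \<in> pseudo_space r s \<Longrightarrow> pseudo_form r s z w = 0"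
  shows "z = 0"
proof (rule pseudo_space_eqI[OF assms(1) subspace_0[OF subspace_pseudo_space]])
  fix i assume i: "i \<in> idx r s"
  then show "coord z (pos_idx r i) = coord 0 (pos_idx r i)"
    using assms(2)[of "unit_vec (pos_idx r i)"] pseudo_form_unit_vec[OF i] sgn_idx_cases[of i]
    by (auto simp: unit_vec_pseudo_space pos_idx_less)
qed

section \<open>The action of an arbitrary vector in terms of the generators\<close>

definition clifford_act ::
    "nat \<Rightarrow> nat \<Rightarrow> (nat + nat \<Rightarrow> 'a \<Rightarrow> 'a::real_vector) \<Rightarrow> (nat \<Rightarrow>\<^sub>0 real) \<Rightarrow> 'a \<Rightarrow> 'a" where
  "clifford_act r s J z x = (\<Sum>i\<in>idx r s. coord z (pos_idx r i) *\<^sub>R J i x)"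

lemma clifford_act_linear_left: "linear (\<lambda>z. clifford_act r s J z x)"
  by (intro linearI) (simp_all add: clifford_act_def scaleR_add_left sum.distrib scaleR_sum_right)

lemma clifford_act_unit_vec:
  assumes "i \<in> idx r s"
  shows "clifford_act r s J (unit_vec (pos_idx r i)) x = J i x"
proof -
  have "clifford_act r s J (unit_vec (pos_idx r i)) x = (\<Sum>j\<in>idx r s. if j = i then J j x else 0)"
    unfolding clifford_act_def using assms
    by (intro sum.cong) (auto simp: coord_unit_vec pos_idx_eq_iff)
  then show ?thesis using assms by simp
qed

abbreviation "clifford_rep r s \<equiv> clifford_form (idx r s) sgn_idx"

locale clifford_signature = clifford_form "idx r s" sgn_idx V J b
  for r s :: nat and V :: "'a::real_vector set" and J b
begin

abbreviation act_J :: "(nat \<Rightarrow>\<^sub>0 real) \<Rightarrow> 'a \<Rightarrow> 'a" where "act_J \<equiv> clifford_act r s J"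

lemma act_linear: "linear (act_J z)"
  unfolding clifford_act_def[abs_def]
  by (intro linear_compose_sum ballI linear_compose_scale_right linJ)

lemma act_V: "x \<in> V \<Longrightarrow> act_J z x \<in> V"
  unfolding clifford_act_def by (intro subspace_sum[OF subV] subspace_scale[OF subV] JV)

lemma act_skew: "x \<in> V \<Longrightarrow> y \<in> V \<Longrightarrow> b (act_J z x) y = - b x (act_J z y)"
  by (simp add: clifford_act_def linear_sum[OF bilinear_linear_left[OF bil], of _ "idx r s"]
      linear_sum[OF bilinear_linear_right[OF bil]] bilinear_lmul[OF bil] bilinear_rmul[OF bil]
      skewJ sum_negf)

lemma act_anticommutator:
  assumes x: "x \<in> V"
  shows "act_J z (act_J w x) + act_J w (act_J z x) = - (2 * pseudo_form r s z w) *\<^sub>R x"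
proof -
  let ?z = "\<lambda>i. coord z (pos_idx r i)" and ?w = "\<lambda>i. coord w (pos_idx r i)"
  have exp: "act_J u (act_J v x) = (\<Sum>i\<in>idx r s. \<Sum>j\<in>idx r s. (coord u (pos_idx r i) * coord v (pos_idx r j)) *\<^sub>R J i (J j x))"
    for u v
    unfolding clifford_act_def
    by (intro sum.cong refl) (simp add: linear_sum[OF linJ] linear_scale[OF linJ] scaleR_sum_right)
  have "act_J w (act_J z x) = (\<Sum>i\<in>idx r s. \<Sum>j\<in>idx r s. (?w j * ?z i) *\<^sub>R J j (J i x))"
    unfolding exp by (rule sum.swap)
  then have "act_J z (act_J w x) + act_J w (act_J z x) =
      (\<Sum>i\<in>idx r s. \<Sum>j\<in>idx r s. (?z i * ?w j) *\<^sub>R (J i (J j x) + J j (J i x)))"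
    by (simp add: exp scaleR_add_right sum.distrib mult.commute)
  also have "\<dots> = (\<Sum>i\<in>idx r s. \<Sum>j\<in>idx r s. if j = i then (?z i * ?w i * (- 2 * sgn_idx i)) *\<^sub>R x else 0)"
  proof (intro sum.cong refl)
    fix i j assume ij: "i \<in> idx r s" "j \<in> idx r s"
    show "(?z i * ?w j) *\<^sub>R (J i (J j x) + J j (J i x)) =
        (if j = i then (?z i * ?w i * (- 2 * sgn_idx i)) *\<^sub>R x else 0)"
      using ij x antiJ[of i j x] by (auto simp: sqJ mult_ac simp flip: scaleR_2)
  qed
  also have "\<dots> = (\<Sum>i\<in>idx r s. (?z i * ?w i * (- 2 * sgn_idx i)) *\<^sub>R x)" by simp
  also have "\<dots> = - (2 * pseudo_form r s z w) *\<^sub>R x"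
    by (simp add: pseudo_form_idx scaleR_sum_left sum_distrib_left mult_ac flip: sum_negf)
  finally show ?thesis .
qed

lemma act_sq:
  assumes "x \<in> V"
  shows "act_J z (act_J z x) = - pseudo_form r s z z *\<^sub>R x"
proof -
  have "2 *\<^sub>R act_J z (act_J z x) = 2 *\<^sub>R (- pseudo_form r s z z *\<^sub>R x)"
    using act_anticommutator[OF assms, of z z] by (simp add: scaleR_2)
  then show ?thesis unfolding scaleR_cancel_left by simp
qed

end

lemma clifford_signature_iff: "clifford_signature r s V J b \<longleftrightarrow> clifford_rep r s V J b"
  by (simp add: clifford_signature_def)

text \<open>
  The action of a module is determined by the operators \<open>J\<close> of the standard basis; these and the
  form are extended to total linear functions.
\<close>

definition represents ::
    "nat \<Rightarrow> nat \<Rightarrow> 'a::real_vector form_module \<Rightarrow> (nat + nat \<Rightarrow> 'a \<Rightarrow> 'a) \<Rightarrow> ('a \<Rightarrow> 'a \<Rightarrow> real) \<Rightarrow> bool" where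
  "represents r s U J b \<longleftrightarrow> clifford_rep r s (mspace U) J b \<and>
     (\<forall>z\<in>pseudo_space r s. \<forall>x\<in>mspace U. act U z x = clifford_act r s J z x) \<and>
     (\<forall>x\<in>mspace U. \<forall>y\<in>mspace U. form U x y = b x y)"

lemma linear_on_sum:
  assumes f: "linear_on S T f" and S: "subspace S" and "finite A" "\<And>a. a \<in> A \<Longrightarrow> v a \<in> S"
  shows "f (\<Sum>a\<in>A. c a *\<^sub>R v a) = (\<Sum>a\<in>A. c a *\<^sub>R f (v a))"
  using assms(3,4)
proof (induction A rule: finite_induct)
  case empty
  have "f (0 *\<^sub>R 0) = 0 *\<^sub>R f 0" using f S unfolding linear_on_def by (metis subspace_0)
  then show ?case by simp
next
  case (insert a A)
  have "(\<Sum>a\<in>A. c a *\<^sub>R v a) \<in> S" "c a *\<^sub>R v a \<in> S"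
    using insert S by (auto intro!: subspace_sum subspace_scale)
  then show ?case using insert f by (simp add: linear_on_def)
qed

lemma linear_on_extension:
  assumes S: "subspace S" and f: "linear_on S T f" and p: "linear p" "\<And>x. p x \<in> S"
  shows "linear (\<lambda>x. f (p x))"
  using f p by (intro linearI) (simp_all add: linear_on_def linear_add linear_scale)

text \<open>Polarising the relation for the square shows that orthogonal vectors act by
  anticommuting operators, in particular those of the standard basis. The projection
  \<open>p\<close> onto the carrier makes these operators and the form total.\<close>

lemma admissible_represents:
  fixes U :: "'a::real_vector form_module"
  assumes U: "admissible r s U"
  obtains J b where "represents r s U J b"
proof -
  define V where "V = mspace U"
  have fd: "finite_dim_subspace V"
    and lin1: "\<And>z. z \<in> pseudo_space r s \<Longrightarrow> linear_on V V (act U z)"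
    and lin2: "\<And>x. x \<in> V \<Longrightarrow> linear_on (pseudo_space r s) V (\<lambda>z. act U z x)"
    and sq: "\<And>z x. z \<in> pseudo_space r s \<Longrightarrow> x \<in> V \<Longrightarrow> act U z (act U z x) = - pseudo_form r s z z *\<^sub>R x"
    and form: "\<And>x. x \<in> V \<Longrightarrow> linear_on V UNIV (form U x)"
    "\<And>x y. x \<in> V \<Longrightarrow> y \<in> V \<Longrightarrow> form U x y = form U y x"
    "\<And>x. x \<in> V \<Longrightarrow> (\<And>y. y \<in> V \<Longrightarrow> form U x y = 0) \<Longrightarrow> x = 0"
    and skew: "\<And>z x y. z \<in> pseudo_space r s \<Longrightarrow> x \<in> V \<Longrightarrow> y \<in> V \<Longrightarrow> form U (act U z x) y + form U x (act U z y) = 0"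
    using U by (auto simp: admissible_def clifford_module_def nondegenerate_symmetric_def V_def)
  have sub: "subspace V" using fd by (simp add: finite_dim_subspace_def)
  have subZ: "subspace (pseudo_space r s)" by (rule subspace_pseudo_space)
  obtain p :: "'a \<Rightarrow> 'a" where p: "linear p" "\<And>x. p x \<in> V" "\<And>x. x \<in> V \<Longrightarrow> p x = x"
    using subspace_projection[OF sub] by metis
  define J where "J i x = act U (unit_vec (pos_idx r i)) (p x)" for i x
  define b where "b x y = form U (p x) (p y)" for x y
  have uZ: "unit_vec (pos_idx r i) \<in> pseudo_space r s" if "i \<in> idx r s" for i
    using that by (simp add: unit_vec_pseudo_space pos_idx_less)
  have JV: "act U z x \<in> V" if "z \<in> pseudo_space r s" "x \<in> V" for z x
    using lin1[OF that(1)] that(2) by (simp add: linear_on_def)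
  have anti: "act U z (act U w x) + act U w (act U z x) = - (2 * pseudo_form r s z w) *\<^sub>R x"
    if z: "z \<in> pseudo_space r s" and w: "w \<in> pseudo_space r s" and x: "x \<in> V" for z w x
  proof -
    have zw: "z + w \<in> pseudo_space r s" using z w subZ by (simp add: subspace_add)
    have add: "act U (z + w) y = act U z y + act U w y" if "y \<in> V" for y
      using lin2[OF that] z w by (simp add: linear_on_def)
    have "- pseudo_form r s (z + w) (z + w) *\<^sub>R x
        = act U z (act U z x) + act U z (act U w x) + (act U w (act U z x) + act U w (act U w x))"
      unfolding sq[OF zw x, symmetric] using add x JV z w zw lin1[OF z] lin1[OF w] by (simp add: linear_on_def subspace_add[OF sub])
    moreover have "pseudo_form r s (z + w) (z + w)
        = pseudo_form r s z z + 2 * pseudo_form r s z w + pseudo_form r s w w"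
      using pseudo_form_sym[of r s z w]
      by (simp add: bilinear_ladd[OF bilinear_pseudo_form] bilinear_radd[OF bilinear_pseudo_form])
    ultimately have "- (pseudo_form r s z z + 2 * pseudo_form r s z w + pseudo_form r s w w) *\<^sub>R x =
        - pseudo_form r s z z *\<^sub>R x + act U z (act U w x) + (act U w (act U z x) + - pseudo_form r s w w *\<^sub>R x)"
      using sq[OF z x] sq[OF w x] by simp
    then show ?thesis by (simp add: scaleR_diff_left algebra_simps)
  qed
  have "clifford_rep r s V J b"
  proof (rule clifford_form.intro)
    show "finite (idx r s)" "finite_dim_subspace V" using fd by simp_all
    show "bilinear b"
    proof -
      have "linear (\<lambda>y. form U (p x) (p y))" for x
        using linear_on_extension[OF sub form(1)[OF p(2)] p(1,2)] .
      moreover have "form U (p x) (p y) = form U (p y) (p x)" for x y using form(2) p(2) by blast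
      ultimately show ?thesis unfolding bilinear_def b_def by simp
    qed
    show "x = 0" if "x \<in> V" "\<And>y. y \<in> V \<Longrightarrow> b x y = 0" for x
      using form(3)[of x] that p(3) by (simp add: b_def)
    show "b x y = b y x" if "x \<in> V" "y \<in> V" for x y using form(2) p(2) by (simp add: b_def)
    fix i assume i: "i \<in> idx r s"
    show "linear (J i)" unfolding J_def[abs_def] using linear_on_extension[OF sub lin1[OF uZ[OF i]] p(1,2)] .
    show "sgn_idx i = 1 \<or> sgn_idx i = - 1" by (rule sgn_idx_cases)
    fix x assume x: "x \<in> V"
    show JiV: "J i x \<in> V" using JV[OF uZ[OF i] p(2)] by (simp add: J_def)
    show "J i (J i x) = - sgn_idx i *\<^sub>R x"
      using sq[OF uZ[OF i] x] pseudo_form_unit_vec[OF i] JiV x p(3)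
      by (simp add: J_def coord_unit_vec)
    show "b (J i x) y = - b x (J i y)" if "y \<in> V" for y
      using skew[OF uZ[OF i] x that] x that p(3) JV[OF uZ[OF i]] by (simp add: J_def b_def)
    show "J i (J j x) = - J j (J i x)" if "j \<in> idx r s" "i \<noteq> j" for j
    proof -
      have "pseudo_form r s (unit_vec (pos_idx r j)) (unit_vec (pos_idx r i)) = 0"
        using pseudo_form_unit_vec[OF i] that i by (simp add: coord_unit_vec pos_idx_eq_iff)
      then show ?thesis
        using anti[OF uZ[OF that(1)] uZ[OF i] x] x p(3) JV uZ that(1) i
        by (simp add: J_def add_eq_0_iff)
    qed
  qed
  moreover have "act U z x = clifford_act r s J z x" if "z \<in> pseudo_space r s" "x \<in> V" for z x
  proof -
    have "act U z x = act U (\<Sum>i\<in>idx r s. coord z (pos_idx r i) *\<^sub>R unit_vec (pos_idx r i)) x"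
      using pseudo_space_expansion[OF that(1)] by simp
    also have "\<dots> = (\<Sum>i\<in>idx r s. coord z (pos_idx r i) *\<^sub>R act U (unit_vec (pos_idx r i)) x)"
      using linear_on_sum[OF lin2[OF that(2)] subZ, where A = "idx r s"
          and v = "\<lambda>i. unit_vec (pos_idx r i)" and c = "\<lambda>i. coord z (pos_idx r i)"] uZ by simp
    finally show ?thesis using p(3)[OF that(2)] by (simp add: clifford_act_def J_def)
  qed
  moreover have "form U x y = b x y" if "x \<in> V" "y \<in> V" for x y using that p(3) by (simp add: b_def)
  ultimately have "represents r s U J b" by (simp add: represents_def V_def)
  then show ?thesis by (rule that)
qed

lemma linear_imp_linear_on: "linear f \<Longrightarrow> f ` S \<subseteq> T \<Longrightarrow> linear_on S T f"
  by (auto simp: linear_on_def linear_add linear_scale)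

lemma represents_admissible:
  assumes "represents r s U J b"
  shows "admissible r s U"
proof -
  have rep: "clifford_rep r s (mspace U) J b"
    and act: "\<And>z x. z \<in> pseudo_space r s \<Longrightarrow> x \<in> mspace U \<Longrightarrow> act U z x = clifford_act r s J z x"
    and form: "\<And>x y. x \<in> mspace U \<Longrightarrow> y \<in> mspace U \<Longrightarrow> form U x y = b x y"
    using assms by (auto simp: represents_def)
  interpret clifford_signature r s "mspace U" J b using rep by (simp add: clifford_signature_iff)
  have cong: "linear_on S T f = linear_on S T g" if "\<And>x. x \<in> S \<Longrightarrow> f x = g x" "subspace S"
    for S :: "'x::real_vector set" and T :: "'y::real_vector set" and f g
    using that by (simp add: linear_on_def subspace_add subspace_scale)
  have "linear_on (mspace U) (mspace U) (act U z)" if "z \<in> pseudo_space r s" for z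
    using linear_imp_linear_on[OF act_linear, of z "mspace U" "mspace U"] act_V act[OF that] subV
      cong[of "mspace U" "act U z" "clifford_act r s J z"] by auto
  moreover have "linear_on (pseudo_space r s) (mspace U) (\<lambda>z. act U z x)" if "x \<in> mspace U" for x
    using linear_imp_linear_on[OF clifford_act_linear_left[of r s J x], of "pseudo_space r s" "mspace U"] act_V[OF that] act[OF _ that]
      cong[OF _ subspace_pseudo_space, of r s "\<lambda>z. act U z x" "\<lambda>z. clifford_act r s J z x"] by auto
  moreover have "linear_on (mspace U) UNIV (form U x)" if "x \<in> mspace U" for x
    using linear_imp_linear_on[OF bilinear_linear_right[OF bil], of x "mspace U" UNIV] form[OF that] subV
      cong[of "mspace U" "form U x" "b x"] by auto
  ultimately show ?thesis
    unfolding admissible_def clifford_module_def nondegenerate_symmetric_def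
    using fdV by (auto simp: act form act_V act_sq act_skew intro: sym nondeg)
qed

definition mk_module ::
    "nat \<Rightarrow> nat \<Rightarrow> 'a::real_vector set \<Rightarrow> (nat + nat \<Rightarrow> 'a \<Rightarrow> 'a) \<Rightarrow> ('a \<Rightarrow> 'a \<Rightarrow> real) \<Rightarrow> 'a form_module" where
  "mk_module r s V J b = \<lparr>mspace = V, act = clifford_act r s J, form = b\<rparr>"

lemma represents_mk_module: "clifford_rep r s V J b \<Longrightarrow> represents r s (mk_module r s V J b) J b"
  by (simp add: represents_def mk_module_def)

lemma mspace_mk_module [simp]: "mspace (mk_module r s V J b) = V" by (simp add: mk_module_def)

lemma clifford_form_subset:
  assumes "clifford_form I e V J b" "subspace W" "W \<subseteq> V" "\<And>i x. i \<in> I \<Longrightarrow> x \<in> W \<Longrightarrow> J i x \<in> W"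
    "\<And>x. x \<in> W \<Longrightarrow> (\<And>y. y \<in> W \<Longrightarrow> b x y = 0) \<Longrightarrow> x = 0"
  shows "clifford_form I e W J b"
proof -
  interpret clifford_form I e V J b by fact
  show ?thesis
    using assms(3-5) finI sign linJ bil finite_dim_subspace_subset[OF fdV assms(2,3)]
    by (intro clifford_form.intro) (auto simp: subset_iff sqJ skewJ intro: antiJ sym)
qed

lemma clifford_form_transport:
  fixes f :: "'a::real_vector \<Rightarrow> 'b::real_vector"
  assumes "clifford_form I e V J b" and f: "linear f" "bij_betw f V W"
    and g: "linear g" "\<And>x. x \<in> V \<Longrightarrow> g (f x) = x"
  shows "clifford_form I e W (\<lambda>i x. f (J i (g x))) (\<lambda>x y. b (g x) (g y))"
proof -
  interpret clifford_form I e V J b by fact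
  have W: "W = f ` V" using f(2) by (simp add: bij_betw_def)
  have gW: "g x \<in> V" if "x \<in> W" for x using that g(2) W by auto
  have fg: "f (g x) = x" if "x \<in> W" for x using that g(2) W by auto
  show ?thesis
  proof (rule clifford_form.intro)
    show "finite_dim_subspace W" unfolding W using dim_linear_image[OF fdV f(1)] f(2) by (simp add: bij_betw_def)
    show "bilinear (\<lambda>x y. b (g x) (g y))" using bilinear_compose[OF bil g(1,1)] .
    show "linear (\<lambda>x. f (J i (g x)))" if "i \<in> I" for i
      using linear_compose[OF linear_compose[OF g(1) linJ[OF that]] f(1)] by (simp add: o_def)
    show "x = 0" if x: "x \<in> W" "\<And>y. y \<in> W \<Longrightarrow> b (g x) (g y) = 0" for x
    proof -
      have "g x = 0"
      proof (rule nondeg[OF gW[OF x(1)]])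
        fix y assume "y \<in> V"
        then show "b (g x) y = 0" using x(2)[of "f y"] g(2) W by simp
      qed
      then show ?thesis using fg[OF x(1)] linear_0[OF f(1)] by simp
    qed
    fix i x assume i: "i \<in> I" and x: "x \<in> W"
    show "f (J i (g x)) \<in> W" using JV[OF i gW[OF x]] W by simp
    show "f (J i (g (f (J i (g x))))) = - e i *\<^sub>R x"
      using i x by (simp add: g(2) gW JV sqJ linear_scale[OF f(1)] linear_neg[OF f(1)] fg)
    show "f (J i (g (f (J j (g x))))) = - f (J j (g (f (J i (g x)))))" if "j \<in> I" "i \<noteq> j" for j
      using i x that by (simp add: g(2) gW JV antiJ[of i j] linear_neg[OF f(1)])
    show "b (g (f (J i (g x)))) (g y) = - b (g x) (g (f (J i (g y))))" if "y \<in> W" for y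
      using i x that by (simp add: g(2) gW JV skewJ)
  qed (use sign finI sym gW in auto)
qed

text \<open>Minimality is stated against modules carried by
  \<open>nat \<Rightarrow>\<^sub>0 real\<close>. Copying \<open>W\<close> there by coordinates
  extends the comparison to all types.\<close>

lemma minimal_dim_le:
  fixes U :: "'a::real_vector form_module" and W :: "'b::real_vector set"
  assumes U: "minimal_admissible r s U" and W: "clifford_rep r s W J b" "W \<noteq> {0}"
  shows "dim (mspace U) \<le> dim W"
proof -
  have fd: "finite_dim_subspace W" using W(1) by (rule clifford_form.fdV)
  then have sub: "subspace W" by (simp add: finite_dim_subspace_def)
  obtain f :: "'b \<Rightarrow> (nat \<Rightarrow>\<^sub>0 real)" where f: "linear f" "inj_on f W"
    using finite_dim_subspace_coordinates[OF fd] by metis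
  then have bij: "bij_betw f W (f ` W)" by (simp add: bij_betw_def)
  then obtain g where g: "linear g" "\<And>x. x \<in> W \<Longrightarrow> g (f x) = x"
    using linear_bij_betw_inverse[OF sub f(1)] by metis
  define X where "X = mk_module r s (f ` W) (\<lambda>i x. f (J i (g x))) (\<lambda>x y. b (g x) (g y))"
  have "represents r s X (\<lambda>i x. f (J i (g x))) (\<lambda>x y. b (g x) (g y))"
    unfolding X_def by (intro represents_mk_module clifford_form_transport[OF W(1) f(1) bij g])
  then have "admissible r s X" by (rule represents_admissible)
  moreover have "mspace X \<noteq> {0}"
    using W(2) g(2) linear_0[OF g(1)] subspace_0[OF sub] by (auto simp: X_def) (metis image_eqI singletonD)
  ultimately have "dim (mspace U) \<le> dim (mspace X)" using U by (simp add: minimal_admissible_def)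
  then show ?thesis using dim_linear_image[OF fd f] by (simp add: X_def)
qed

lemma linearly_isomorphic_dim:
  assumes "finite_dim_subspace V" "linearly_isomorphic V W"
  shows "dim V = dim W"
proof -
  obtain f where f: "linear f" "inj_on f V" "f ` V = W"
    using assms(2) by (auto simp: linearly_isomorphic_def bij_betw_def)
  show ?thesis using dim_linear_image(1)[OF assms(1) f(1,2)] f(3) by simp
qed

text \<open>A nondegenerate invariant subspace is an admissible module, hence at least as large as
  \<open>U\<close>. Only the dimension of \<open>V\<close> is compared with that of
  \<open>U\<close>, so the lemma also applies to a structure not yet known to be minimal, such as a
  flipped one.\<close>

lemma minimal_simple:
  fixes U :: "'a::real_vector form_module" and V :: "'b::real_vector set"
  assumes U: "minimal_admissible r s U" and V: "clifford_rep r s V J b"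
    and iso: "linearly_isomorphic V (mspace U)"
  shows "simple_form V (J ` idx r s) b"
  unfolding simple_form_def
proof (intro conjI allI impI)
  have fd: "finite_dim_subspace V" using V by (rule clifford_form.fdV)
  show "V \<noteq> {0}"
  proof
    assume "V = {0}"
    moreover obtain f where "linear f" "f ` V = mspace U"
      using iso by (auto simp: linearly_isomorphic_def bij_betw_def)
    ultimately have "mspace U = {0}" using linear_0[of f] by auto
    then show False using U by (simp add: minimal_admissible_def)
  qed
  fix W
  assume "subspace W \<and> W \<subseteq> V \<and> W \<noteq> {0} \<and> (\<forall>f\<in>J ` idx r s. f ` W \<subseteq> W) \<and>
     (\<forall>x\<in>W. (\<forall>y\<in>W. b x y = 0) \<longrightarrow> x = 0)"
  then have W: "subspace W" "W \<subseteq> V" "W \<noteq> {0}" and inv: "\<And>i x. i \<in> idx r s \<Longrightarrow> x \<in> W \<Longrightarrow> J i x \<in> W"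
    and nd: "\<And>x. x \<in> W \<Longrightarrow> (\<And>y. y \<in> W \<Longrightarrow> b x y = 0) \<Longrightarrow> x = 0" by auto
  have "clifford_rep r s W J b"
    using V W(1,2) inv nd by (rule clifford_form_subset)
  then have "dim (mspace U) \<le> dim W" using minimal_dim_le[OF U] W(3) by blast
  then show "W = V"
    using finite_dim_subspace_dim_eq[OF fd W(1,2)] linearly_isomorphic_dim[OF fd iso] by simp
qed

section \<open>The volume form\<close>

context clifford_form begin

definition prodJ :: "'i list \<Rightarrow> 'a \<Rightarrow> 'a" where "prodJ xs = foldr J xs"

lemma prodJ_simps [simp]: "prodJ [] x = x" "prodJ (i # xs) x = J i (prodJ xs x)"
  by (simp_all add: prodJ_def)

lemma prodJ_V: "set xs \<subseteq> I \<Longrightarrow> x \<in> V \<Longrightarrow> prodJ xs x \<in> V"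
  by (induction xs) (simp_all add: JV)

lemma linear_prodJ: "set xs \<subseteq> I \<Longrightarrow> linear (prodJ xs)"
proof (induction xs)
  case Nil
  then show ?case using linear_ident by (simp add: prodJ_def id_def)
next
  case (Cons i xs)
  then show ?case using linear_compose[of "prodJ xs" "J i"] linJ by (simp add: prodJ_def o_def)
qed

lemma J_prodJ_notin:
  "set xs \<subseteq> I \<Longrightarrow> i \<in> I \<Longrightarrow> i \<notin> set xs \<Longrightarrow> x \<in> V \<Longrightarrow>
    J i (prodJ xs x) = (- 1) ^ length xs *\<^sub>R prodJ xs (J i x)"
proof (induction xs)
  case (Cons j xs)
  then have "J i (J j (prodJ xs x)) = - J j (J i (prodJ xs x))"
    by (intro antiJ prodJ_V) auto
  with Cons show ?case by (simp add: linear_scale[OF linJ] linear_neg[OF linJ])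
qed simp

lemma J_prodJ_in:
  "set xs \<subseteq> I \<Longrightarrow> distinct xs \<Longrightarrow> i \<in> set xs \<Longrightarrow> x \<in> V \<Longrightarrow>
    J i (prodJ xs x) = (- 1) ^ (length xs - 1) *\<^sub>R prodJ xs (J i x)"
proof (induction xs)
  case (Cons j xs)
  show ?case
  proof (cases "i = j")
    case True
    then show ?thesis using Cons.prems J_prodJ_notin[of xs i x] prodJ_V[of xs "J i x"] JV[of i x]
      by (simp add: linear_scale[OF linJ])
  next
    case False
    then have i: "i \<in> set xs" "i \<in> I" using Cons.prems by auto
    then have "J i (J j (prodJ xs x)) = - J j (J i (prodJ xs x))"
      using False Cons.prems by (intro antiJ prodJ_V) auto
    moreover have "length xs = Suc (length xs - 1)" using i(1) by (cases xs) auto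
    ultimately show ?thesis using Cons i
      by (simp add: linear_scale[OF linJ] linear_neg[OF linJ]) (metis power_Suc mult_minus1 scaleR_minus_left)
  qed
qed simp

text \<open>For \<open>n\<close> factors the exponent \<open>n * (n + 1) div 2\<close> has two
  sources: \<open>n * (n - 1) div 2\<close> exchanges reverse the word, and each of the
  \<open>n\<close> squares is \<open>- e i\<close>.\<close>

lemma prodJ_sq:
  "set xs \<subseteq> I \<Longrightarrow> distinct xs \<Longrightarrow> x \<in> V \<Longrightarrow>
    prodJ xs (prodJ xs x) = ((- 1) ^ (length xs * (length xs + 1) div 2) * (\<Prod>i\<leftarrow>xs. e i)) *\<^sub>R x"
proof (induction xs)
  case (Cons j xs)
  let ?m = "length xs"
  have j: "j \<in> I" "j \<notin> set xs" and xs: "set xs \<subseteq> I" using Cons.prems by auto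
  have V: "prodJ xs x \<in> V" using Cons.prems prodJ_V by auto
  have sgn: "(- 1 :: real) ^ ?m * (- 1) ^ ?m = 1" by (simp flip: power_mult_distrib)
  have "prodJ xs (J j (prodJ xs x)) = (- 1) ^ ?m *\<^sub>R J j (prodJ xs (prodJ xs x))"
    using J_prodJ_notin[OF xs j V] by (simp add: sgn)
  then have "J j (prodJ xs (J j (prodJ xs x))) = ((- 1) ^ ?m * (- e j)) *\<^sub>R prodJ xs (prodJ xs x)"
    using sqJ[OF j(1) prodJ_V[OF xs V]] by (simp add: linear_scale[OF linJ[OF j(1)]])
  moreover have "Suc ?m * (Suc ?m + 1) div 2 = ?m * (?m + 1) div 2 + Suc ?m"
    by (simp add: algebra_simps)
  ultimately show ?case using Cons by (simp add: power_add mult_ac)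
qed simp

lemma prodJ_isometry:
  "set xs \<subseteq> I \<Longrightarrow> x \<in> V \<Longrightarrow> y \<in> V \<Longrightarrow> b (prodJ xs x) (prodJ xs y) = (\<Prod>i\<leftarrow>xs. e i) * b x y"
  by (induction xs) (simp_all add: isoJ prodJ_V)

text \<open>A product of all generators commutes with each of them when their number is odd, and it
  is self-adjoint as an isometric involution. Its fixed space is then invariant and nondegenerate,
  hence 0 or \<open>V\<close>.\<close>

lemma simple_prodJ_scalar:
  assumes simple: "simple_form V (J ` I) b" and xs: "set xs = I" "distinct xs" "odd (length xs)"
    and e1: "(\<Prod>i\<leftarrow>xs. e i) = 1" and sq: "\<And>x. x \<in> V \<Longrightarrow> prodJ xs (prodJ xs x) = x"
  obtains d where "d = 1 \<or> d = - 1" "\<And>x. x \<in> V \<Longrightarrow> prodJ xs x = d *\<^sub>R x"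
proof -
  let ?O = "prodJ xs"
  have sub: "set xs \<subseteq> I" using xs by simp
  have OV: "?O x \<in> V" if "x \<in> V" for x using that prodJ_V sub by simp
  have lin: "linear ?O" using linear_prodJ sub by simp
  have comm: "J i (?O x) = ?O (J i x)" if "i \<in> I" "x \<in> V" for i x
    using J_prodJ_in[of xs i x] that xs by simp
  have sa: "b (?O x) y = b x (?O y)" if "x \<in> V" "y \<in> V" for x y
    using prodJ_isometry[OF sub that(1) OV[OF that(2)]] sq[OF that(2)] e1 by simp
  define W where "W = {x\<in>V. ?O x = x}"
  show ?thesis
  proof (cases "W = {0}")
    case True
    have "?O x = (- 1) *\<^sub>R x" if x: "x \<in> V" for x
    proof -
      have "x + ?O x \<in> W" using x OV sq subV by (simp add: W_def subspace_add linear_add[OF lin] add.commute)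
      then have "x + ?O x = 0" using True by simp
      then show ?thesis by (simp add: add_eq_0_iff)
    qed
    then show ?thesis using that[of "- 1"] by simp
  next
    case False
    have subW: "subspace W"
      using subV by (auto simp: W_def subspace_def linear_0[OF lin] linear_add[OF lin] linear_scale[OF lin])
    obtain w where w: "w \<in> W" "w \<noteq> 0" using False subspace_0[OF subW] by auto
    have "W = V"
    proof (rule simple_formD[OF simple subW _ w])
      show "W \<subseteq> V" by (auto simp: W_def)
      show "f x \<in> W" if "f \<in> J ` I" "x \<in> W" for f x
        using that comm JV by (auto simp: W_def) metis
      show "x = 0" if x: "x \<in> W" "\<And>y. y \<in> W \<Longrightarrow> b x y = 0" for x
      proof (rule nondeg)
        show xV: "x \<in> V" using x(1) by (simp add: W_def)
        fix y assume y: "y \<in> V"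
        have "y + ?O y \<in> W" using y OV sq subV by (simp add: W_def subspace_add linear_add[OF lin] add.commute)
        then have "b x y + b x (?O y) = 0" using x(2) by (simp add: bilinear_radd[OF bil, symmetric])
        moreover have "b x (?O y) = b x y" using sa[OF xV y] x(1) by (simp add: W_def)
        ultimately show "b x y = 0" by simp
      qed
    qed
    then show ?thesis using that[of 1] by (auto simp: W_def)
  qed
qed

lemma clifford_form_scale:
  assumes "t * t = 1"
  shows "clifford_form I e V (\<lambda>i x. t *\<^sub>R J i x) b"
proof (rule clifford_form.intro[OF finI fdV sign _ _ _ _ bil sym nondeg])
  fix i assume i: "i \<in> I"
  show "linear (\<lambda>x. t *\<^sub>R J i x)" using linJ[OF i] by (rule linear_compose_scale_right)
  fix x assume x: "x \<in> V"
  show "t *\<^sub>R J i x \<in> V" using i x JV subV by (simp add: subspace_scale)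
  show "t *\<^sub>R J i (t *\<^sub>R J i x) = - e i *\<^sub>R x"
    using i x assms by (simp add: linear_scale[OF linJ] sqJ)
  show "b (t *\<^sub>R J i x) y = - b x (t *\<^sub>R J i y)" if "y \<in> V" for y
    using i x that by (simp add: bilinear_lmul[OF bil] bilinear_rmul[OF bil] skewJ)
  show "t *\<^sub>R J i (t *\<^sub>R J j x) = - (t *\<^sub>R J j (t *\<^sub>R J i x))" if "j \<in> I" "i \<noteq> j" for j
    using i x that assms by (simp add: linear_scale[OF linJ] antiJ[of i j])
qed auto

end

section \<open>The volume form of signature \<open>(r, s)\<close>\<close>

definition idx_list :: "nat \<Rightarrow> nat \<Rightarrow> (nat + nat) list" where
  "idx_list r s = map (\<lambda>n. if n < r then Inl n else Inr (n - r)) [0..<r + s]"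

lemma set_idx_list: "set (idx_list r s) = idx r s"
proof
  show "set (idx_list r s) \<subseteq> idx r s" by (auto simp: idx_list_def idx_def)
  show "idx r s \<subseteq> set (idx_list r s)"
  proof
    fix i assume "i \<in> idx r s"
    then have "pos_idx r i < r + s" "i = (if pos_idx r i < r then Inl (pos_idx r i) else Inr (pos_idx r i - r))"
      by (auto simp: idx_def pos_idx_def)
    then show "i \<in> set (idx_list r s)" unfolding idx_list_def set_map
      by (intro image_eqI[of _ _ "pos_idx r i"]) auto
  qed
qed

lemma distinct_idx_list: "distinct (idx_list r s)"
  by (auto simp: idx_list_def distinct_map inj_on_def split: if_splits)

lemma length_idx_list: "length (idx_list r s) = r + s" by (simp add: idx_list_def)

lemma map_pos_idx_list: "map (pos_idx r) (idx_list r s) = [0..<r + s]"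
  by (auto simp: idx_list_def pos_idx_def intro: map_idI)

lemma prod_idx_list: "(\<Prod>i\<leftarrow>idx_list r s. sgn_idx i) = (- 1) ^ s"
proof -
  have "(\<Prod>i\<leftarrow>idx_list r s. sgn_idx i) = (\<Prod>i\<in>idx r s. sgn_idx i)"
    unfolding set_idx_list[symmetric] by (rule prod.distinct_set_conv_list[OF distinct_idx_list, symmetric])
  also have "\<dots> = (- 1) ^ s" by (simp add: idx_def prod.Plus sgn_idx_def)
  finally show ?thesis .
qed

lemma volume_form_prodJ:
  assumes "represents r s U J b" "x \<in> mspace U"
  shows "volume_form r s U x = foldr J (idx_list r s) x"
proof -
  have rep: "clifford_rep r s (mspace U) J b"
    and act: "\<And>z x. z \<in> pseudo_space r s \<Longrightarrow> x \<in> mspace U \<Longrightarrow> act U z x = clifford_act r s J z x"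
    using assms(1) by (auto simp: represents_def)
  interpret clifford_form "idx r s" sgn_idx "mspace U" J b by fact
  have "foldr (\<lambda>n. act U (Poly_Mapping.single n 1)) (map (pos_idx r) xs) x = prodJ xs x"
    if "set xs \<subseteq> idx r s" for xs
    using that
  proof (induction xs)
    case (Cons i xs)
    then have "unit_vec (pos_idx r i) \<in> pseudo_space r s" "prodJ xs x \<in> mspace U" "i \<in> idx r s"
      using assms(2) prodJ_V by (auto simp: unit_vec_pseudo_space pos_idx_less)
    then show ?case using Cons act clifford_act_unit_vec[of i r s J] by (simp add: unit_vec_def)
  qed simp
  from this[of "idx_list r s"] show ?thesis
    by (simp add: volume_form_def map_pos_idx_list set_idx_list prodJ_def)
qed

text \<open>The volume form multiplies \<open>b\<close> by \<open>(- 1) ^ s\<close>, so for odd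
  \<open>s\<close> it cannot be the identity on a nonzero nondegenerate space. In the converse
  direction it is a central self-adjoint involution, hence \<open>d = 1\<close> or
  \<open>d = - 1\<close> on the given module, and replacing \<open>J\<close> by \<open>- J\<close>
  provides the other sign.\<close>

lemma two_minimal_modules_iff:
  fixes U :: "'a::real_vector form_module"
  assumes U: "minimal_admissible r s U"
  shows "two_minimal_modules r s \<longleftrightarrow> (int r - int s) mod 4 = 3 \<and> even s"
proof
  assume "two_minimal_modules r s"
  then obtain X :: "(nat \<Rightarrow>\<^sub>0 real) form_module"
    where m4: "(int r - int s) mod 4 = 3" and X: "minimal_plus r s X"
    by (auto simp: two_minimal_modules_def)
  have adm: "admissible r s X" and ne: "mspace X \<noteq> {0}"
    using X by (auto simp: minimal_plus_def minimal_admissible_def)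
  obtain J b where rep: "represents r s X J b" using admissible_represents[OF adm] .
  then have cr: "clifford_rep r s (mspace X) J b" by (simp add: represents_def)
  then interpret clifford_form "idx r s" sgn_idx "mspace X" J b .
  have vol: "prodJ (idx_list r s) x = x" if "x \<in> mspace X" for x
    using volume_form_prodJ[OF rep that] X that by (simp add: minimal_plus_def prodJ_def)
  have "even s"
  proof (rule ccontr)
    assume "odd s"
    then have "b x y = 0" if "x \<in> mspace X" "y \<in> mspace X" for x y
      using prodJ_isometry[of "idx_list r s" x y] vol that by (simp add: set_idx_list prod_idx_list)
    then have "x = 0" if "x \<in> mspace X" for x using nondeg that by blast
    then show False using ne subspace_0[OF subV] by auto
  qed
  then show "(int r - int s) mod 4 = 3 \<and> even s" using m4 by simp
next
  assume rs: "(int r - int s) mod 4 = 3 \<and> even s"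
  define n where "n = r + s"
  \<comment> \<open>As \<open>s\<close> is even, \<open>n\<close> is 3 modulo 4: thus
    \<open>n\<close> is odd, which makes the volume form central, and the exponent in its square is
    even.\<close>
  have "int n = (int r - int s) + 2 * int s" by (simp add: n_def)
  moreover obtain t where "s = 2 * t" using rs by auto
  ultimately have "int n mod 4 = 3" using rs by presburger
  then have n4: "n mod 4 = 3" by presburger
  have on: "odd n" using n4 by presburger
  define q where "q = n div 4"
  have nq: "n = 4 * q + 3" using n4 by (simp add: q_def) presburger
  have "n * (n + 1) div 2 = (4 * q + 3) * (2 * (q + 1))" unfolding nq by (simp add: algebra_simps)
  then have en: "even (n * (n + 1) div 2)" by simp
  have admU: "admissible r s U" and neU: "mspace U \<noteq> {0}"
    and minU: "\<And>X :: (nat \<Rightarrow>\<^sub>0 real) form_module. admissible r s X \<Longrightarrow> mspace X \<noteq> {0} \<Longrightarrow> dim (mspace U) \<le> dim (mspace X)"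
    using U by (auto simp: minimal_admissible_def)
  obtain J b where repU: "represents r s U J b" using admissible_represents[OF admU] .
  then have crU: "clifford_rep r s (mspace U) J b" by (simp add: represents_def)
  then have fdU: "finite_dim_subspace (mspace U)" by (rule clifford_form.fdV)
  then have subU: "subspace (mspace U)" by (simp add: finite_dim_subspace_def)
  obtain f :: "'a \<Rightarrow> (nat \<Rightarrow>\<^sub>0 real)" where f: "linear f" "inj_on f (mspace U)"
    using finite_dim_subspace_coordinates[OF fdU] by metis
  define W where "W = f ` mspace U"
  have bij: "bij_betw f (mspace U) W" using f(2) by (simp add: bij_betw_def W_def)
  obtain g where g: "linear g" "bij_betw g W (mspace U)" "\<And>x. x \<in> mspace U \<Longrightarrow> g (f x) = x"
    using linear_bij_betw_inverse[OF subU f(1) bij] by metis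
  define K where "K i x = f (J i (g x))" for i x
  define c where "c x y = b (g x) (g y)" for x y
  have crW: "clifford_rep r s W K c"
    unfolding K_def[abs_def] c_def[abs_def] by (rule clifford_form_transport[OF crU f(1) bij g(1,3)])
  interpret clifford_form "idx r s" sgn_idx W K c by (rule crW)
  have simple: "simple_form W (K ` idx r s) c"
    using minimal_simple[OF U crW] g(1,2) by (auto simp: linearly_isomorphic_def)
  have dimW: "dim W = dim (mspace U)" using dim_linear_image(1)[OF fdU f] by (simp add: W_def)
  have neW: "W \<noteq> {0}" using simple by (simp add: simple_form_def)
  obtain d where d: "d = 1 \<or> d = - 1" "\<And>x. x \<in> W \<Longrightarrow> prodJ (idx_list r s) x = d *\<^sub>R x"
  proof (rule simple_prodJ_scalar[OF simple set_idx_list distinct_idx_list])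
    show "odd (length (idx_list r s))" using on by (simp add: length_idx_list n_def)
    show one: "(\<Prod>i\<leftarrow>idx_list r s. sgn_idx i) = 1" using rs by (simp add: prod_idx_list)
    show "prodJ (idx_list r s) (prodJ (idx_list r s) x) = x" if "x \<in> W" for x
      using prodJ_sq[of "idx_list r s" x] that en one
      by (simp add: set_idx_list distinct_idx_list length_idx_list n_def)
  qed auto
  \<comment> \<open>Scaling the generators by \<open>t\<close> scales the volume form by
    \<open>t ^ n\<close>, which is \<open>t\<close> for odd \<open>n\<close>. So \<open>M d\<close>
    is the plus module and \<open>M (- d)\<close> the minus module.\<close>
  define M where "M t = mk_module r s W (\<lambda>i x. t *\<^sub>R K i x) c" for t :: real
  have M: "minimal_admissible r s (M t) \<and> (\<forall>x\<in>W. volume_form r s (M t) x = (t * d) *\<^sub>R x)"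
    if t: "t = 1 \<or> t = - 1" for t
  proof -
    have "t * t = 1" using t by auto
    then have cr: "clifford_rep r s W (\<lambda>i x. t *\<^sub>R K i x) c" by (rule clifford_form_scale)
    then have rep: "represents r s (M t) (\<lambda>i x. t *\<^sub>R K i x) c" unfolding M_def by (rule represents_mk_module)
    have "minimal_admissible r s (M t)"
      using represents_admissible[OF rep] neW minU dimW by (simp add: minimal_admissible_def M_def)
    moreover have "foldr (\<lambda>i x. t *\<^sub>R K i x) xs x = t ^ length xs *\<^sub>R prodJ xs x"
      if "set xs \<subseteq> idx r s" "x \<in> W" for xs x
      using that by (induction xs) (simp_all add: linear_scale[OF linJ])
    then have "volume_form r s (M t) x = (t * d) *\<^sub>R x" if "x \<in> W" for x
      using volume_form_prodJ[OF rep] that d(2) t on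
      by (auto simp: M_def set_idx_list length_idx_list n_def)
    ultimately show ?thesis by blast
  qed
  have "minimal_plus r s (M d)" "minimal_minus r s (M (- d))"
    using M[of d] M[of "- d"] d(1) by (auto simp: minimal_plus_def minimal_minus_def M_def)
  then show "two_minimal_modules r s" using rs unfolding two_minimal_modules_def by blast
qed

text \<open>The sign relating the second summand to the first. Depending only on
  \<open>r - s\<close> modulo 4 and the parity of \<open>s\<close>, it is unchanged by all three
  periodicities.\<close>

definition second_sign :: "nat \<Rightarrow> nat \<Rightarrow> real" where
  "second_sign r s = (if (int r - int s) mod 4 = 3 \<and> even s then - 1 else 1)"

lemma second_sign_cases: "second_sign r s = 1 \<or> second_sign r s = - 1"
  by (simp add: second_sign_def)

text \<open>This unites the two cases of \<open>double_summands\<close>: up to an isometry, the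
  second summand is the first with \<open>J\<close> multiplied by the sign. In the case of two
  modules the isometry comes from the normalisation in \<open>opposite_modules\<close>.\<close>

lemma double_summands_represents:
  assumes ds: "double_summands r s V1 V2" and rep: "represents r s V1 J b"
  obtains T J' b' where "represents r s V2 J' b'" "linear T" "bij_betw T (mspace V1) (mspace V2)"
    "\<And>i x. i \<in> idx r s \<Longrightarrow> x \<in> mspace V1 \<Longrightarrow> J' i (T x) = second_sign r s *\<^sub>R T (J i x)"
    "\<And>x y. x \<in> mspace V1 \<Longrightarrow> y \<in> mspace V1 \<Longrightarrow> b' (T x) (T y) = b x y"
    "minimal_admissible r s V1"
proof (cases "two_minimal_modules r s")
  case True
  then have plus: "minimal_plus r s V1" and minus: "minimal_minus r s V2" and opp: "opposite_modules r s V1 V2"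
    using ds by (auto simp: double_summands_def)
  have min: "minimal_admissible r s V1" "minimal_admissible r s V2"
    using plus minus by (auto simp: minimal_plus_def minimal_minus_def)
  have sgn: "second_sign r s = - 1"
    using True two_minimal_modules_iff[OF min(1)] by (simp add: second_sign_def)
  obtain J' b' where rep': "represents r s V2 J' b'"
    using admissible_represents[of r s V2] min(2) by (auto simp: minimal_admissible_def)
  obtain T0 where T0: "linear_on (mspace V1) (mspace V2) T0" "bij_betw T0 (mspace V1) (mspace V2)"
      "\<And>z x. z \<in> pseudo_space r s \<Longrightarrow> x \<in> mspace V1 \<Longrightarrow> T0 (act V1 z x) = - act V2 z (T0 x)"
      "\<And>x y. x \<in> mspace V1 \<Longrightarrow> y \<in> mspace V1 \<Longrightarrow> form V2 (T0 x) (T0 y) = form V1 x y"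
    using opp by (auto simp: opposite_modules_def)
  interpret c: clifford_form "idx r s" sgn_idx "mspace V1" J b using rep by (simp add: represents_def)
  interpret c': clifford_form "idx r s" sgn_idx "mspace V2" J' b' using rep' by (simp add: represents_def)
  obtain p :: "'a \<Rightarrow> 'a" where p: "linear p" "\<And>x. p x \<in> mspace V1" "\<And>x. x \<in> mspace V1 \<Longrightarrow> p x = x"
    using subspace_projection[OF c.subV] by metis
  define T where "T x = T0 (p x)" for x
  have TV: "T x = T0 x" if "x \<in> mspace V1" for x using that p(3) by (simp add: T_def)
  have T0V: "T0 x \<in> mspace V2" if "x \<in> mspace V1" for x using T0(1) that by (simp add: linear_on_def)
  show ?thesis
  proof (rule that[OF rep'])
    show "linear T" unfolding T_def[abs_def] using linear_on_extension[OF c.subV T0(1) p(1,2)] .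
    show "bij_betw T (mspace V1) (mspace V2)" using T0(2) bij_betw_cong[of "mspace V1" T T0, OF TV] by simp
    show "b' (T x) (T y) = b x y" if "x \<in> mspace V1" "y \<in> mspace V1" for x y
      using T0(4)[OF that] rep rep' that T0V by (simp add: represents_def TV)
    show "J' i (T x) = second_sign r s *\<^sub>R T (J i x)" if i: "i \<in> idx r s" and x: "x \<in> mspace V1" for i x
    proof -
      have u: "unit_vec (pos_idx r i) \<in> pseudo_space r s"
        using i by (simp add: unit_vec_pseudo_space pos_idx_less)
      have "J' i (T0 x) = act V2 (unit_vec (pos_idx r i)) (T0 x)"
        using rep' u T0V[OF x] clifford_act_unit_vec[OF i, of J'] by (simp add: represents_def)
      also have "\<dots> = - T0 (act V1 (unit_vec (pos_idx r i)) x)" using T0(3)[OF u x] by simp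
      also have "act V1 (unit_vec (pos_idx r i)) x = J i x"
        using rep u x clifford_act_unit_vec[OF i, of J] by (simp add: represents_def)
      finally show ?thesis using c.JV[OF i x] x by (simp add: TV sgn)
    qed
    show "minimal_admissible r s V1" by (rule min(1))
  qed
next
  case False
  then have min: "minimal_admissible r s V1" and eq: "V2 = V1" using ds by (auto simp: double_summands_def)
  have "second_sign r s = 1"
    using False two_minimal_modules_iff[OF min] by (auto simp: second_sign_def)
  then show ?thesis using rep min eq by (intro that[of J b "\<lambda>x. x"]) (simp_all add: linear_ident bij_betw_def)
qed

section \<open>Isomorphisms of the Lie algebras\<close>

lemma module_bracket_eq:
  assumes rep: "represents r s U J b" and x: "x \<in> mspace U" and y: "y \<in> mspace U"
  shows "module_bracket r s U x y = (\<Sum>i\<in>idx r s. (sgn_idx i * b (J i x) y) *\<^sub>R unit_vec (pos_idx r i))"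
    (is "_ = ?w")
    and "z \<in> pseudo_space r s \<Longrightarrow> b (clifford_act r s J z x) y = pseudo_form r s z (module_bracket r s U x y)"
proof -
  have cr: "clifford_rep r s (mspace U) J b"
    and act: "\<And>z x. z \<in> pseudo_space r s \<Longrightarrow> x \<in> mspace U \<Longrightarrow> act U z x = clifford_act r s J z x"
    and form: "\<And>x y. x \<in> mspace U \<Longrightarrow> y \<in> mspace U \<Longrightarrow> form U x y = b x y"
    using rep by (auto simp: represents_def)
  interpret clifford_signature r s "mspace U" J b using cr by (simp add: clifford_signature_iff)
  have eq: "b (act_J z x) y = pseudo_form r s z ?w" for z
  proof -
    have "pseudo_form r s z ?w = (\<Sum>i\<in>idx r s. coord z (pos_idx r i) * b (J i x) y)"
      unfolding pseudo_form_idx by (intro sum.cong refl) (simp add: coord_expansion)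
    then show ?thesis
      by (simp add: clifford_act_def linear_sum[OF bilinear_linear_left[OF bil], of _ "idx r s"] bilinear_lmul[OF bil])
  qed
  show "module_bracket r s U x y = ?w"
    unfolding module_bracket_def
  proof (rule the_equality)
    have "form U (act U z x) y = pseudo_form r s z ?w" if "z \<in> pseudo_space r s" for z
      using eq[of z] act[OF that x] form act_V[OF x] y by simp
    then show "?w \<in> pseudo_space r s \<and> (\<forall>z\<in>pseudo_space r s. form U (act U z x) y = pseudo_form r s z ?w)"
      by (intro conjI ballI expansion_pseudo_space)
    fix w assume w: "w \<in> pseudo_space r s \<and> (\<forall>z\<in>pseudo_space r s. form U (act U z x) y = pseudo_form r s z w)"
    have "w - ?w = 0"
    proof (rule pseudo_form_nondegenerate)
      show "w - ?w \<in> pseudo_space r s"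
        using w expansion_pseudo_space subspace_pseudo_space by (simp add: subspace_diff)
      fix z assume z: "z \<in> pseudo_space r s"
      then have "pseudo_form r s z w = pseudo_form r s z ?w"
        using conjunct2[OF w, THEN bspec, OF z] eq[of z] act[OF z x] form[OF act_V[OF x] y] by simp
      then show "pseudo_form r s (w - ?w) z = 0"
        by (simp add: pseudo_form_sym[of r s _ z] bilinear_rsub[OF bilinear_pseudo_form])
    qed
    then show "w = ?w" by simp
  qed
  then show "z \<in> pseudo_space r s \<Longrightarrow> b (clifford_act r s J z x) y = pseudo_form r s z (module_bracket r s U x y)"
    using eq by simp
qed

lemma module_bracket_pseudo_space:
  "represents r s U J b \<Longrightarrow> x \<in> mspace U \<Longrightarrow> y \<in> mspace U \<Longrightarrow> module_bracket r s U x y \<in> pseudo_space r s"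
  by (simp add: module_bracket_eq(1) expansion_pseudo_space)

lemma module_bracket_0:
  assumes rep: "represents r s U J b" and y: "y \<in> mspace U"
  shows "module_bracket r s U 0 y = 0" "module_bracket r s U y 0 = 0"
proof -
  interpret clifford_form "idx r s" sgn_idx "mspace U" J b using rep by (simp add: represents_def)
  show "module_bracket r s U 0 y = 0" "module_bracket r s U y 0 = 0"
    using subspace_0[OF subV] y
    by (simp_all add: module_bracket_eq(1)[OF rep] linear_0[OF linJ] bilinear_lzero[OF bil] bilinear_rzero[OF bil])
qed

text \<open>Each \<open>J i\<close> is injective, so with at least one generator no nonzero vector
  of the module is central. This identifies the centre of the algebra with
  \<open>pseudo_space r s\<close>.\<close>

lemma module_bracket_central:
  assumes rep: "represents r s U J b" and rs: "r + s > 0" and x: "x \<in> mspace U"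
    and zero: "\<And>y. y \<in> mspace U \<Longrightarrow> module_bracket r s U x y = 0"
  shows "x = 0"
proof -
  interpret clifford_form "idx r s" sgn_idx "mspace U" J b using rep by (simp add: represents_def)
  have "0 \<in> pos_idx r ` idx r s" using rs by (simp add: pos_idx_image)
  then obtain i where i: "i \<in> idx r s" by auto
  have "J i x = 0"
  proof (rule nondeg[OF JV[OF i x]])
    fix y assume y: "y \<in> mspace U"
    have "sgn_idx i * b (J i x) y = coord (module_bracket r s U x y) (pos_idx r i)"
      using coord_expansion[OF i] by (simp add: module_bracket_eq(1)[OF rep x y])
    then show "b (J i x) y = 0" using zero[OF y] sgn_idx_cases[of i] by auto
  qed
  then show ?thesis using J_eq_0[OF i x] by simp
qed

lemma pseudo_H_algebra_simps:
  "lie_carrier (pseudo_H_algebra r s U) = mspace U \<times> pseudo_space r s"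
  "lie_bracket (pseudo_H_algebra r s U) (x, z) (y, w) = (0, module_bracket r s U x y)"
  by (simp_all add: pseudo_H_algebra_def)

text \<open>An isomorphism maps centre to centre, so \<open>f (0, z)\<close> has no module
  component. The part of \<open>f\<close> from the module into the centre is discarded: it does not
  affect brackets. What is left are \<open>A\<close> and \<open>C\<close>.\<close>

lemma lie_isomorphism_components:
  fixes U :: "'a::real_vector form_module" and V :: "'b::real_vector form_module"
  assumes repU: "represents r s U J b" and repV: "represents p q V J' b'"
    and rs: "r + s > 0" "p + q > 0"
    and iso: "lie_isomorphic (pseudo_H_algebra r s U) (pseudo_H_algebra p q V)"
  obtains A C where "linear A" "bij_betw A (mspace U) (mspace V)" "linear C" "C ` pseudo_space r s \<subseteq> pseudo_space p q"
    "\<And>x y. x \<in> mspace U \<Longrightarrow> y \<in> mspace U \<Longrightarrow>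
      C (module_bracket r s U x y) = module_bracket p q V (A x) (A y)"
proof -
  let ?U = "mspace U" and ?V = "mspace V" and ?Z = "pseudo_space r s" and ?Y = "pseudo_space p q"
  let ?m = "module_bracket r s U" and ?n = "module_bracket p q V"
  interpret c: clifford_form "idx r s" sgn_idx ?U J b using repU by (simp add: represents_def)
  interpret c': clifford_form "idx p q" sgn_idx ?V J' b' using repV by (simp add: represents_def)
  obtain f where f: "linear_on (?U \<times> ?Z) (?V \<times> ?Y) f" "bij_betw f (?U \<times> ?Z) (?V \<times> ?Y)"
    and hom_all: "\<forall>v\<in>?U \<times> ?Z. \<forall>w\<in>?U \<times> ?Z. f (lie_bracket (pseudo_H_algebra r s U) v w)
        = lie_bracket (pseudo_H_algebra p q V) (f v) (f w)"
    using iso unfolding lie_isomorphic_def pseudo_H_algebra_simps(1) by (elim exE conjE)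
  have hom: "f (0, ?m x y) = lie_bracket (pseudo_H_algebra p q V) (f (x, z)) (f (y, w))"
    if "x \<in> ?U" "z \<in> ?Z" "y \<in> ?U" "w \<in> ?Z" for x z y w
    using bspec[OF bspec[OF hom_all, of "(x, z)"], of "(y, w)"] that
    by (simp add: pseudo_H_algebra_simps(2))
  have fV: "f v \<in> ?V \<times> ?Y" if "v \<in> ?U \<times> ?Z" for v using f(1) that unfolding linear_on_def by blast
  have fadd: "f (v + w) = f v + f w" if "v \<in> ?U \<times> ?Z" "w \<in> ?U \<times> ?Z" for v w
    using f(1) that unfolding linear_on_def by blast
  have fscale: "f (k *\<^sub>R v) = k *\<^sub>R f v" if "v \<in> ?U \<times> ?Z" for v k
    using f(1) that unfolding linear_on_def by blast
  have fst_f: "fst (f v) \<in> ?V" and snd_f: "snd (f v) \<in> ?Y" if "v \<in> ?U \<times> ?Z" for v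
    using fV[OF that] by (auto simp: mem_Times_iff)
  have finj: "v = w" if "f v = f w" "v \<in> ?U \<times> ?Z" "w \<in> ?U \<times> ?Z" for v w
    using f(2) that by (auto simp: bij_betw_def inj_on_def)
  have subZ: "subspace ?Z" "subspace ?Y" by (rule subspace_pseudo_space)+
  have zU: "0 \<in> ?U" and zZ: "0 \<in> ?Z" and zV: "0 \<in> ?V" and zY: "0 \<in> ?Y"
    using c.subV c'.subV subZ by (auto simp: subspace_0)
  have f0: "f 0 = 0" using fscale[of 0 0] zU zZ by (simp add: zero_prod_def)
  have brk: "lie_bracket (pseudo_H_algebra p q V) v w = (0, ?n (fst v) (fst w))" for v w
    using pseudo_H_algebra_simps(2)[of p q V "fst v" "snd v" "fst w" "snd w"] by simp
  have hom': "f (0, ?m x y) = (0, ?n (fst (f (x, z))) (fst (f (y, w))))"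
    if "x \<in> ?U" "z \<in> ?Z" "y \<in> ?U" "w \<in> ?Z" for x y z w
    using hom[OF that] by (simp add: brk)
  have center: "fst (f (0, z)) = 0" if z: "z \<in> ?Z" for z
  proof (rule module_bracket_central[OF repV rs(2)])
    show "fst (f (0, z)) \<in> ?V" using fst_f zU z by simp
    fix y assume y: "y \<in> ?V"
    have "(y, 0) \<in> f ` (?U \<times> ?Z)" using f(2) y zY by (simp add: bij_betw_def)
    then obtain u w where uw: "u \<in> ?U" "w \<in> ?Z" "f (u, w) = (y, 0)" by auto
    have "f (0, ?m 0 u) = (0, ?n (fst (f (0, z))) (fst (f (u, w))))" by (rule hom'[OF zU z uw(1,2)])
    then show "?n (fst (f (0, z))) y = 0"
      using uw f0 by (simp add: module_bracket_0[OF repU uw(1)] zero_prod_def)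
  qed
  obtain pU :: "'a \<Rightarrow> 'a" where pU: "linear pU" "\<And>x. pU x \<in> ?U" "\<And>x. x \<in> ?U \<Longrightarrow> pU x = x"
    using subspace_projection[OF c.subV] by metis
  obtain pZ :: "(nat \<Rightarrow>\<^sub>0 real) \<Rightarrow> (nat \<Rightarrow>\<^sub>0 real)" where pZ: "linear pZ" "\<And>x. pZ x \<in> ?Z" "\<And>x. x \<in> ?Z \<Longrightarrow> pZ x = x"
    using subspace_projection[OF subZ(1)] by metis
  define A where "A x = fst (f (pU x, 0))" for x
  define C where "C z = snd (f (0, pZ z))" for z
  have "linear A"
  proof (rule linearI)
    fix x y k
    have "(pU (x + y), 0) = (pU x, 0) + (pU y, 0 :: nat \<Rightarrow>\<^sub>0 real)" "(pU (k *\<^sub>R x), 0) = k *\<^sub>R (pU x, 0 :: nat \<Rightarrow>\<^sub>0 real)"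
      by (simp_all add: linear_add[OF pU(1)] linear_scale[OF pU(1)])
    then show "A (x + y) = A x + A y" "A (k *\<^sub>R x) = k *\<^sub>R A x"
      unfolding A_def using fadd[of "(pU x, 0)" "(pU y, 0)"] fscale[of "(pU x, 0)" k] pU(2) zZ by auto
  qed
  moreover have "linear C"
  proof (rule linearI)
    fix x y k
    have "(0, pZ (x + y)) = (0, pZ x) + (0 :: 'a, pZ y)" "(0, pZ (k *\<^sub>R x)) = k *\<^sub>R (0 :: 'a, pZ x)"
      by (simp_all add: linear_add[OF pZ(1)] linear_scale[OF pZ(1)])
    then show "C (x + y) = C x + C y" "C (k *\<^sub>R x) = k *\<^sub>R C x"
      unfolding C_def using fadd[of "(0, pZ x)" "(0, pZ y)"] fscale[of "(0, pZ x)" k] pZ(2) zU by auto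
  qed
  moreover have "C ` ?Z \<subseteq> ?Y" unfolding C_def using snd_f pZ(2) zU by auto
  moreover have "bij_betw A ?U ?V"
    unfolding bij_betw_def
  proof
    show "inj_on A ?U"
      unfolding linear_inj_on_iff[OF \<open>linear A\<close> c.subV]
    proof (intro ballI impI)
      fix x assume x: "x \<in> ?U" "A x = 0"
      show "x = 0"
      proof (rule module_bracket_central[OF repU rs(1) x(1)])
        fix y assume y: "y \<in> ?U"
        have "f (0, ?m x y) = (0, ?n (A x) (fst (f (y, 0))))"
          using hom'[OF x(1) zZ y zZ] pU(3)[OF x(1)] by (simp add: A_def)
        then have "f (0, ?m x y) = f 0"
          using x(2) f0 module_bracket_0(1)[OF repV fst_f] y zZ by (simp add: zero_prod_def)
        then have "(0, ?m x y) = (0 :: 'a \<times> (nat \<Rightarrow>\<^sub>0 real))"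
          by (rule finj) (use zU zZ module_bracket_pseudo_space[OF repU x(1) y] in \<open>auto simp: zero_prod_def\<close>)
        then show "?m x y = 0" by (simp add: zero_prod_def)
      qed
    qed
    show "A ` ?U = ?V"
    proof
      show "A ` ?U \<subseteq> ?V" unfolding A_def using fst_f pU(2) zZ by auto
      show "?V \<subseteq> A ` ?U"
      proof
        fix y assume "y \<in> ?V"
        then have "(y, 0) \<in> f ` (?U \<times> ?Z)" using f(2) zY by (simp add: bij_betw_def)
        then obtain u w where uw: "u \<in> ?U" "w \<in> ?Z" "f (u, w) = (y, 0)" by auto
        have "f (u, w) = f (u, 0) + f (0, w)" using fadd[of "(u, 0)" "(0, w)"] uw zU zZ by simp
        then have "y = A u" using uw center[OF uw(2)] pU(3) by (simp add: A_def prod_eq_iff)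
        then show "y \<in> A ` ?U" using uw(1) by blast
      qed
    qed
  qed
  moreover have "C (?m x y) = ?n (A x) (A y)" if "x \<in> ?U" "y \<in> ?U" for x y
    using hom'[OF that(1) zZ that(2) zZ] pU(3) pZ(3) module_bracket_pseudo_space[OF repU that] that
    by (simp add: A_def C_def)
  ultimately show ?thesis using that by blast
qed

section \<open>Similarities between the two scalar products\<close>

lemma pseudo_space_commute: "pseudo_space r s = pseudo_space s r"
  by (simp add: pseudo_space_def add.commute)

lemma unit_vec_eq_iff [simp]: "unit_vec m = unit_vec n \<longleftrightarrow> m = n"
  using coord_unit_vec[of m n] coord_unit_vec[of n n] by (auto split: if_splits)

text \<open>One half of Sylvester's law. The map \<open>c\<close> followed by the projection
  \<open>t\<close> to the positive coordinates is injective on the positive subspace of dimension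
  \<open>p\<close>: for \<open>z\<close> in the kernel, \<open>c z\<close> has nonpositive square,
  while that of \<open>z\<close> is positive unless \<open>z = 0\<close>.\<close>

lemma pseudo_form_inertia:
  assumes c: "linear c" and "0 < l"
    and sim: "\<And>z. z \<in> pseudo_space p q \<Longrightarrow> pseudo_form r s (c z) (c z) = l * pseudo_form p q z z"
  shows "p \<le> r"
proof -
  define t where "t z = (\<Sum>i<r. coord z i *\<^sub>R unit_vec i)" for z
  have coord_t: "coord (t z) n = (if n < r then coord z n else 0)" for z n
    by (simp add: t_def coord_sum coord_unit_vec if_distrib cong: if_cong)
  have lt: "linear t" unfolding t_def
    by (intro linearI) (simp_all add: scaleR_add_left sum.distrib scaleR_sum_right)
  have form: "pseudo_form m n z z = (\<Sum>i<m. coord z i * coord z i) - (\<Sum>j<n. coord z (m + j) * coord z (m + j))" for m n z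
    by (simp add: pseudo_form_def coord_def)
  have lin: "linear (t \<circ> c)" using c lt by (rule linear_compose)
  have "inj_on (t \<circ> c) (pseudo_space p 0)"
    unfolding linear_inj_on_iff[OF lin subspace_pseudo_space]
  proof (intro ballI impI)
    fix z assume z: "z \<in> pseudo_space p 0" and tz: "(t \<circ> c) z = 0"
    have "z \<in> pseudo_space p q" using z by (simp add: pseudo_space_iff)
    have "coord (c z) i = 0" if "i < r" for i
      using coord_t[of "c z" i] tz that by simp
    then have "pseudo_form r s (c z) (c z) \<le> 0" by (simp add: form sum_nonneg)
    then have "l * (\<Sum>i<p. coord z i * coord z i) \<le> 0"
      using sim[OF \<open>z \<in> pseudo_space p q\<close>] z by (simp add: form pseudo_space_iff)
    then have "(\<Sum>i<p. coord z i * coord z i) \<le> 0" using \<open>0 < l\<close> by (simp add: mult_le_0_iff)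
    then have "(\<Sum>i<p. coord z i * coord z i) = 0" by (intro antisym sum_nonneg) auto
    then have "coord z i = 0" if "i < p" for i using that by (subst (asm) sum_nonneg_eq_0_iff) auto
    then show "z = 0" using pseudo_space_eqI[OF z subspace_0[OF subspace_pseudo_space]] pos_idx_less[of _ p 0] by simp
  qed
  then have "dim ((t \<circ> c) ` pseudo_space p 0) = dim (pseudo_space p 0)"
    using dim_linear_image(1)[OF finite_dim_pseudo_space lin] by simp
  moreover have "(t \<circ> c) ` pseudo_space p 0 \<subseteq> pseudo_space r 0"
    by (auto simp: pseudo_space_iff coord_t)
  ultimately have "dim (pseudo_space p 0) \<le> dim (pseudo_space r 0)"
    using finite_dim_subspace_dim_mono[OF finite_dim_pseudo_space linear_subspace_image[OF lin subspace_pseudo_space]] by metis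
  moreover have "dim (pseudo_space n 0) = n" for n
  proof -
    have inj: "inj_on unit_vec {..<n}" by (simp add: inj_on_def)
    have ind: "independent (unit_vec ` {..<n})"
      unfolding independent_explicit_finite_subsets
    proof (intro allI impI ballI)
      fix A u v assume A: "A \<subseteq> unit_vec ` {..<n}" "finite A" and sum: "(\<Sum>v\<in>A. u v *\<^sub>R v) = 0" and v: "v \<in> A"
      obtain m where m: "m < n" "v = unit_vec m" using A v by auto
      have "(\<Sum>w\<in>A. u w * coord w m) = (\<Sum>w\<in>A. if w = v then u w else 0)"
      proof (intro sum.cong refl)
        fix w assume "w \<in> A"
        then obtain k where "w = unit_vec k" using A by auto
        then show "u w * coord w m = (if w = v then u w else 0)"
          using m by (auto simp: coord_unit_vec)
      qed
      moreover have "(\<Sum>w\<in>A. u w * coord w m) = coord (\<Sum>v\<in>A. u v *\<^sub>R v) m" by (simp add: coord_sum)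
      ultimately show "u v = 0" using A(2) v sum by simp
    qed
    have "span (unit_vec ` {..<n}) = pseudo_space n 0" using span_unit_vec[of n 0] by simp
    then show ?thesis using dim_span_eq_card_independent[OF ind] card_image[OF inj] by simp
  qed
  ultimately show ?thesis by simp
qed

text \<open>
  Applied to \<open>K = K\<^sub>w\<close> and \<open>L = K\<^sub>z\<close>. Two Clifford structures with the same quotient
  \<open>Y = K\<^sub>w\<^sup>-\<^sup>1 K\<^sub>z\<close>, not a scalar, therefore agree on the quotients of norms.
\<close>

lemma clifford_quotient_quadratic:
  fixes K L Y :: "'a::real_vector \<Rightarrow> 'a"
  assumes K: "linear K" and x: "x \<in> V"
    and KV: "\<And>x. x \<in> V \<Longrightarrow> K x \<in> V" and LV: "\<And>x. x \<in> V \<Longrightarrow> L x \<in> V" and YV: "\<And>x. x \<in> V \<Longrightarrow> Y x \<in> V"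
    and KK: "\<And>x. x \<in> V \<Longrightarrow> K (K x) = - k *\<^sub>R x" and LL: "\<And>x. x \<in> V \<Longrightarrow> L (L x) = - l *\<^sub>R x"
    and KL: "\<And>x. x \<in> V \<Longrightarrow> K (L x) + L (K x) = - (2 * m) *\<^sub>R x"
    and KY: "\<And>x. x \<in> V \<Longrightarrow> K (Y x) = L x" and k: "k \<noteq> 0"
  shows "Y (Y x) = (2 * m / k) *\<^sub>R Y x - (l / k) *\<^sub>R x"
proof -
  have Y: "k *\<^sub>R Y x = - K (L x)" if "x \<in> V" for x
    using KK[OF YV[OF that]] KY[OF that] by simp
  have "k *\<^sub>R Y (Y x) = - K (L (Y x))" by (rule Y[OF YV[OF x]])
  also have "\<dots> = (2 * m) *\<^sub>R Y x + L (K (Y x))"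
    using KL[OF YV[OF x]] by (simp add: eq_diff_eq[symmetric])
  also have "L (K (Y x)) = - l *\<^sub>R x" using KY[OF x] LL[OF x] by simp
  finally have "(1 / k) *\<^sub>R (k *\<^sub>R Y (Y x)) = (1 / k) *\<^sub>R ((2 * m) *\<^sub>R Y x + - l *\<^sub>R x)" by simp
  then show ?thesis using k by (simp add: scaleR_add_right scaleR_diff_right)
qed

text \<open>The unknown \<open>G\<close> drops out of quotients: if \<open>Y\<close> solves
  \<open>?K w (Y x) = ?K z x\<close>, then \<open>GK\<close> gives
  \<open>?D (c w) (Y x) = ?D (c z) x\<close>. One operator thus satisfies two quadratic equations,
  whose constant terms are the quotients of norms to be compared.\<close>

lemma clifford_similarity:
  fixes V :: "'a::real_vector set"
  assumes D: "clifford_rep r s V J b" and E: "clifford_rep p q V K b'"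
    and Z: "pseudo_space r s = pseudo_space p q" "p + q > 0" and V: "V \<noteq> {0}"
    and G: "linear G" "\<And>x. x \<in> V \<Longrightarrow> G x = 0 \<Longrightarrow> x = 0"
    and c: "\<And>z. z \<in> pseudo_space r s \<Longrightarrow> c z \<in> pseudo_space r s"
    and GK: "\<And>z x. z \<in> pseudo_space r s \<Longrightarrow> x \<in> V \<Longrightarrow> G (clifford_act p q K z x) = clifford_act r s J (c z) x"
  obtains l where "l \<noteq> 0"
    "\<And>z. z \<in> pseudo_space r s \<Longrightarrow> pseudo_form r s (c z) (c z) = l * pseudo_form p q z z"
proof -
  interpret D: clifford_signature r s V J b using D by (simp add: clifford_signature_iff)
  interpret E: clifford_signature p q V K b' using E by (simp add: clifford_signature_iff)
  let ?D = "clifford_act r s J" and ?K = "clifford_act p q K"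
  let ?Q = "pseudo_form r s" and ?R = "pseudo_form p q"
  obtain x0 where x0: "x0 \<in> V" "x0 \<noteq> 0" using V subspace_0[OF D.subV] by auto
  have "0 \<in> pos_idx p ` idx p q" using Z(2) by (simp add: pos_idx_image)
  then obtain i where i: "i \<in> idx p q" by auto
  define w where "w = unit_vec (pos_idx p i)"
  have wZ: "w \<in> pseudo_space r s" using i Z(1) by (simp add: w_def unit_vec_pseudo_space pos_idx_less)
  have Rw: "?R w w \<noteq> 0" using pseudo_form_unit_vec[OF i] sgn_idx_cases[of i]
    by (auto simp: w_def coord_unit_vec)
  have Kinj: "x = 0" if "x \<in> V" "?K w x = 0" for x
    using E.act_sq[OF that(1), of w] that(2) Rw linear_0[OF E.act_linear] by simp
  \<comment> \<open>If \<open>c w\<close> were isotropic, \<open>?D (c w)\<close> would have square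
    zero; but on \<open>V\<close> it is the composite of the injective maps \<open>?K w\<close> and
    \<open>G\<close>.\<close>
  have Qw: "?Q (c w) (c w) \<noteq> 0"
  proof
    assume "?Q (c w) (c w) = 0"
    then have "?D (c w) (?D (c w) x0) = 0" using D.act_sq[OF x0(1), of "c w"] by simp
    then have "?D (c w) x0 = 0"
      using GK[OF wZ D.act_V[OF x0(1)], of "c w"] G(2)[OF E.act_V] Kinj D.act_V x0(1) by metis
    then show False using GK[OF wZ x0(1)] G(2)[OF E.act_V] Kinj x0 by metis
  qed
  have main: "?Q (c z) (c z) / ?Q (c w) (c w) = ?R z z / ?R w w" if z: "z \<in> pseudo_space r s" for z
  proof (rule ccontr)
    assume neq: "?Q (c z) (c z) / ?Q (c w) (c w) \<noteq> ?R z z / ?R w w"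
    define Y where "Y x = (- 1 / ?R w w) *\<^sub>R ?K w (?K z x)" for x
    have YV: "Y x \<in> V" if "x \<in> V" for x
      using that E.act_V D.subV by (simp add: Y_def subspace_scale subspace_neg)
    have KY: "?K w (Y x) = ?K z x" if "x \<in> V" for x
      using E.act_sq[OF E.act_V[OF that], of w z] Rw
      by (simp add: Y_def linear_scale[OF E.act_linear] linear_neg[OF E.act_linear])
    have DY: "?D (c w) (Y x) = ?D (c z) x" if "x \<in> V" for x
      using GK[OF wZ YV[OF that]] KY[OF that] GK[OF z that] by simp
    let ?m = "?Q (c w) (c z) / ?Q (c w) (c w)" and ?n = "?R w z / ?R w w"
    let ?g = "?Q (c z) (c z) / ?Q (c w) (c w)" and ?h = "?R z z / ?R w w"
    have q1: "Y (Y x) = (2 * ?m) *\<^sub>R Y x - ?g *\<^sub>R x" if "x \<in> V" for x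
      using clifford_quotient_quadratic[OF D.act_linear that D.act_V D.act_V YV D.act_sq D.act_sq
          D.act_anticommutator DY Qw] by simp
    have q2: "Y (Y x) = (2 * ?n) *\<^sub>R Y x - ?h *\<^sub>R x" if "x \<in> V" for x
      using clifford_quotient_quadratic[OF E.act_linear that E.act_V E.act_V YV E.act_sq E.act_sq
          E.act_anticommutator KY Rw] by simp
    have eq: "(2 * (?m - ?n)) *\<^sub>R Y x = (?g - ?h) *\<^sub>R x" if "x \<in> V" for x
      using q1[OF that] q2[OF that] by (simp add: algebra_simps scaleR_diff_left)
    \<comment> \<open>Equal linear coefficients would force equal constant terms. Hence
      \<open>Y\<close> is a scalar \<open>t\<close>, and in this remaining case both quotients of
      norms equal \<open>t * t\<close>.\<close>
    have mn: "?m \<noteq> ?n"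
    proof
      assume "?m = ?n"
      then have "2 * (?m - ?n) = 0" by simp
      then have "(?g - ?h) *\<^sub>R x0 = 0" using eq[OF x0(1)] by (simp only: scaleR_zero_left)
      then show False using x0(2) neq by simp
    qed
    define t where "t = (?g - ?h) / (2 * (?m - ?n))"
    have Yx: "Y x = t *\<^sub>R x" if "x \<in> V" for x
    proof -
      have "(1 / (2 * (?m - ?n))) *\<^sub>R ((2 * (?m - ?n)) *\<^sub>R Y x) = (1 / (2 * (?m - ?n))) *\<^sub>R ((?g - ?h) *\<^sub>R x)"
        using eq[OF that] by simp
      then show ?thesis using mn by (simp add: t_def)
    qed
    have "?K z (?K z x0) = (t * t) *\<^sub>R ?K w (?K w x0)"
      using KY[OF E.act_V[OF x0(1)]] KY[OF x0(1)] Yx E.act_V[OF x0(1)] x0(1)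
      by (metis linear_scale[OF E.act_linear] scaleR_scaleR)
    then have "?R z z = t * t * ?R w w" using E.act_sq[OF x0(1)] x0(2) by simp
    moreover have "?D (c z) (?D (c z) x0) = (t * t) *\<^sub>R ?D (c w) (?D (c w) x0)"
      using DY[OF D.act_V[OF x0(1)]] DY[OF x0(1)] Yx D.act_V[OF x0(1)] x0(1)
      by (metis linear_scale[OF D.act_linear] scaleR_scaleR)
    then have "?Q (c z) (c z) = t * t * ?Q (c w) (c w)" using D.act_sq[OF x0(1)] x0(2) by simp
    ultimately show False using neq Qw Rw by simp
  qed
  show ?thesis
  proof (rule that[of "?Q (c w) (c w) / ?R w w"])
    show "?Q (c w) (c w) / ?R w w \<noteq> 0" using Qw Rw by simp
    show "?Q (c z) (c z) = ?Q (c w) (c w) / ?R w w * ?R z z" if "z \<in> pseudo_space r s" for z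
      using main[OF that] Qw Rw by (simp add: field_simps)
  qed
qed

text \<open>Let \<open>c\<close> be adjoint to \<open>C\<close>, let \<open>G\<close> represent the
  pulled-back form of \<open>V\<close> with respect to \<open>b\<close>, and let \<open>K\<close> be
  the action of \<open>V\<close> transported to the space of \<open>U\<close>. Compatibility with
  the brackets then reads \<open>GK\<close>, and symmetry of the pulled-back form makes
  \<open>G\<close> self-adjoint.\<close>

lemma lie_isomorphic_flip_operator:
  fixes U :: "'a::real_vector form_module" and V :: "'b::real_vector form_module"
  assumes repU: "represents r s U J b" and repV: "represents s r V J' b'"
    and neU: "mspace U \<noteq> {0}" and rs: "r \<noteq> s"
    and iso: "lie_isomorphic (pseudo_H_algebra r s U) (pseudo_H_algebra s r V)"
  shows "\<exists>G H. flip_operator (mspace U) (J ` idx r s) {} b G H"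
proof -
  have rs0: "r + s > 0" "s + r > 0" using rs by auto
  have crU: "clifford_rep r s (mspace U) J b" and crV: "clifford_rep s r (mspace V) J' b'"
    using repU repV by (auto simp: represents_def)
  interpret U: clifford_signature r s "mspace U" J b using crU by (simp add: clifford_signature_iff)
  interpret V: clifford_signature s r "mspace V" J' b' using crV by (simp add: clifford_signature_iff)
  let ?U = "mspace U" and ?V = "mspace V" and ?Z = "pseudo_space r s"
  obtain A C where A: "linear A" "bij_betw A ?U ?V" and C: "linear C" "C ` ?Z \<subseteq> pseudo_space s r"
    and CA: "\<And>x y. x \<in> ?U \<Longrightarrow> y \<in> ?U \<Longrightarrow> C (module_bracket r s U x y) = module_bracket s r V (A x) (A y)"
    using lie_isomorphism_components[OF repU repV rs0 iso] by metis
  obtain A' where A': "linear A'" "bij_betw A' ?V ?U" "\<And>x. x \<in> ?U \<Longrightarrow> A' (A x) = x" "\<And>y. y \<in> ?V \<Longrightarrow> A (A' y) = y"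
    using linear_bij_betw_inverse[OF U.subV A] by metis
  have AV: "A x \<in> ?V" if "x \<in> ?U" for x using A(2) that by (auto simp: bij_betw_def)
  have A'V: "A' x \<in> ?U" if "x \<in> ?V" for x using A'(2) that by (auto simp: bij_betw_def)
  obtain c where c: "linear c" "c ` ?Z \<subseteq> ?Z"
    "\<And>z w. z \<in> ?Z \<Longrightarrow> w \<in> ?Z \<Longrightarrow> pseudo_form r s (c z) w = pseudo_form s r z (C w)"
  proof (rule bilinear_representation[OF finite_dim_pseudo_space bilinear_pseudo_form
        bilinear_compose[OF bilinear_pseudo_form linear_ident C(1)]])
    show "x = 0" if "x \<in> ?Z" "\<And>y. y \<in> ?Z \<Longrightarrow> pseudo_form r s x y = 0" for x
      using pseudo_form_nondegenerate that by blast
  qed blast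
  have cZ: "c z \<in> ?Z" if "z \<in> ?Z" for z using c(2) that by auto
  obtain G where G: "linear G" "G ` ?U \<subseteq> ?U" "\<And>x y. x \<in> ?U \<Longrightarrow> y \<in> ?U \<Longrightarrow> b (G x) y = b' (A x) (A y)"
    using bilinear_representation[OF U.fdV U.bil bilinear_compose[OF V.bil A(1,1)] U.nondeg] by metis
  have Ginj: "x = 0" if x: "x \<in> ?U" "G x = 0" for x
  proof -
    have "A x = 0"
    proof (rule V.nondeg[OF AV[OF x(1)]])
      fix y assume y: "y \<in> ?V"
      have "b (G x) (A' y) = b' (A x) y" using G(3)[OF x(1) A'V[OF y]] A'(4)[OF y] by simp
      then show "b' (A x) y = 0" using x(2) by (simp add: bilinear_lzero[OF U.bil])
    qed
    then show ?thesis using A'(3)[OF x(1)] linear_0[OF A'(1)] by simp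
  qed
  obtain H where H: "linear H" "H ` ?U \<subseteq> ?U" "\<And>x. x \<in> ?U \<Longrightarrow> H (G x) = x" "\<And>x. x \<in> ?U \<Longrightarrow> G (H x) = x"
    using linear_inj_endo_inverse[OF U.fdV G(1,2) Ginj] by metis
  have GU: "G x \<in> ?U" "H x \<in> ?U" if "x \<in> ?U" for x using G(2) H(2) that by auto
  define K where "K i x = A' (J' i (A x))" for i x
  have crK: "clifford_rep s r ?U K (\<lambda>x y. b' (A x) (A y))"
    unfolding K_def[abs_def] using clifford_form_transport[OF crV A'(1,2) A(1) A'(4)] .
  interpret K: clifford_signature s r ?U K "\<lambda>x y. b' (A x) (A y)" using crK by (simp add: clifford_signature_iff)
  have actK: "clifford_act s r K z x = A' (clifford_act s r J' z (A x))" for z x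
    by (simp add: clifford_act_def K_def linear_sum[OF A'(1)] linear_scale[OF A'(1)])
  have GK: "G (clifford_act s r K z x) = clifford_act r s J (c z) x" if z: "z \<in> ?Z" and x: "x \<in> ?U" for z x
  proof -
    let ?u = "clifford_act s r K z x" and ?v = "clifford_act r s J (c z) x"
    have uU: "?u \<in> ?U" "?v \<in> ?U" using K.act_V[OF x] U.act_V[OF x] by auto
    have "G ?u - ?v = 0"
    proof (rule U.nondeg)
      show "G ?u - ?v \<in> ?U" using uU GU U.subV by (simp add: subspace_diff)
      fix y assume y: "y \<in> ?U"
      have "b (G ?u) y = b' (clifford_act s r J' z (A x)) (A y)"
        using G(3)[OF uU(1) y] A'(4)[OF V.act_V[OF AV[OF x]]] by (simp add: actK)
      also have "\<dots> = pseudo_form s r z (C (module_bracket r s U x y))"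
        using module_bracket_eq(2)[OF repV AV[OF x] AV[OF y]] z CA[OF x y]
        by (simp add: pseudo_space_commute[of s r])
      also have "\<dots> = pseudo_form r s (c z) (module_bracket r s U x y)"
        using c(3)[OF z module_bracket_pseudo_space[OF repU x y]] by simp
      also have "\<dots> = b ?v y" using module_bracket_eq(2)[OF repU x y cZ[OF z]] by simp
      finally show "b (G ?u - ?v) y = 0" by (simp add: bilinear_lsub[OF U.bil])
    qed
    then show ?thesis by simp
  qed
  obtain l where l: "l \<noteq> 0" and sim: "\<And>z. z \<in> ?Z \<Longrightarrow> pseudo_form r s (c z) (c z) = l * pseudo_form s r z z"
    using clifford_similarity[OF crU crK pseudo_space_commute rs0(2) neU G(1) Ginj cZ GK] by metis
  have cinj: "z = 0" if z: "z \<in> ?Z" "c z = 0" for z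
  proof (rule pseudo_form_nondegenerate[of z s r])
    show "z \<in> pseudo_space s r" using z(1) by (simp add: pseudo_space_commute)
    fix w assume "w \<in> pseudo_space s r"
    then have w: "w \<in> ?Z" by (simp add: pseudo_space_commute)
    have "z + w \<in> ?Z" using z(1) w subspace_pseudo_space by (simp add: subspace_add)
    from sim[OF this] have "pseudo_form r s (c w) (c w) = l * pseudo_form s r (z + w) (z + w)"
      using z(2) by (simp add: linear_add[OF c(1)])
    moreover have "pseudo_form s r z z = 0"
      using sim[OF z(1)] z(2) l by (simp add: bilinear_lzero[OF bilinear_pseudo_form])
    moreover have "pseudo_form s r (z + w) (z + w) = pseudo_form s r z z + 2 * pseudo_form s r z w + pseudo_form s r w w"
      using pseudo_form_sym[of s r z w]
      by (simp add: bilinear_ladd[OF bilinear_pseudo_form] bilinear_radd[OF bilinear_pseudo_form])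
    ultimately show "pseudo_form s r z w = 0" using sim[OF w] l by (simp add: distrib_left)
  qed
  obtain d where d: "linear d" "d ` ?Z \<subseteq> ?Z" "\<And>z. z \<in> ?Z \<Longrightarrow> d (c z) = z" "\<And>z. z \<in> ?Z \<Longrightarrow> c (d z) = z"
    using linear_inj_endo_inverse[OF finite_dim_pseudo_space c(1,2) cinj] by metis
  \<comment> \<open>For positive \<open>l\<close> both \<open>c\<close> and its inverse would be
    similarities with positive factor, and inertia in both directions would give
    \<open>r = s\<close>.\<close>
  have "l < 0"
  proof (rule ccontr)
    assume "\<not> l < 0"
    then have pos: "0 < l" "0 < 1 / l" using l by auto
    have "s \<le> r" using pseudo_form_inertia[OF c(1) pos(1), of s r r s] sim by (simp add: pseudo_space_commute)
    moreover have "pseudo_form s r (d z) (d z) = 1 / l * pseudo_form r s z z" if "z \<in> ?Z" for z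
      using sim[of "d z"] d(2,4) that l by auto
    then have "r \<le> s" using pseudo_form_inertia[OF d(1) pos(2), of r s s r] by simp
    ultimately show False using rs by simp
  qed
  \<comment> \<open>With \<open>c z\<close> the basis vector of \<open>i\<close>, the transported
    action of \<open>z\<close> is \<open>J i\<close> followed by \<open>H\<close>, and its square is
    the scalar \<open>- sgn_idx i / l\<close>. Evaluating this at the preimage of \<open>G x\<close>
    under \<open>J i\<close> gives the claim.\<close>
  have GJG: "G (J i (G x)) = l *\<^sub>R J i x" if i: "i \<in> idx r s" and x: "x \<in> ?U" for i x
  proof -
    define z where "z = d (unit_vec (pos_idx r i))"
    have uZ: "unit_vec (pos_idx r i) \<in> ?Z" using i by (simp add: unit_vec_pseudo_space pos_idx_less)
    have zZ: "z \<in> ?Z" and cz: "c z = unit_vec (pos_idx r i)" using uZ d by (auto simp: z_def)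
    have JK: "J i y = G (clifford_act s r K z y)" if "y \<in> ?U" for y
      using GK[OF zZ that] clifford_act_unit_vec[OF i, of J y] by (simp add: cz)
    have KH: "clifford_act s r K z y = H (J i y)" if "y \<in> ?U" for y
      using JK[OF that] H(3) K.act_V[OF that] by simp
    have "sgn_idx i = l * pseudo_form s r z z"
      using sim[OF zZ] pseudo_form_unit_vec[OF i, of "unit_vec (pos_idx r i)"] by (simp add: cz coord_unit_vec)
    then have q: "- pseudo_form s r z z = - sgn_idx i / l" using l by simp
    define y where "y = - sgn_idx i *\<^sub>R J i (G x)"
    have yU: "y \<in> ?U" using U.JV[OF i GU(1)[OF x]] U.subV by (simp add: y_def subspace_scale subspace_neg)
    have Jy: "J i y = G x"
      using U.sqJ[OF i GU(1)[OF x]] by (simp add: y_def linear_scale[OF U.linJ[OF i]] linear_neg[OF U.linJ[OF i]])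
    have "H (J i (H (J i y))) = (- sgn_idx i / l) *\<^sub>R y"
      using K.act_sq[OF yU, of z] KH yU GU(2) U.JV[OF i] q by simp
    then have "H (J i x) = (- sgn_idx i / l) *\<^sub>R y" using Jy H(3)[OF x] by simp
    then have "G (H (J i x)) = (1 / l) *\<^sub>R G (J i (G x))"
      by (simp add: y_def linear_scale[OF G(1)] linear_neg[OF G(1)])
    then show ?thesis using H(4) U.JV[OF i x] l by simp
  qed
  \<comment> \<open>Scaling \<open>G\<close> by \<open>k\<close> multiplies the left side of
    \<open>GJG\<close> by \<open>k * k\<close>, so the factor \<open>l\<close> becomes -1.\<close>
  define k where "k = 1 / sqrt (- l)"
  have k: "k \<noteq> 0" "k * k * l = - 1" using \<open>l < 0\<close> by (auto simp: k_def field_simps)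
  have "flip_operator ?U (J ` idx r s) {} b (\<lambda>x. k *\<^sub>R G x) (\<lambda>x. (1 / k) *\<^sub>R H x)"
    unfolding flip_operator_def
  proof (intro conjI ballI)
    show "linear (\<lambda>x. k *\<^sub>R G x)" "linear (\<lambda>x. (1 / k) *\<^sub>R H x)"
      using G(1) H(1) by (auto intro: linear_compose_scale_right)
    show "(\<lambda>x. k *\<^sub>R G x) ` ?U \<subseteq> ?U" "(\<lambda>x. (1 / k) *\<^sub>R H x) ` ?U \<subseteq> ?U"
      using GU U.subV by (auto simp: subspace_scale)
    fix x assume x: "x \<in> ?U"
    show "k *\<^sub>R G ((1 / k) *\<^sub>R H x) = x" "(1 / k) *\<^sub>R H (k *\<^sub>R G x) = x"
      using x k H(3,4) by (simp_all add: linear_scale[OF G(1)] linear_scale[OF H(1)])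
    fix y assume y: "y \<in> ?U"
    have "b (G x) y = b x (G y)"
      using G(3)[OF x y] G(3)[OF y x] V.sym[OF AV[OF x] AV[OF y]] U.sym[OF x GU(1)[OF y]] by simp
    then show "b (k *\<^sub>R G x) y = b x (k *\<^sub>R G y)" by (simp add: bilinear_lmul[OF U.bil] bilinear_rmul[OF U.bil])
  next
    fix f x assume "f \<in> J ` idx r s" and x: "x \<in> ?U"
    then obtain i where i: "i \<in> idx r s" "f = J i" by auto
    have "k *\<^sub>R G (f (k *\<^sub>R G x)) = (k * k * l) *\<^sub>R f x"
      using GJG[OF i(1) x] i by (simp add: linear_scale[OF U.linJ] linear_scale[OF G(1)])
    then show "k *\<^sub>R G (f (k *\<^sub>R G x)) = - f x" by (simp add: k(2))
  qed auto
  then show ?thesis by blast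
qed

section \<open>From a flip operator back to a Lie algebra isomorphism\<close>

definition swap_idx :: "nat + nat \<Rightarrow> nat + nat" where "swap_idx = case_sum Inr Inl"

lemma swap_idx_idx: "i \<in> idx s r \<Longrightarrow> swap_idx i \<in> idx r s"
  by (auto simp: swap_idx_def idx_def)

lemma swap_idx_swap_idx [simp]: "swap_idx (swap_idx i) = i"
  by (cases i) (simp_all add: swap_idx_def)

lemma swap_idx_eq_iff [simp]: "swap_idx i = swap_idx j \<longleftrightarrow> i = j"
  by (metis swap_idx_swap_idx)

lemma sgn_swap_idx [simp]: "sgn_idx (swap_idx i) = - sgn_idx i"
  by (cases i) (simp_all add: swap_idx_def sgn_idx_def)

text \<open>The coordinates of a bracket carry the factor \<open>sgn_idx\<close>, which changes
  under \<open>swap_idx\<close>; this accounts for the minus sign. The sign \<open>k\<close> absorbs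
  the ambiguity in the comparison of the modules.\<close>

definition swap_space :: "real \<Rightarrow> nat \<Rightarrow> nat \<Rightarrow> (nat \<Rightarrow>\<^sub>0 real) \<Rightarrow> (nat \<Rightarrow>\<^sub>0 real)" where
  "swap_space k r s z = (\<Sum>j\<in>idx s r. (- k * coord z (pos_idx r (swap_idx j))) *\<^sub>R unit_vec (pos_idx s j))"

lemma coord_swap_space:
  "j \<in> idx s r \<Longrightarrow> coord (swap_space k r s z) (pos_idx s j) = - k * coord z (pos_idx r (swap_idx j))"
  unfolding swap_space_def by (rule coord_expansion)

lemma swap_space_pseudo_space: "swap_space k r s z \<in> pseudo_space s r"
  unfolding swap_space_def by (rule expansion_pseudo_space)

lemma linear_swap_space: "linear (swap_space k r s)"
  unfolding swap_space_def
  by (intro linearI) (simp_all add: algebra_simps scaleR_add_left sum_subtractf sum_negf sum.distrib scaleR_sum_right)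

lemma swap_space_swap_space:
  assumes "k * k = 1" "z \<in> pseudo_space r s"
  shows "swap_space k s r (swap_space k r s z) = z"
proof (rule pseudo_space_eqI[OF swap_space_pseudo_space assms(2)])
  fix i assume "i \<in> idx r s"
  then show "coord (swap_space k s r (swap_space k r s z)) (pos_idx r i) = coord z (pos_idx r i)"
    using assms(1) by (simp add: coord_swap_space swap_idx_idx flip: mult.assoc)
qed

lemma lie_isomorphic_swap:
  assumes repU: "represents r s U J b" and repV: "represents s r V J' b'" and k: "k * k = 1"
    and A: "linear A" "bij_betw A (mspace U) (mspace V)"
    and JA: "\<And>j x y. j \<in> idx s r \<Longrightarrow> x \<in> mspace U \<Longrightarrow> y \<in> mspace U \<Longrightarrow>
      b' (J' j (A x)) (A y) = k * b (J (swap_idx j) x) y"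
  shows "lie_isomorphic (pseudo_H_algebra r s U) (pseudo_H_algebra s r V)"
proof -
  let ?C = "swap_space k r s"
  define f where "f v = (A (fst v), ?C (snd v))" for v
  have AV: "A x \<in> mspace V" if "x \<in> mspace U" for x using A(2) that by (auto simp: bij_betw_def)
  have hom: "?C (module_bracket r s U x y) = module_bracket s r V (A x) (A y)"
    if x: "x \<in> mspace U" and y: "y \<in> mspace U" for x y
  proof (rule pseudo_space_eqI[OF swap_space_pseudo_space module_bracket_pseudo_space[OF repV AV[OF x] AV[OF y]]])
    fix j assume j: "j \<in> idx s r"
    show "coord (?C (module_bracket r s U x y)) (pos_idx s j) = coord (module_bracket s r V (A x) (A y)) (pos_idx s j)"
      using j JA[OF j x y] coord_expansion[OF swap_idx_idx[OF j]] coord_expansion[OF j]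
      by (simp add: coord_swap_space module_bracket_eq(1)[OF repU x y] module_bracket_eq(1)[OF repV AV[OF x] AV[OF y]])
  qed
  have "linear_on (mspace U \<times> pseudo_space r s) (mspace V \<times> pseudo_space s r) f"
    using AV by (auto simp: linear_on_def f_def linear_add[OF A(1)] linear_scale[OF A(1)]
        linear_add[OF linear_swap_space] linear_scale[OF linear_swap_space] swap_space_pseudo_space)
  moreover have "bij_betw ?C (pseudo_space r s) (pseudo_space s r)"
    by (rule bij_betw_byWitness[where f' = "swap_space k s r"])
      (auto simp: swap_space_swap_space k swap_space_pseudo_space)
  then have "bij_betw f (mspace U \<times> pseudo_space r s) (mspace V \<times> pseudo_space s r)"
    using bij_betw_map_prod[OF A(2)] by (simp add: f_def[abs_def] map_prod_def case_prod_unfold)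
  moreover have "f (lie_bracket (pseudo_H_algebra r s U) v w) = lie_bracket (pseudo_H_algebra s r V) (f v) (f w)"
    if "v \<in> mspace U \<times> pseudo_space r s" "w \<in> mspace U \<times> pseudo_space r s" for v w
    using that by (auto simp: pseudo_H_algebra_simps f_def hom linear_0[OF A(1)])
  ultimately show ?thesis unfolding lie_isomorphic_def pseudo_H_algebra_simps(1) by blast
qed

text \<open>From \<open>H (J i (H x)) = - J i x\<close>, a product of two of the new operators is
  minus the corresponding product of old ones. So the squares change sign and anticommutation
  persists.\<close>

lemma flip_clifford_rep:
  assumes cr: "clifford_rep r s V J b" and fo: "flip_operator V (J ` idx r s) {} b G H"
  shows "clifford_rep s r V (\<lambda>j x. H (J (swap_idx j) x)) (\<lambda>x y. b (G x) y)"
proof -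
  interpret clifford_form "idx r s" sgn_idx V J b by (rule cr)
  have G: "linear G" "linear H" "\<And>x. x \<in> V \<Longrightarrow> G x \<in> V" "\<And>x. x \<in> V \<Longrightarrow> H x \<in> V"
    "\<And>x. x \<in> V \<Longrightarrow> G (H x) = x" "\<And>x. x \<in> V \<Longrightarrow> H (G x) = x"
    "\<And>x y. x \<in> V \<Longrightarrow> y \<in> V \<Longrightarrow> b (G x) y = b x (G y)"
    "\<And>i x. i \<in> idx r s \<Longrightarrow> x \<in> V \<Longrightarrow> G (J i (G x)) = - J i x"
    using fo by (auto simp: flip_operator_def)
  have HJH: "H (J i (H x)) = - J i x" if i: "i \<in> idx r s" and x: "x \<in> V" for i x
  proof -
    have "J i x = J i (G (H x))" using G(5)[OF x] by simp
    also have "\<dots> = H (G (J i (G (H x))))" using G(6)[OF JV[OF i G(3)[OF G(4)[OF x]]]] by simp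
    also have "\<dots> = - H (J i (H x))" using G(8)[OF i G(4)[OF x]] by (simp add: linear_neg[OF G(2)])
    finally show ?thesis by simp
  qed
  show ?thesis
  proof (rule clifford_form.intro)
    show "bilinear (\<lambda>x y. b (G x) y)" using bilinear_compose[OF bil G(1) linear_ident] .
    show "b (G x) y = b (G y) x" if "x \<in> V" "y \<in> V" for x y
      using G(7)[OF that] sym[OF that(1) G(3)[OF that(2)]] by simp
    show "x = 0" if "x \<in> V" "\<And>y. y \<in> V \<Longrightarrow> b (G x) y = 0" for x
      using nondeg[OF G(3)[OF that(1)]] that G(6)[OF that(1)] linear_0[OF G(2)] by metis
    fix j assume j': "j \<in> idx s r"
    then have j: "swap_idx j \<in> idx r s" by (rule swap_idx_idx)
    show "linear (\<lambda>x. H (J (swap_idx j) x))" using linear_compose[OF linJ[OF j] G(2)] by (simp add: o_def)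
    fix x assume x: "x \<in> V"
    show "H (J (swap_idx j) x) \<in> V" using G(4) JV[OF j x] by simp
    show "H (J (swap_idx j) (H (J (swap_idx j) x))) = - sgn_idx j *\<^sub>R x"
      using HJH[OF j JV[OF j x]] sqJ[OF j x] by simp
    show "b (G (H (J (swap_idx j) x))) y = - b (G x) (H (J (swap_idx j) y))" if y: "y \<in> V" for y
      using G(5)[OF JV[OF j x]] G(7)[OF x G(4)[OF JV[OF j y]]] G(5)[OF JV[OF j y]] skewJ[OF j x y] by simp
    show "H (J (swap_idx j) (H (J (swap_idx i) x))) = - H (J (swap_idx i) (H (J (swap_idx j) x)))"
      if "i \<in> idx s r" "j \<noteq> i" for i
      using HJH[OF j JV[OF swap_idx_idx[OF that(1)] x]] HJH[OF swap_idx_idx[OF that(1)] JV[OF j x]]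
        antiJ[OF j swap_idx_idx[OF that(1)] _ x] that(2) by simp
  qed (use sgn_idx_cases fdV in auto)
qed

section \<open>Direct sums and transport of structure\<close>

definition sum_form :: "('a \<Rightarrow> 'a \<Rightarrow> real) \<Rightarrow> ('b \<Rightarrow> 'b \<Rightarrow> real) \<Rightarrow> 'a \<times> 'b \<Rightarrow> 'a \<times> 'b \<Rightarrow> real" where
  "sum_form b c v w = b (fst v) (fst w) + c (snd v) (snd w)"

lemma linear_map_prod:
  assumes "linear f" "linear g"
  shows "linear (map_prod f g)"
  by (intro linearI) (auto simp: linear_add[OF assms(1)] linear_add[OF assms(2)]
      linear_scale[OF assms(1)] linear_scale[OF assms(2)])

lemma finite_dim_subspace_Times:
  assumes V: "finite_dim_subspace V" and W: "finite_dim_subspace W"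
  shows "finite_dim_subspace (V \<times> W)"
proof -
  obtain B C where B: "finite B" "span B = V" and C: "finite C" "span C = W"
    using assms by (auto simp: finite_dim_subspace_def)
  have sub: "subspace (V \<times> W)" using V W by (simp add: finite_dim_subspace_def subspace_Times)
  have l: "linear (\<lambda>x. (x, 0 :: 'b))" "linear (\<lambda>y. (0 :: 'a, y))" by (auto intro!: linearI)
  define E where "E = (\<lambda>x. (x, 0 :: 'b)) ` B \<union> (\<lambda>y. (0 :: 'a, y)) ` C"
  have "V \<times> W \<subseteq> span E"
  proof
    fix v assume "v \<in> V \<times> W"
    then have v: "fst v \<in> span B" "snd v \<in> span C" using B C by auto
    have "(fst v, 0) \<in> span ((\<lambda>x. (x, 0 :: 'b)) ` B)" "(0, snd v) \<in> span ((\<lambda>y. (0 :: 'a, y)) ` C)"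
      using v by (simp_all add: linear_span_image[OF l(1)] linear_span_image[OF l(2)])
    then have "(fst v, 0) \<in> span E" "(0, snd v) \<in> span E"
      using span_mono[of "(\<lambda>x. (x, 0 :: 'b)) ` B" E] span_mono[of "(\<lambda>y. (0 :: 'a, y)) ` C" E]
      by (auto simp: E_def)
    from span_add[OF this] show "v \<in> span E" by simp
  qed
  moreover have "span E \<subseteq> V \<times> W"
    using B C span_superset[of B] span_superset[of C] V W
    by (intro span_minimal sub) (auto simp: E_def finite_dim_subspace_def subspace_0)
  ultimately show ?thesis
    using sub B(1) C(1) unfolding finite_dim_subspace_def
    by (intro conjI exI[of _ E]) (auto simp: E_def)
qed

lemma clifford_form_sum:
  assumes "clifford_form I e V J b" "clifford_form I e W K c"
  shows "clifford_form I e (V \<times> W) (\<lambda>i. map_prod (J i) (K i)) (sum_form b c)"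
proof -
  interpret A: clifford_form I e V J b by fact
  interpret B: clifford_form I e W K c by fact
  show ?thesis
  proof (rule clifford_form.intro)
    show "finite_dim_subspace (V \<times> W)" by (rule finite_dim_subspace_Times[OF A.fdV B.fdV])
    show "bilinear (sum_form b c)"
      unfolding bilinear_def sum_form_def
      by (auto intro!: linearI simp: bilinear_ladd[OF A.bil] bilinear_radd[OF A.bil] bilinear_lmul[OF A.bil]
          bilinear_rmul[OF A.bil] bilinear_ladd[OF B.bil] bilinear_radd[OF B.bil] bilinear_lmul[OF B.bil]
          bilinear_rmul[OF B.bil] algebra_simps)
    show "sum_form b c v w = sum_form b c w v" if "v \<in> V \<times> W" "w \<in> V \<times> W" for v w
      using that A.sym[of "fst v" "fst w"] B.sym[of "snd v" "snd w"] by (auto simp: sum_form_def)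
    show "v = 0" if v: "v \<in> V \<times> W" and z: "\<And>w. w \<in> V \<times> W \<Longrightarrow> sum_form b c v w = 0" for v
    proof -
      have "fst v = 0"
      proof (rule A.nondeg)
        show "fst v \<in> V" using v by auto
        fix y assume "y \<in> V"
        then show "b (fst v) y = 0" using z[of "(y, 0)"] subspace_0[OF B.subV]
          by (simp add: sum_form_def bilinear_rzero[OF B.bil])
      qed
      moreover have "snd v = 0"
      proof (rule B.nondeg)
        show "snd v \<in> W" using v by auto
        fix y assume "y \<in> W"
        then show "c (snd v) y = 0" using z[of "(0, y)"] subspace_0[OF A.subV]
          by (simp add: sum_form_def bilinear_rzero[OF A.bil])
      qed
      ultimately show ?thesis by (simp add: prod_eq_iff)
    qed
  qed (auto simp: A.finI sum_form_def A.JV B.JV A.sqJ B.sqJ A.antiJ[of _ _ "fst _"] A.skewJ B.skewJ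
      intro: linear_map_prod A.linJ B.linJ A.antiJ B.antiJ dest: A.sign)
qed

lemma clifford_act_map_prod:
  "clifford_act r s (\<lambda>i. map_prod (J i) (K i)) z (x, y) = (clifford_act r s J z x, clifford_act r s K z y)"
  by (simp add: clifford_act_def prod_eq_iff fst_sum snd_sum)

lemma represents_module_sum:
  assumes "represents r s U J b" "represents r s V K c"
  shows "represents r s (module_sum U V) (\<lambda>i. map_prod (J i) (K i)) (sum_form b c)"
  using assms clifford_form_sum[of "idx r s" sgn_idx "mspace U" J b "mspace V" K c]
  by (auto simp: represents_def module_sum_def clifford_act_map_prod sum_form_def)

text \<open>The conditions on a flip operator do not notice a common sign \<open>d\<close> of the
  generators or a factor \<open>t\<close> of the form, and this is the ambiguity left by
  \<open>simple_forms_similar\<close>.\<close>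

lemma flip_operator_transport:
  fixes f :: "'a::real_vector \<Rightarrow> 'b::real_vector"
  assumes fo: "flip_operator V (J ` I) {} b G H" and W: "subspace W" and f: "linear f" "bij_betw f W V"
    and KW: "\<And>i x. i \<in> I \<Longrightarrow> x \<in> W \<Longrightarrow> K i x \<in> W"
    and d: "d * d = 1" "\<And>i x. i \<in> I \<Longrightarrow> x \<in> W \<Longrightarrow> J i (f x) = d *\<^sub>R f (K i x)"
    and t: "t \<noteq> 0" "\<And>x y. x \<in> W \<Longrightarrow> y \<in> W \<Longrightarrow> b (f x) (f y) = t * c x y"
  shows "\<exists>G H. flip_operator W (K ` I) {} c G H"
proof -
  have G: "linear G" "linear H" "\<And>x. x \<in> V \<Longrightarrow> G x \<in> V" "\<And>x. x \<in> V \<Longrightarrow> H x \<in> V"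
    "\<And>x. x \<in> V \<Longrightarrow> G (H x) = x" "\<And>x. x \<in> V \<Longrightarrow> H (G x) = x"
    "\<And>x y. x \<in> V \<Longrightarrow> y \<in> V \<Longrightarrow> b (G x) y = b x (G y)"
    "\<And>i x. i \<in> I \<Longrightarrow> x \<in> V \<Longrightarrow> G (J i (G x)) = - J i x"
    using fo by (auto simp: flip_operator_def)
  obtain g where g: "linear g" "bij_betw g V W" "\<And>x. x \<in> W \<Longrightarrow> g (f x) = x" "\<And>y. y \<in> V \<Longrightarrow> f (g y) = y"
    using linear_bij_betw_inverse[OF W f] by metis
  have fV: "f x \<in> V" if "x \<in> W" for x using f(2) that by (auto simp: bij_betw_def)
  have gW: "g x \<in> W" if "x \<in> V" for x using g(2) that by (auto simp: bij_betw_def)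
  have lin: "linear (\<lambda>x. g (F (f x)))" if "linear F" for F
    using linear_compose[OF linear_compose[OF f(1) that] g(1)] by (simp add: o_def)
  have fK: "f (K i x) = d *\<^sub>R J i (f x)" if "i \<in> I" "x \<in> W" for i x
    using d(2)[OF that] d(1) by simp
  have "flip_operator W (K ` I) {} c (\<lambda>x. g (G (f x))) (\<lambda>x. g (H (f x)))"
    unfolding flip_operator_def
  proof (intro conjI ballI)
    show "linear (\<lambda>x. g (G (f x)))" "linear (\<lambda>x. g (H (f x)))" using lin G(1,2) by auto
    show "(\<lambda>x. g (G (f x))) ` W \<subseteq> W" "(\<lambda>x. g (H (f x))) ` W \<subseteq> W" using G(3,4) fV gW by auto
    fix x assume x: "x \<in> W"
    show "g (G (f (g (H (f x))))) = x" "g (H (f (g (G (f x))))) = x"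
      using x G fV g by simp_all
    fix y assume y: "y \<in> W"
    have "t * c (g (G (f x))) y = t * c x (g (G (f y)))"
      using t(2)[OF gW[OF G(3)[OF fV[OF x]]] y] t(2)[OF x gW[OF G(3)[OF fV[OF y]]]]
        G(7)[OF fV[OF x] fV[OF y]] g(4)[OF G(3)[OF fV[OF x]]] g(4)[OF G(3)[OF fV[OF y]]] by simp
    then show "c (g (G (f x))) y = c x (g (G (f y)))" using t(1) by simp
  next
    fix h x assume "h \<in> K ` I" and x: "x \<in> W"
    then obtain i where i: "i \<in> I" "h = K i" by auto
    have GfV: "G (f x) \<in> V" using G(3) fV x by simp
    have "g (G (f (K i (g (G (f x)))))) = d *\<^sub>R g (G (J i (G (f x))))"
      using fK[OF i(1) gW[OF GfV]] g(4)[OF GfV] by (simp add: linear_scale[OF G(1)] linear_scale[OF g(1)])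
    also have "\<dots> = - (d *\<^sub>R g (J i (f x)))"
      using G(8)[OF i(1) fV[OF x]] by (simp add: linear_neg[OF g(1)])
    also have "\<dots> = - K i x"
      using d(2)[OF i(1) x] d(1) g(3)[OF KW[OF i(1) x]] by (simp add: linear_scale[OF g(1)])
    finally show "g (G (f (h (g (G (f x)))))) = - h x" using i by simp
  qed auto
  then show ?thesis by blast
qed

lemma linearly_isomorphic_trans:
  assumes "linearly_isomorphic U V" "linearly_isomorphic V W"
  shows "linearly_isomorphic U W"
  using assms unfolding linearly_isomorphic_def by (meson bij_betw_trans linear_compose)

lemma linearly_isomorphic_Times:
  assumes "linearly_isomorphic V V'" "linearly_isomorphic W W'"
  shows "linearly_isomorphic (V \<times> W) (V' \<times> W')"
proof -
  obtain f g where f: "linear f" "bij_betw f V V'" and g: "linear g" "bij_betw g W W'"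
    using assms by (auto simp: linearly_isomorphic_def)
  show ?thesis unfolding linearly_isomorphic_def
    using linear_map_prod[OF f(1) g(1)] bij_betw_map_prod[OF f(2) g(2)] by blast
qed

lemma linearly_isomorphic_refl: "linearly_isomorphic V V"
  unfolding linearly_isomorphic_def by (intro exI[of _ "\<lambda>x. x"]) (simp add: linear_ident bij_betw_def)

abbreviation twisted_double :: "real \<Rightarrow> (nat + nat \<Rightarrow> 'a::real_vector \<Rightarrow> 'a) \<Rightarrow> nat + nat \<Rightarrow> 'a \<times> 'a \<Rightarrow> 'a \<times> 'a" where
  "twisted_double t J i \<equiv> map_prod (J i) (\<lambda>x. t *\<^sub>R J i x)"

text \<open>
  The property propagated along the periodicity, for the signature \<open>(r, s)\<close>. The sign \<open>t\<close>
  distinguishes \<open>V \<oplus> V\<close> from the sum of \<open>V\<close> with the module on which \<open>J\<close> is replaced by \<open>-J\<close>.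
\<close>

definition flippable ::
    "'a::real_vector itself \<Rightarrow> 'b::real_vector itself \<Rightarrow> real \<Rightarrow> nat \<Rightarrow> nat \<Rightarrow> bool" where
  "flippable _ _ t r s \<longleftrightarrow>
     (\<forall>(V :: 'a set) J b (W :: 'b set) K c.
        clifford_rep r s V J b \<and> simple_form V (J ` idx r s) b \<and>
        clifford_rep s r W K c \<and> simple_form W (K ` idx s r) c \<longrightarrow>
        linearly_isomorphic (V \<times> V) W \<and>
        (\<exists>G H. flip_operator (V \<times> V) (twisted_double t J ` idx r s) {} (sum_form b b) G H))"

text \<open>By uniqueness of simple modules one example decides the property. The new modules may
  have other carrier types, which lets the conclusion of the theorem speak about types different
  from those of its hypothesis.\<close>

lemma flippable_transfer:
  fixes V :: "'a::real_vector set" and W :: "'b::real_vector set"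
  assumes V: "clifford_rep r s V J b" "simple_form V (J ` idx r s) b"
    and W: "clifford_rep s r W K c" "simple_form W (K ` idx s r) c"
    and iso: "linearly_isomorphic (V \<times> V) W"
    and fo: "flip_operator (V \<times> V) (twisted_double t J ` idx r s) {} (sum_form b b) G H"
  shows "flippable TYPE('c::real_vector) TYPE('d::real_vector) t r s"
  unfolding flippable_def
proof (intro allI impI)
  fix V' :: "'c set" and J' b' and W' :: "'d set" and K' c'
  assume "clifford_rep r s V' J' b' \<and> simple_form V' (J' ` idx r s) b' \<and>
        clifford_rep s r W' K' c' \<and> simple_form W' (K' ` idx s r) c'"
  then have V': "clifford_rep r s V' J' b'" "simple_form V' (J' ` idx r s) b'"
    and W': "clifford_rep s r W' K' c'" "simple_form W' (K' ` idx s r) c'" by auto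
  interpret V: clifford_form_pair "idx r s" sgn_idx V' J' b' V J b
    using V V' by (simp add: clifford_form_pair_def)
  interpret W: clifford_form_pair "idx s r" sgn_idx W K c W' K' c'
    using W W' by (simp add: clifford_form_pair_def)
  obtain d f T where d: "d = 1 \<or> d = - 1" "f = 1 \<or> f = - 1" and T: "linear T" "bij_betw T V' V"
    "\<And>i x. i \<in> idx r s \<Longrightarrow> x \<in> V' \<Longrightarrow> J i (T x) = d *\<^sub>R T (J' i x)"
    "\<And>x y. x \<in> V' \<Longrightarrow> y \<in> V' \<Longrightarrow> b (T x) (T y) = f * b' x y"
    by (rule V.simple_forms_similar[OF V'(2) V(2)]) (rule that)
  obtain S where S: "linear S" "bij_betw S W W'"
    by (rule W.simple_forms_similar[OF W(2) W'(2)]) (rule that)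
  have TV: "linearly_isomorphic V' V" and SW: "linearly_isomorphic W W'"
    using T(1,2) S by (auto simp: linearly_isomorphic_def)
  have "linearly_isomorphic (V' \<times> V') W'"
    using linearly_isomorphic_trans[OF linearly_isomorphic_trans[OF linearly_isomorphic_Times[OF TV TV] iso] SW] .
  moreover have "\<exists>G H. flip_operator (V' \<times> V') (twisted_double t J' ` idx r s) {} (sum_form b' b') G H"
  proof (rule flip_operator_transport[OF fo])
    show "subspace (V' \<times> V')" using V.c1.subV by (simp add: subspace_Times)
    show "linear (map_prod T T)" using linear_map_prod[OF T(1,1)] .
    show "bij_betw (map_prod T T) (V' \<times> V') (V \<times> V)" using bij_betw_map_prod[OF T(2,2)] .
    show "d * d = 1" "f \<noteq> 0" using d by auto
    fix v assume v: "v \<in> V' \<times> V'"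
    show "sum_form b b (map_prod T T v) (map_prod T T w) = f * sum_form b' b' v w" if "w \<in> V' \<times> V'" for w
      using v that T(4) by (auto simp: sum_form_def distrib_left)
    fix i assume i: "i \<in> idx r s"
    show "twisted_double t J' i v \<in> V' \<times> V'"
      using v V.c1.JV[OF i] V.c1.subV by (auto simp: subspace_scale)
    show "twisted_double t J i (map_prod T T v) = d *\<^sub>R map_prod T T (twisted_double t J' i v)"
      using v T(3)[OF i] by (auto simp: linear_scale[OF T(1)] mult.commute)
  qed
  ultimately show "linearly_isomorphic (V' \<times> V') W' \<and>
      (\<exists>G H. flip_operator (V' \<times> V') (twisted_double t J' ` idx r s) {} (sum_form b' b') G H)" by blast
qed

section \<open>Periodicity\<close>

text \<open>
  For \<open>(dr, ds) = (4, 4)\<close> the negative generators are chosen as the codeword \<open>0, 5, 6, 7\<close>, which meets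
  every codeword in an even number of places.
\<close>

lemma octet_index:
  assumes "(dr, ds) \<in> {(0, 8), (8, 0), (4, 4)}"
  obtains k :: "nat \<Rightarrow> nat + nat" where "inj_on k {..<8}" "\<And>n. n < 8 \<Longrightarrow> k n \<in> idx (r + dr) (s + ds)"
    "idx (r + dr) (s + ds) - k ` {..<8} = idx r s"
    "sgn_idx (k 0) * sgn_idx (k 5) * sgn_idx (k 6) * sgn_idx (k 7) = 1"
    "sgn_idx (k 1) * sgn_idx (k 4) * sgn_idx (k 6) * sgn_idx (k 7) = 1"
    "sgn_idx (k 2) * sgn_idx (k 4) * sgn_idx (k 5) * sgn_idx (k 7) = 1"
    "sgn_idx (k 3) * sgn_idx (k 4) * sgn_idx (k 5) * sgn_idx (k 6) = 1"
proof -
  have diff: "idx (r + dr) (s + ds) - k ` {..<8} = idx r s"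
    if "k ` {..<8} = Inl ` {r..<r + dr} \<union> Inr ` {s..<s + ds}" for k :: "nat \<Rightarrow> nat + nat"
    unfolding that by (auto simp: idx_def)
  consider "dr = 0" "ds = 8" | "dr = 8" "ds = 0" | "dr = 4" "ds = 4" using assms by auto
  then show ?thesis
  proof cases
    case 1
    have "(\<lambda>n. Inr (s + n) :: nat + nat) ` {..<8} = Inr ` ((+) s ` {0..<8})"
      by (simp add: image_image atLeast0LessThan)
    also have "\<dots> = Inl ` {r..<r + dr} \<union> Inr ` {s..<s + ds}" using 1 by (simp add: add.commute)
    finally have d: "idx (r + dr) (s + ds) - (\<lambda>n. Inr (s + n)) ` {..<8} = idx r s" by (rule diff)
    show ?thesis by (rule that[OF _ _ d]) (auto simp: inj_on_def idx_def sgn_idx_def 1)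
  next
    case 2
    have "(\<lambda>n. Inl (r + n) :: nat + nat) ` {..<8} = Inl ` ((+) r ` {0..<8})"
      by (simp add: image_image atLeast0LessThan)
    also have "\<dots> = Inl ` {r..<r + dr} \<union> Inr ` {s..<s + ds}" using 2 by (simp add: add.commute)
    finally have d: "idx (r + dr) (s + ds) - (\<lambda>n. Inl (r + n)) ` {..<8} = idx r s" by (rule diff)
    show ?thesis by (rule that[OF _ _ d]) (auto simp: inj_on_def idx_def sgn_idx_def 2)
  next
    case 3
    define k :: "nat \<Rightarrow> nat + nat"
      where "k n = (if n = 0 then Inr s else if n < 5 then Inl (r + (n - 1)) else Inr (s + (n - 4)))" for n
    have "k ` {..<8} = Inl ` {r..<r + 4} \<union> Inr ` {s..<s + 4}"
    proof -
      have "{..<8} = {0, 1, 2, 3, 4, 5, 6, 7 :: nat}" by auto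
      moreover have "{r..<r + 4} = {r, r + 1, r + 2, r + 3}" "{s..<s + 4} = {s, s + 1, s + 2, s + 3}" by auto
      ultimately show ?thesis by (auto simp: k_def)
    qed
    then have d: "idx (r + dr) (s + ds) - k ` {..<8} = idx r s" using 3 by (intro diff) simp
    show ?thesis by (rule that[OF _ _ d]) (auto simp: inj_on_def idx_def sgn_idx_def k_def 3 split: if_splits)
  qed
qed

text \<open>The modules of the larger signature are cut down to \<open>stage 4\<close>, where they
  are simple for \<open>(r, s)\<close> and \<open>(s, r)\<close> and \<open>fl\<close> applies. The
  linear isomorphism and the flip operator obtained there are then carried back up.\<close>

lemma flippable_octet:
  assumes fl: "flippable TYPE('a::real_vector) TYPE('b::real_vector) t r s" and t: "t * t = 1"
    and dd: "(dr, ds) \<in> {(0, 8), (8, 0), (4, 4)}"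
  shows "flippable TYPE('a) TYPE('b) t (r + dr) (s + ds)"
  unfolding flippable_def
proof (intro allI impI)
  let ?I = "idx (r + dr) (s + ds)" and ?I' = "idx (s + ds) (r + dr)"
  fix V :: "'a set" and J b and W :: "'b set" and K c
  assume "clifford_rep (r + dr) (s + ds) V J b \<and> simple_form V (J ` ?I) b \<and>
    clifford_rep (s + ds) (r + dr) W K c \<and> simple_form W (K ` ?I') c"
  then have V: "clifford_rep (r + dr) (s + ds) V J b" "simple_form V (J ` ?I) b"
    and W: "clifford_rep (s + ds) (r + dr) W K c" "simple_form W (K ` ?I') c" by auto
  obtain k :: "nat \<Rightarrow> nat + nat" where k: "inj_on k {..<8}" "\<And>n. n < 8 \<Longrightarrow> k n \<in> ?I" "?I - k ` {..<8} = idx r s"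
    "sgn_idx (k 0) * sgn_idx (k 5) * sgn_idx (k 6) * sgn_idx (k 7) = 1"
    "sgn_idx (k 1) * sgn_idx (k 4) * sgn_idx (k 6) * sgn_idx (k 7) = 1"
    "sgn_idx (k 2) * sgn_idx (k 4) * sgn_idx (k 5) * sgn_idx (k 7) = 1"
    "sgn_idx (k 3) * sgn_idx (k 4) * sgn_idx (k 5) * sgn_idx (k 6) = 1"
    using octet_index[OF dd, of r s] by metis
  have dd': "(ds, dr) \<in> {(0, 8), (8, 0), (4, 4)}" using dd by auto
  obtain m :: "nat \<Rightarrow> nat + nat" where m: "inj_on m {..<8}" "\<And>n. n < 8 \<Longrightarrow> m n \<in> ?I'" "?I' - m ` {..<8} = idx s r"
    "sgn_idx (m 0) * sgn_idx (m 5) * sgn_idx (m 6) * sgn_idx (m 7) = 1"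
    "sgn_idx (m 1) * sgn_idx (m 4) * sgn_idx (m 6) * sgn_idx (m 7) = 1"
    "sgn_idx (m 2) * sgn_idx (m 4) * sgn_idx (m 5) * sgn_idx (m 7) = 1"
    "sgn_idx (m 3) * sgn_idx (m 4) * sgn_idx (m 5) * sgn_idx (m 6) = 1"
    using octet_index[OF dd', of s r] by metis
  have VV: "clifford_rep (r + dr) (s + ds) (V \<times> V) (twisted_double t J) (sum_form b b)"
    using clifford_form_sum[OF V(1) clifford_form.clifford_form_scale[OF V(1) t]] .
  interpret A: clifford_octet ?I sgn_idx V J b k
    using V(1) k by (simp add: clifford_octet_def clifford_octet_axioms_def)
  interpret B: clifford_octet ?I' sgn_idx W K c m
    using W(1) m by (simp add: clifford_octet_def clifford_octet_axioms_def)
  interpret D: clifford_octet ?I sgn_idx "V \<times> V" "twisted_double t J" "sum_form b b" k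
    using VV k by (simp add: clifford_octet_def clifford_octet_axioms_def)
  have rest: "A.rest = idx r s" "B.rest = idx s r" "D.rest = idx r s"
    using k(3) m(3) by (simp_all add: A.rest_def B.rest_def D.rest_def)
  have DA: "D.A n (x, y) = (A.A n x, t *\<^sub>R A.A n y)" for n x y
    by (simp add: D.A_def A.A_def)
  \<comment> \<open>Four factors contribute \<open>t ^ 4 = 1\<close>, so the involutions act alike
    on both summands, and the stage of the twisted double is the double of the stage.\<close>
  have DQ: "D.Q n (x, y) = (A.Q n x, A.Q n y)" if "n < 4" "x \<in> V" "y \<in> V" for n x y
    using that(1) t by (auto dest!: A.less_4_cases
        simp: D.Q_def A.Q_def DA A.A_scale mult.assoc[symmetric])
  have stage: "D.stage 4 = A.stage 4 \<times> A.stage 4"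
    by (auto simp: D.stage_def A.stage_def DQ)
  have "linearly_isomorphic (A.stage 4 \<times> A.stage 4) (B.stage 4) \<and>
      (\<exists>G H. flip_operator (A.stage 4 \<times> A.stage 4) (twisted_double t J ` idx r s) {} (sum_form b b) G H)"
    using fl[unfolded flippable_def] A.clifford_form_stage B.clifford_form_stage
      A.simple_core[OF V(2)] B.simple_core[OF W(2)] unfolding rest by blast
  then obtain G H where iso: "linearly_isomorphic (D.stage 4) (B.stage 4)"
    and fo: "flip_operator (D.stage 4) (twisted_double t J ` D.rest) {} (sum_form b b) G H"
    unfolding stage rest by blast
  show "linearly_isomorphic (V \<times> V) W \<and>
      (\<exists>G H. flip_operator (V \<times> V) (twisted_double t J ` ?I) {} (sum_form b b) G H)"
    using linearly_isomorphic_octet[OF D.clifford_octet_axioms B.clifford_octet_axioms iso]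
      D.flip_operator_core[OF fo] by blast
qed

lemma flippable_periodic:
  assumes "flippable TYPE('a::real_vector) TYPE('b::real_vector) t r s" "t * t = 1"
    "(dr, ds) \<in> {(0, 8), (8, 0), (4, 4)}"
  shows "flippable TYPE('a) TYPE('b) t (r + dr * k) (s + ds * k)"
proof (induction k)
  case 0
  then show ?case using assms(1) by simp
next
  case (Suc k)
  from flippable_octet[OF this assms(2,3)] show ?case by (simp add: add_ac)
qed

text \<open>This excludes \<open>r = s\<close>: both algebras would then be built from simple
  modules of the same signature, which have equal dimension, and a nonzero space is smaller than its
  double.\<close>

lemma simple_not_double:
  fixes V :: "'b::real_vector set"
  assumes V: "clifford_form I e V J b" "simple_form V (J ` I) b"
    and W: "clifford_form I e W K c" "simple_form W (K ` I) c"
    and iso: "linearly_isomorphic (V \<times> V) W"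
  shows False
proof -
  interpret P: clifford_form_pair I e W K c V J b using V W by (simp add: clifford_form_pair_def)
  obtain S where S: "linear S" "bij_betw S W V"
    by (rule P.simple_forms_similar[OF W(2) V(2)]) (rule that)
  have "linearly_isomorphic (V \<times> V) V"
    using linearly_isomorphic_trans[OF iso] S by (auto simp: linearly_isomorphic_def)
  moreover have fd: "finite_dim_subspace (V \<times> V)" using finite_dim_subspace_Times[OF P.c2.fdV P.c2.fdV] .
  ultimately have dim: "dim (V \<times> V) = dim V" using linearly_isomorphic_dim by blast
  have l: "linear (\<lambda>x. (x, 0 :: 'b))" by (auto intro!: linearI)
  have inj: "inj_on (\<lambda>x. (x, 0 :: 'b)) V" by (simp add: inj_on_def)
  have sub: "(\<lambda>x. (x, 0)) ` V \<subseteq> V \<times> V" using subspace_0[OF P.c2.subV] by auto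
  have "(\<lambda>x. (x, 0)) ` V = V \<times> V"
    using finite_dim_subspace_dim_eq[OF fd linear_subspace_image[OF l P.c2.subV] sub]
      dim_linear_image(1)[OF P.c2.fdV l inj] dim by simp
  then have "y = 0" if "y \<in> V" for y using that subspace_0[OF P.c2.subV] by (metis (no_types, lifting) SigmaI imageE prod.inject)
  then show False using V(2) subspace_0[OF P.c2.subV] by (auto simp: simple_form_def)
qed

lemma double_summands_twisted_double:
  fixes V1 V2 :: "'a::real_vector form_module"
  assumes ds: "double_summands r s V1 V2"
  obtains J b K c F where "clifford_rep r s (mspace V1) J b" "simple_form (mspace V1) (J ` idx r s) b"
    "represents r s (module_sum V1 V2) K c"
    "linear F" "bij_betw F (mspace V1 \<times> mspace V1) (mspace (module_sum V1 V2))"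
    "\<And>i v. i \<in> idx r s \<Longrightarrow> v \<in> mspace V1 \<times> mspace V1 \<Longrightarrow>
      K i (F v) = F (twisted_double (second_sign r s) J i v)"
    "\<And>v w. v \<in> mspace V1 \<times> mspace V1 \<Longrightarrow> w \<in> mspace V1 \<times> mspace V1 \<Longrightarrow>
      c (F v) (F w) = sum_form b b v w"
proof -
  have min: "minimal_admissible r s V1"
    using ds by (auto simp: double_summands_def minimal_plus_def split: if_splits)
  then obtain J b where rep: "represents r s V1 J b"
    using admissible_represents[of r s V1] by (auto simp: minimal_admissible_def)
  then have cr: "clifford_rep r s (mspace V1) J b" by (simp add: represents_def)
  obtain T J' b' where T: "represents r s V2 J' b'" "linear T" "bij_betw T (mspace V1) (mspace V2)"
    "\<And>i x. i \<in> idx r s \<Longrightarrow> x \<in> mspace V1 \<Longrightarrow> J' i (T x) = second_sign r s *\<^sub>R T (J i x)"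
    "\<And>x y. x \<in> mspace V1 \<Longrightarrow> y \<in> mspace V1 \<Longrightarrow> b' (T x) (T y) = b x y"
    by (rule double_summands_represents[OF ds rep]) (rule that)
  show ?thesis
  proof (rule that[OF cr minimal_simple[OF min cr linearly_isomorphic_refl] represents_module_sum[OF rep T(1)]])
    show "linear (map_prod (\<lambda>x. x) T)" using linear_map_prod[OF linear_ident T(2)] .
    have "bij_betw (\<lambda>x. x) (mspace V1) (mspace V1)" by (simp add: bij_betw_def)
    from bij_betw_map_prod[OF this T(3)]
    show "bij_betw (map_prod (\<lambda>x. x) T) (mspace V1 \<times> mspace V1) (mspace (module_sum V1 V2))"
      by (simp add: module_sum_def)
    fix v assume v: "v \<in> mspace V1 \<times> mspace V1"
    show "map_prod (J i) (J' i) (map_prod (\<lambda>x. x) T v)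
        = map_prod (\<lambda>x. x) T (twisted_double (second_sign r s) J i v)" if "i \<in> idx r s" for i
      using v T(4)[OF that] by (auto simp: linear_scale[OF T(2)])
    show "sum_form b b' (map_prod (\<lambda>x. x) T v) (map_prod (\<lambda>x. x) T w) = sum_form b b v w"
      if "w \<in> mspace V1 \<times> mspace V1" for w
      using v that T(5) by (auto simp: sum_form_def)
  qed
qed

lemma lie_isomorphic_linearly_isomorphic:
  fixes U :: "'a::real_vector form_module" and V :: "'b::real_vector form_module"
  assumes repU: "represents r s U J b" and repV: "represents s r V K c"
    and iso: "lie_isomorphic (pseudo_H_algebra r s U) (pseudo_H_algebra s r V)"
  shows "linearly_isomorphic (mspace U) (mspace V)"
proof (cases "r + s = 0")
  case False
  then have rs: "r + s > 0" "s + r > 0" by auto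
  obtain A where "linear A" "bij_betw A (mspace U) (mspace V)"
    by (rule lie_isomorphism_components[OF repU repV rs iso]) (rule that)
  then show ?thesis by (auto simp: linearly_isomorphic_def)
next
  \<comment> \<open>Here the algebra is abelian and the centre no longer singles out
    \<open>pseudo_space r s\<close>. That space is zero, however, so \<open>f\<close> itself is
    essentially the required map.\<close>
  case True
  interpret clifford_form "idx r s" sgn_idx "mspace U" J b using repU by (simp add: represents_def)
  have Z: "pseudo_space r s = {0}" "pseudo_space s r = {0}"
    using True by (auto simp: pseudo_space_def)
  obtain f where f: "linear_on (mspace U \<times> {0}) (mspace V \<times> {0}) f" "bij_betw f (mspace U \<times> {0}) (mspace V \<times> {0})"
    and "\<forall>x\<in>mspace U \<times> {0}. \<forall>y\<in>mspace U \<times> {0}. f (lie_bracket (pseudo_H_algebra r s U) x y)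
      = lie_bracket (pseudo_H_algebra s r V) (f x) (f y)"
    using iso unfolding lie_isomorphic_def pseudo_H_algebra_simps(1) Z by (elim exE conjE)
  obtain p :: "'a \<Rightarrow> 'a" where p: "linear p" "\<And>x. p x \<in> mspace U" "\<And>x. x \<in> mspace U \<Longrightarrow> p x = x"
    using subspace_projection[OF subV] by metis
  define A where "A x = fst (f (p x, 0))" for x
  have "linear A"
  proof (rule linearI)
    fix x y k
    have "(p (x + y), 0) = (p x, 0) + (p y, 0 :: nat \<Rightarrow>\<^sub>0 real)" "(p (k *\<^sub>R x), 0) = k *\<^sub>R (p x, 0 :: nat \<Rightarrow>\<^sub>0 real)"
      by (simp_all add: linear_add[OF p(1)] linear_scale[OF p(1)])
    moreover have "f ((p x, 0) + (p y, 0)) = f (p x, 0) + f (p y, 0)" "f (k *\<^sub>R (p x, 0)) = k *\<^sub>R f (p x, 0)"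
      using f(1) p(2) unfolding linear_on_def by blast+
    ultimately show "A (x + y) = A x + A y" "A (k *\<^sub>R x) = k *\<^sub>R A x" unfolding A_def by simp_all
  qed
  moreover have "bij_betw A (mspace U) (mspace V)"
  proof -
    have 1: "bij_betw (\<lambda>x. (x, 0 :: nat \<Rightarrow>\<^sub>0 real)) (mspace U) (mspace U \<times> {0})"
      by (auto simp: bij_betw_def inj_on_def)
    have 2: "bij_betw fst (mspace V \<times> {0 :: nat \<Rightarrow>\<^sub>0 real}) (mspace V)"
      by (auto simp: bij_betw_def inj_on_def image_iff)
    have "bij_betw (fst \<circ> (f \<circ> (\<lambda>x. (x, 0)))) (mspace U) (mspace V)"
      by (rule bij_betw_trans[OF bij_betw_trans[OF 1 f(2)] 2])
    then show ?thesis using bij_betw_cong[of "mspace U" A "fst \<circ> (f \<circ> (\<lambda>x. (x, 0)))"] p(3) by (simp add: A_def)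
  qed
  ultimately show ?thesis by (auto simp: linearly_isomorphic_def)
qed

lemma flippable_of_lie_isomorphic:
  fixes L :: "(('a::real_vector \<times> 'a) \<times> (nat \<Rightarrow>\<^sub>0 real)) lie_algebra"
    and M :: "('b::real_vector \<times> (nat \<Rightarrow>\<^sub>0 real)) lie_algebra"
  assumes "is_N2 r s L" "is_N s r M" "lie_isomorphic L M"
  shows "flippable TYPE('c::real_vector) TYPE('d::real_vector) (second_sign r s) r s"
proof -
  obtain V1 V2 :: "'a form_module" where ds: "double_summands r s V1 V2"
    and L: "L = pseudo_H_algebra r s (module_sum V1 V2)" using assms(1) by (auto simp: is_N2_def)
  obtain V :: "'b form_module" where min: "minimal_admissible s r V" and M: "M = pseudo_H_algebra s r V"
    using assms(2) by (auto simp: is_N_def)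
  let ?X = "mspace V1" and ?U = "module_sum V1 V2"
  obtain J b K c F where cr: "clifford_rep r s ?X J b" "simple_form ?X (J ` idx r s) b"
    and repU: "represents r s ?U K c" and F: "linear F" "bij_betw F (?X \<times> ?X) (mspace ?U)"
    "\<And>i v. i \<in> idx r s \<Longrightarrow> v \<in> ?X \<times> ?X \<Longrightarrow> K i (F v) = F (twisted_double (second_sign r s) J i v)"
    "\<And>v w. v \<in> ?X \<times> ?X \<Longrightarrow> w \<in> ?X \<times> ?X \<Longrightarrow> c (F v) (F w) = sum_form b b v w"
    by (rule double_summands_twisted_double[OF ds]) (rule that)
  obtain K' c' where repV: "represents s r V K' c'"
    using admissible_represents[of s r V] min by (auto simp: minimal_admissible_def)
  then have crV: "clifford_rep s r (mspace V) K' c'" by (simp add: represents_def)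
  have sV: "simple_form (mspace V) (K' ` idx s r) c'"
    by (rule minimal_simple[OF min crV linearly_isomorphic_refl])
  have iso: "lie_isomorphic (pseudo_H_algebra r s ?U) (pseudo_H_algebra s r V)" using assms(3) L M by simp
  interpret X: clifford_form "idx r s" sgn_idx ?X J b by (rule cr(1))
  have subXX: "subspace (?X \<times> ?X)" using X.subV by (simp add: subspace_Times)
  have "linearly_isomorphic (?X \<times> ?X) (mspace ?U)" using F(1,2) by (auto simp: linearly_isomorphic_def)
  then have isoXV: "linearly_isomorphic (?X \<times> ?X) (mspace V)"
    using lie_isomorphic_linearly_isomorphic[OF repU repV iso] linearly_isomorphic_trans by blast
  \<comment> \<open>This is obtained from dimensions alone, before any flip operator is available:
    the construction of the latter relies on it to fix the sign of the factor.\<close>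
  have rs: "r \<noteq> s"
  proof
    assume "r = s"
    then show False using simple_not_double[OF cr _ _ isoXV, of K' c'] crV sV by simp
  qed
  have "mspace ?U \<noteq> {0}"
  proof
    assume "mspace ?U = {0}"
    moreover have "mspace V1 \<noteq> {0}" using cr(2) by (simp add: simple_form_def)
    moreover have "0 \<in> mspace V2"
      using repU calculation by (auto simp: module_sum_def zero_prod_def)
    ultimately show False by (auto simp: module_sum_def zero_prod_def)
  qed
  then obtain G H where fo: "flip_operator (mspace ?U) (K ` idx r s) {} c G H"
    using lie_isomorphic_flip_operator[OF repU repV _ rs iso] by blast
  have t: "second_sign r s * second_sign r s = 1" using second_sign_cases[of r s] by auto
  have "\<exists>G H. flip_operator (?X \<times> ?X) (twisted_double (second_sign r s) J ` idx r s) {} (sum_form b b) G H"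
  proof (rule flip_operator_transport[OF fo subXX F(1,2), where d = 1 and t = 1])
    show "twisted_double (second_sign r s) J i v \<in> ?X \<times> ?X" if "i \<in> idx r s" "v \<in> ?X \<times> ?X" for i v
      using that X.JV X.subV by (auto simp: subspace_scale)
  qed (use F(3,4) in auto)
  then obtain G H where "flip_operator (?X \<times> ?X) (twisted_double (second_sign r s) J ` idx r s) {} (sum_form b b) G H"
    by blast
  then show ?thesis by (rule flippable_transfer[OF cr crV sV isoXV])
qed

text \<open>Flipping the twisted double gives an admissible structure of signature
  \<open>(s, r)\<close> on a space of the same dimension as the minimal module \<open>V\<close>. It
  is therefore simple and, by uniqueness, similar to \<open>V\<close>.\<close>

lemma lie_isomorphic_of_flippable:
  fixes L :: "(('c::real_vector \<times> 'c) \<times> (nat \<Rightarrow>\<^sub>0 real)) lie_algebra"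
    and M :: "('d::real_vector \<times> (nat \<Rightarrow>\<^sub>0 real)) lie_algebra"
  assumes fl: "flippable TYPE('c) TYPE('d) (second_sign r s) r s"
    and "is_N2 r s L" "is_N s r M"
  shows "lie_isomorphic L M"
proof -
  obtain V1 V2 :: "'c form_module" where ds: "double_summands r s V1 V2"
    and L: "L = pseudo_H_algebra r s (module_sum V1 V2)" using assms(2) by (auto simp: is_N2_def)
  obtain V :: "'d form_module" where min: "minimal_admissible s r V" and M: "M = pseudo_H_algebra s r V"
    using assms(3) by (auto simp: is_N_def)
  let ?X = "mspace V1" and ?U = "module_sum V1 V2" and ?t = "second_sign r s"
  obtain J b K c F where cr: "clifford_rep r s ?X J b" "simple_form ?X (J ` idx r s) b"
    and repU: "represents r s ?U K c" and F: "linear F" "bij_betw F (?X \<times> ?X) (mspace ?U)"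
    "\<And>i v. i \<in> idx r s \<Longrightarrow> v \<in> ?X \<times> ?X \<Longrightarrow> K i (F v) = F (twisted_double ?t J i v)"
    "\<And>v w. v \<in> ?X \<times> ?X \<Longrightarrow> w \<in> ?X \<times> ?X \<Longrightarrow> c (F v) (F w) = sum_form b b v w"
    by (rule double_summands_twisted_double[OF ds]) (rule that)
  obtain K' c' where repV: "represents s r V K' c'"
    using admissible_represents[of s r V] min by (auto simp: minimal_admissible_def)
  then have crV: "clifford_rep s r (mspace V) K' c'" by (simp add: represents_def)
  have sV: "simple_form (mspace V) (K' ` idx s r) c'"
    by (rule minimal_simple[OF min crV linearly_isomorphic_refl])
  have t: "?t * ?t = 1" using second_sign_cases[of r s] by auto
  have crXX: "clifford_rep r s (?X \<times> ?X) (twisted_double ?t J) (sum_form b b)"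
    using clifford_form_sum[OF cr(1) clifford_form.clifford_form_scale[OF cr(1) t]] .
  interpret XX: clifford_form "idx r s" sgn_idx "?X \<times> ?X" "twisted_double ?t J" "sum_form b b" by (rule crXX)
  have isoXV: "linearly_isomorphic (?X \<times> ?X) (mspace V)"
    and "\<exists>G H. flip_operator (?X \<times> ?X) (twisted_double ?t J ` idx r s) {} (sum_form b b) G H"
    using fl cr crV sV unfolding flippable_def by blast+
  then obtain G H where fo: "flip_operator (?X \<times> ?X) (twisted_double ?t J ` idx r s) {} (sum_form b b) G H"
    by blast
  define N where "N j v = H (twisted_double ?t J (swap_idx j) v)" for j v
  have crN: "clifford_rep s r (?X \<times> ?X) N (\<lambda>v w. sum_form b b (G v) w)"
    unfolding N_def[abs_def] by (rule flip_clifford_rep[OF crXX fo])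
  have sN: "simple_form (?X \<times> ?X) (N ` idx s r) (\<lambda>v w. sum_form b b (G v) w)"
    by (rule minimal_simple[OF min crN isoXV])
  interpret P: clifford_form_pair "idx s r" sgn_idx "?X \<times> ?X" N "\<lambda>v w. sum_form b b (G v) w" "mspace V" K' c'
    using crN crV by (simp add: clifford_form_pair_def)
  obtain d f T where d: "d = 1 \<or> d = - 1" "f = 1 \<or> f = - 1" and T: "linear T" "bij_betw T (?X \<times> ?X) (mspace V)"
    "\<And>i x. i \<in> idx s r \<Longrightarrow> x \<in> ?X \<times> ?X \<Longrightarrow> K' i (T x) = d *\<^sub>R T (N i x)"
    "\<And>x y. x \<in> ?X \<times> ?X \<Longrightarrow> y \<in> ?X \<times> ?X \<Longrightarrow> c' (T x) (T y) = f * sum_form b b (G x) y"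
    by (rule P.simple_forms_similar[OF sN sV]) (rule that)
  obtain E where E: "linear E" "bij_betw E (mspace ?U) (?X \<times> ?X)" "\<And>y. y \<in> mspace ?U \<Longrightarrow> F (E y) = y"
    using linear_bij_betw_inverse[OF XX.subV F(1,2)] by metis
  have EX: "E x \<in> ?X \<times> ?X" if "x \<in> mspace ?U" for x using E(2) that by (auto simp: bij_betw_def)
  have GH: "G (H v) = v" if "v \<in> ?X \<times> ?X" for v using fo that unfolding flip_operator_def by blast
  have "lie_isomorphic (pseudo_H_algebra r s ?U) (pseudo_H_algebra s r V)"
  \<comment> \<open>The sign \<open>d\<close> stems from the comparison of the generators and
    \<open>f\<close> from that of the forms; the map of the centres compensates their
    product.\<close>
  proof (rule lie_isomorphic_swap[OF repU repV, where k = "d * f" and A = "T \<circ> E"])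
    show "d * f * (d * f) = 1" using d by auto
    show "linear (T \<circ> E)" using E(1) T(1) by (rule linear_compose)
    show "bij_betw (T \<circ> E) (mspace ?U) (mspace V)" using E(2) T(2) by (rule bij_betw_trans)
    fix j x y assume j: "j \<in> idx s r" and x: "x \<in> mspace ?U" and y: "y \<in> mspace ?U"
    let ?v = "E x" and ?w = "E y"
    have i: "swap_idx j \<in> idx r s" using j by (rule swap_idx_idx)
    have Jv: "twisted_double ?t J (swap_idx j) ?v \<in> ?X \<times> ?X" using XX.JV[OF i EX[OF x]] .
    have "c' (K' j (T ?v)) (T ?w) = d * c' (T (N j ?v)) (T ?w)"
      using T(3)[OF j EX[OF x]] by (simp add: bilinear_lmul[OF P.c2.bil])
    also have "\<dots> = d * f * sum_form b b (G (N j ?v)) ?w"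
      using T(4)[OF P.c1.JV[OF j EX[OF x]] EX[OF y]] by simp
    also have "G (N j ?v) = twisted_double ?t J (swap_idx j) ?v" using GH[OF Jv] by (simp add: N_def)
    also have "sum_form b b (twisted_double ?t J (swap_idx j) ?v) ?w = c (K (swap_idx j) x) y"
      using F(4)[OF Jv EX[OF y]] F(3)[OF i EX[OF x]] E(3)[OF x] E(3)[OF y] by simp
    finally show "c' (K' j ((T \<circ> E) x)) ((T \<circ> E) y) = d * f * c (K (swap_idx j) x) y" by simp
  qed
  then show ?thesis using L M by simp
qed

text \<open>In all three cases \<open>dr - ds\<close> is divisible by 4 and \<open>ds\<close> is
  even.\<close>

lemma second_sign_periodic:
  assumes "(dr, ds) \<in> {(0, 8), (8, 0), (4, 4)}"
  shows "second_sign (r + dr * k) (s + ds * k) = second_sign r s"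
proof -
  obtain a where a: "int dr - int ds = 4 * a" using assms by auto
  have "int (r + dr * k) - int (s + ds * k) = int r - int s + (a * int k) * 4"
    using arg_cong[OF a, of "\<lambda>x. x * int k"] by (simp add: algebra_simps)
  then have "(int (r + dr * k) - int (s + ds * k)) mod 4 = (int r - int s) mod 4"
    by (simp only: mod_mult_self1)
  moreover have "even (s + ds * k) = even s" using assms by auto
  ultimately show ?thesis by (simp add: second_sign_def)
qed

lemma lie_isomorphic_periodic:
  fixes L :: "(('a::real_vector \<times> 'a) \<times> (nat \<Rightarrow>\<^sub>0 real)) lie_algebra"
    and M :: "('b::real_vector \<times> (nat \<Rightarrow>\<^sub>0 real)) lie_algebra"
    and L' :: "(('c::real_vector \<times> 'c) \<times> (nat \<Rightarrow>\<^sub>0 real)) lie_algebra"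
    and M' :: "('d::real_vector \<times> (nat \<Rightarrow>\<^sub>0 real)) lie_algebra"
  assumes LM: "is_N2 r s L" "is_N s r M" "lie_isomorphic L M"
    and dd: "(dr, ds) \<in> {(0, 8), (8, 0), (4, 4)}"
    and "is_N2 (r + dr * k) (s + ds * k) L'" "is_N (s + ds * k) (r + dr * k) M'"
  shows "lie_isomorphic L' M'"
proof -
  have "second_sign r s * second_sign r s = 1" using second_sign_cases[of r s] by auto
  then have "flippable TYPE('c) TYPE('d) (second_sign r s) (r + dr * k) (s + ds * k)"
    by (rule flippable_periodic[OF flippable_of_lie_isomorphic[OF LM] _ dd])
  then show ?thesis
    using lie_isomorphic_of_flippable[of "r + dr * k" "s + ds * k" L' M'] assms(5,6)
    by (simp add: second_sign_periodic[OF dd])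
qed

theorem theorem12:
  fixes r s :: nat
    and L :: "(('a::real_vector \<times> 'a) \<times> (nat \<Rightarrow>\<^sub>0 real)) lie_algebra"
    and M :: "('b::real_vector \<times> (nat \<Rightarrow>\<^sub>0 real)) lie_algebra"
  assumes "is_N2 r s L" and "is_N s r M" and "lie_isomorphic L M"
  shows "\<forall>k\<ge>1.
    (\<forall>(L' :: (('c::real_vector \<times> 'c) \<times> (nat \<Rightarrow>\<^sub>0 real)) lie_algebra)
       (M' :: ('d::real_vector \<times> (nat \<Rightarrow>\<^sub>0 real)) lie_algebra).
       is_N2 r (s + 8 * k) L' \<and> is_N (s + 8 * k) r M' \<longrightarrow> lie_isomorphic L' M') \<and>
    (\<forall>(L' :: (('c \<times> 'c) \<times> (nat \<Rightarrow>\<^sub>0 real)) lie_algebra)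
       (M' :: ('d \<times> (nat \<Rightarrow>\<^sub>0 real)) lie_algebra).
       is_N2 (r + 8 * k) s L' \<and> is_N s (r + 8 * k) M' \<longrightarrow> lie_isomorphic L' M') \<and>
    (\<forall>(L' :: (('c \<times> 'c) \<times> (nat \<Rightarrow>\<^sub>0 real)) lie_algebra)
       (M' :: ('d \<times> (nat \<Rightarrow>\<^sub>0 real)) lie_algebra).
       is_N2 (r + 4 * k) (s + 4 * k) L' \<and> is_N (s + 4 * k) (r + 4 * k) M' \<longrightarrow>
         lie_isomorphic L' M')"
  by (auto intro: lie_isomorphic_periodic[OF assms, of 0 8, simplified]
      lie_isomorphic_periodic[OF assms, of 8 0, simplified]
      lie_isomorphic_periodic[OF assms, of 4 4, simplified])

end
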